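(* For symmetric forms, maximal $L^p$-regularity may fail for $p\in[1,\infty]$ and $\mathcal A\in\dot W^{1/2,q}([0,T];\mathcal B(V,V'))$ for some $q>2$. This is shown by the following example. Let $H=L^2([0,\tfrac12])$ and $V=L^2([0,\tfrac12],w)$ (the weighted space with weight $w$), where $w(x)=(x|\log x|)^{-3/2}$. Put $\phi(x)=w(x)$, $c(x)=x|\log x|$, and $$u(t,x)=c(x)\bigl(\sin(t\phi(x))+d\bigr),\qquad t\in[0,T],$$ for some sufficiently large $d>0$. Then: (1) $\dot u(t)\notin H$ for all $t\in[0,T]$. (2) $u$ is an integrated solution of a non-autonomous problem associated to some bounded coercive symmetric sesquilinear form $a\colon[0,T]\times V\times V\to\mathbb C$ and the inhomogeneous part $f(t)=u(t)$, $f\in L^\infty([0,T];V)$. The question of the fractional Sobolev regularity of the form $a$ (that is, of $t\mapsto\mathcal A(t)\in\mathcal B(V,V')$) reduces to the regularity of the mapping $u\colon[0,T]\to V$. (3) $u\in\dot W^{1/2,q}([0,T];V)$ for all $q\in(2,\infty)$.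
   Context: Forms: for Hilbert spaces $V,H$ with dense embedding $V\hookrightarrow H$, a mapping $a\colon[0,T]\times V\times V\to\mathbb C$ is a bounded coercive sesquilinear form if $a(t,\cdot,\cdot)$ is sesquilinear for all $t\in[0,T]$ and there are $\varepsilon,M>0$ with $\operatorname{Re}a(t,v,v)\ge\varepsilon\|v\|_V^2$ and $|a(t,v,z)|\le M\|v\|_V\|z\|_V$ for all $t\in[0,T]$ and $v,z\in V$; it is symmetric if $a(t,v,z)=\overline{a(t,z,v)}$. It induces operators $\mathcal A(t)\colon V\to V'$ by $\langle\mathcal A(t)v,z\rangle=a(t,v,z)$, and $A(t)$ denotes the part of $\mathcal A(t)$ in $H$. Here $V\hookrightarrow H\hookrightarrow V'$. That $u$ is an integrated solution for the inhomogeneous part $f$ means that it satisfies $\dot u(t)+\mathcal A(t)u(t)=f(t)$ in $V'$. Maximal regularity: the problem $\dot u(t)+A(t)u(t)=f(t)$, $u(0)=u_0$ on $H$ has maximal $L^p$-regularity if for all $f\in L^p([0,T];H)$ and all $u_0$ in the real interpolation space $(D(A(0)),H)_{1/p,p}$ there is a unique solution $u\in L^p([0,T];H)$ with $u(t)\in D(A(t))$ for almost all $t\in[0,T]$ and $\dot u,A(\cdot)u(\cdot)\in L^p([0,T];H)$, and there is $C>0$ with $\|u\|_{W^{1,p}([0,T];H)}+\|A(\cdot)u(\cdot)\|_{L^p([0,T];H)}\le C(\|f\|_{L^p([0,T];H)}+\|u_0\|_{(D(A(0)),H)_{1/p,p}})$. Fractional Sobolev spaces: for $\alpha\in(0,1)$,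 $q\in(1,\infty)$ and a Banach space $Y$, a Bochner measurable $g\colon[0,T]\to Y$ lies in $\dot W^{\alpha,q}([0,T];Y)$ if $\left(\int_0^T\int_0^T\frac{\|g(t)-g(s)\|_Y^q}{|t-s|^{1+\alpha q}}\,ds\,dt\right)^{1/q}<\infty$. *)

theory Defs
  imports "HOL-Analysis.Analysis" "HOL-Probability.Essential_Supremum"
begin

section \<open>Complex inner product spaces\<close>

text \<open>The distribution only has real inner products. The complex inner product is linear in
  its first and antilinear in its second argument.\<close>

class complex_inner = real_inner +
  fixes scaleC :: "complex \<Rightarrow> 'a \<Rightarrow> 'a"  (infixr \<open>*\<^sub>C\<close> 75)
    and cinner :: "'a \<Rightarrow> 'a \<Rightarrow> complex"
  assumes scaleC_add_right: "c *\<^sub>C (x + y) = c *\<^sub>C x + c *\<^sub>C y"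
    and scaleC_add_left: "(c + d) *\<^sub>C x = c *\<^sub>C x + d *\<^sub>C x"
    and scaleC_scaleC: "c *\<^sub>C d *\<^sub>C x = (c * d) *\<^sub>C x"
    and scaleR_scaleC: "r *\<^sub>R x = complex_of_real r *\<^sub>C x"
    and cinner_commute: "cinner x y = cnj (cinner y x)"
    and cinner_add_left: "cinner (x + y) z = cinner x z + cinner y z"
    and cinner_scaleC_left: "cinner (c *\<^sub>C x) y = c * cinner x y"
    and inner_eq_Re_cinner: "inner x y = Re (cinner x y)"


section \<open>The spaces $L^2$ as types\<close>

text \<open>The measure is attached to a type by a type class, so that one construction yields the
  space $L^2(\mu)$ for every such measure $\mu$.\<close>

class measure_tag =
  fixes tag_measure :: "'a itself \<Rightarrow> real measure"

definition sq_integrable :: "real measure \<Rightarrow> (real \<Rightarrow> complex) \<Rightarrow> bool" where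
  "sq_integrable M f \<longleftrightarrow> f \<in> borel_measurable M \<and> integrable M (\<lambda>x. (cmod (f x))\<^sup>2)"

definition l2_rel :: "'a::measure_tag itself \<Rightarrow> (real \<Rightarrow> complex) \<Rightarrow> (real \<Rightarrow> complex) \<Rightarrow> bool" where
  "l2_rel A f g \<longleftrightarrow> sq_integrable (tag_measure A) f \<and> sq_integrable (tag_measure A) g \<and>
     (AE x in tag_measure A. f x = g x)"

lemma sq_integrable_zero: "sq_integrable M (\<lambda>_. 0)"
  by (simp add: sq_integrable_def)

lemma sq_integrable_mult:
  assumes "sq_integrable M f" "sq_integrable M g"
  shows "integrable M (\<lambda>x. f x * cnj (g x))"
proof (rule Bochner_Integration.integrable_bound)
  show "integrable M (\<lambda>x. (cmod (f x))\<^sup>2 + (cmod (g x))\<^sup>2)"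
    using assms by (simp add: sq_integrable_def)
  show "(\<lambda>x. f x * cnj (g x)) \<in> borel_measurable M"
    using assms unfolding sq_integrable_def
    by (intro borel_measurable_times borel_measurable_continuous_on[where f=cnj]
        continuous_intros) auto
  have "cmod (f x * cnj (g x)) \<le> norm ((cmod (f x))\<^sup>2 + (cmod (g x))\<^sup>2)" for x
  proof -
    have "2 * (cmod (f x) * cmod (g x)) \<le> (cmod (f x))\<^sup>2 + (cmod (g x))\<^sup>2"
      using sum_squares_bound[of "cmod (f x)" "cmod (g x)"] by simp
    moreover have "0 \<le> cmod (f x) * cmod (g x)" by simp
    ultimately have "cmod (f x) * cmod (g x) \<le> (cmod (f x))\<^sup>2 + (cmod (g x))\<^sup>2" by linarith
    then show ?thesis by (simp add: norm_mult)
  qed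
  then show "AE x in M. cmod (f x * cnj (g x)) \<le> norm ((cmod (f x))\<^sup>2 + (cmod (g x))\<^sup>2)"
    by simp
qed

lemma sq_integrable_add:
  assumes "sq_integrable M f" "sq_integrable M g"
  shows "sq_integrable M (\<lambda>x. f x + g x)"
proof -
  have eq: "(cmod (f x + g x))\<^sup>2 = (cmod (f x))\<^sup>2 + (cmod (g x))\<^sup>2 + 2 * Re (f x * cnj (g x))" for x
    unfolding cmod_power2 by (simp add: power2_eq_square algebra_simps)
  have "integrable M (\<lambda>x. (cmod (f x))\<^sup>2 + (cmod (g x))\<^sup>2 + 2 * Re (f x * cnj (g x)))"
    using assms integrable_Re[OF sq_integrable_mult[OF assms]] unfolding sq_integrable_def
    by (intro Bochner_Integration.integrable_add integrable_mult_right) auto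
  moreover have "(\<lambda>x. f x + g x) \<in> borel_measurable M"
    using assms unfolding sq_integrable_def by (intro borel_measurable_add) auto
  ultimately show ?thesis by (simp add: sq_integrable_def eq)
qed

lemma sq_integrable_scale:
  assumes "sq_integrable M f"
  shows "sq_integrable M (\<lambda>x. c * f x)"
  using assms unfolding sq_integrable_def
  by (auto simp: norm_mult power_mult_distrib intro!: borel_measurable_times)

text \<open>A quotient type would need \<open>'a\<close> to occur in the type of representatives.\<close>

typedef (overloaded) 'a l2 =
  "{S. \<exists>f. sq_integrable (tag_measure TYPE('a::measure_tag)) f \<and> S = {g. l2_rel TYPE('a) f g}}"
  by (auto intro: sq_integrable_zero)

definition to_l2 :: "(real \<Rightarrow> complex) \<Rightarrow> 'a::measure_tag l2" where
  "to_l2 f = (if sq_integrable (tag_measure TYPE('a)) f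
     then Abs_l2 {g. l2_rel TYPE('a) f g} else Abs_l2 {g. l2_rel TYPE('a) (\<lambda>_. 0) g})"

definition rep_l2 :: "'a::measure_tag l2 \<Rightarrow> real \<Rightarrow> complex" where
  "rep_l2 x = (SOME f. f \<in> Rep_l2 x)"

lemma Rep_to_l2:
  assumes "sq_integrable (tag_measure TYPE('a::measure_tag)) f"
  shows "Rep_l2 (to_l2 f :: 'a l2) = {g. l2_rel TYPE('a) f g}"
  unfolding to_l2_def using assms by (auto intro!: Abs_l2_inverse)

lemma to_l2_eq_iff:
  assumes f: "sq_integrable (tag_measure TYPE('a::measure_tag)) f"
    and g: "sq_integrable (tag_measure TYPE('a)) g"
  shows "(to_l2 f :: 'a l2) = to_l2 g \<longleftrightarrow> (AE x in tag_measure TYPE('a). f x = g x)"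
proof
  assume "(to_l2 f :: 'a l2) = to_l2 g"
  then have "{h. l2_rel TYPE('a) f h} = {h. l2_rel TYPE('a) g h}"
    by (metis Rep_to_l2 f g)
  moreover have "l2_rel TYPE('a) g g" using g by (simp add: l2_rel_def)
  ultimately show "AE x in tag_measure TYPE('a). f x = g x"
    by (auto simp: l2_rel_def)
next
  assume ae: "AE x in tag_measure TYPE('a). f x = g x"
  have "(AE x in tag_measure TYPE('a). f x = h x) \<longleftrightarrow> (AE x in tag_measure TYPE('a). g x = h x)" for h
  proof
    assume "AE x in tag_measure TYPE('a). f x = h x"
    with ae show "AE x in tag_measure TYPE('a). g x = h x" by eventually_elim simp
  next
    assume "AE x in tag_measure TYPE('a). g x = h x"
    with ae show "AE x in tag_measure TYPE('a). f x = h x" by eventually_elim simp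
  qed
  then have "{h. l2_rel TYPE('a) f h} = {h. l2_rel TYPE('a) g h}"
    using f g by (auto simp: l2_rel_def)
  then show "(to_l2 f :: 'a l2) = to_l2 g" by (simp add: to_l2_def f g)
qed

lemma rep_l2_in: "rep_l2 x \<in> Rep_l2 x"
proof -
  obtain f where "sq_integrable (tag_measure TYPE('a)) f" "Rep_l2 x = {g. l2_rel TYPE('a) f g}"
    using Rep_l2[of x] by auto
  then have "f \<in> Rep_l2 x" by (simp add: l2_rel_def)
  then show ?thesis unfolding rep_l2_def by (rule someI[where P="\<lambda>f. f \<in> Rep_l2 x"])
qed

lemma sq_integrable_rep_l2 [simp]:
  "sq_integrable (tag_measure TYPE('a)) (rep_l2 (x :: 'a::measure_tag l2))"
  using rep_l2_in[of x] Rep_l2[of x] by (auto simp: l2_rel_def)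

lemma to_l2_rep_l2 [simp]: "to_l2 (rep_l2 x) = (x :: 'a::measure_tag l2)"
proof -
  obtain f where f: "sq_integrable (tag_measure TYPE('a)) f" "Rep_l2 x = {g. l2_rel TYPE('a) f g}"
    using Rep_l2[of x] by auto
  then have "to_l2 f = x" by (metis Rep_l2_inject Rep_to_l2)
  moreover have "AE t in tag_measure TYPE('a). f t = rep_l2 x t"
    using rep_l2_in[of x] f by (simp add: l2_rel_def)
  ultimately show ?thesis using to_l2_eq_iff[OF f(1) sq_integrable_rep_l2] by metis
qed

lemma rep_l2_to_l2:
  assumes "sq_integrable (tag_measure TYPE('a::measure_tag)) f"
  shows "AE t in tag_measure TYPE('a). rep_l2 (to_l2 f :: 'a l2) t = f t"
  using to_l2_eq_iff[OF sq_integrable_rep_l2 assms] to_l2_rep_l2 by metis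

instantiation l2 :: (measure_tag) complex_inner
begin

definition zero_l2 :: "'a l2" where "zero_l2 = to_l2 (\<lambda>_. 0)"
definition plus_l2 :: "'a l2 \<Rightarrow> 'a l2 \<Rightarrow> 'a l2" where
  "plus_l2 f g = to_l2 (\<lambda>x. rep_l2 f x + rep_l2 g x)"
definition scaleC_l2 :: "complex \<Rightarrow> 'a l2 \<Rightarrow> 'a l2" where
  "scaleC_l2 c f = to_l2 (\<lambda>x. c * rep_l2 f x)"
definition cinner_l2 :: "'a l2 \<Rightarrow> 'a l2 \<Rightarrow> complex" where
  "cinner_l2 f g = (\<integral>x. rep_l2 f x * cnj (rep_l2 g x) \<partial>tag_measure TYPE('a))"
definition uminus_l2 :: "'a l2 \<Rightarrow> 'a l2" where "uminus_l2 f = (-1) *\<^sub>C f"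
definition minus_l2 :: "'a l2 \<Rightarrow> 'a l2 \<Rightarrow> 'a l2" where "minus_l2 f g = f + (-1) *\<^sub>C g"
definition scaleR_l2 :: "real \<Rightarrow> 'a l2 \<Rightarrow> 'a l2" where "scaleR_l2 r f = complex_of_real r *\<^sub>C f"
definition inner_l2 :: "'a l2 \<Rightarrow> 'a l2 \<Rightarrow> real" where "inner_l2 f g = Re (cinner f g)"
definition norm_l2 :: "'a l2 \<Rightarrow> real" where "norm_l2 f = sqrt (inner f f)"
definition sgn_l2 :: "'a l2 \<Rightarrow> 'a l2" where "sgn_l2 f = inverse (norm f) *\<^sub>R f"
definition dist_l2 :: "'a l2 \<Rightarrow> 'a l2 \<Rightarrow> real" where "dist_l2 f g = norm (f - g)"
definition uniformity_l2 :: "('a l2 \<times> 'a l2) filter" where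
  "uniformity_l2 = (INF e\<in>{0<..}. principal {(x, y). dist x y < e})"
definition open_l2 :: "'a l2 set \<Rightarrow> bool" where
  "open_l2 U \<longleftrightarrow> (\<forall>x\<in>U. \<forall>\<^sub>F (x', y) in uniformity. x' = x \<longrightarrow> y \<in> U)"

instance
proof
  fix x y z :: "'a l2" and r s :: real and c d :: complex
  let ?M = "tag_measure TYPE('a)"
  have rep_add: "AE t in ?M. rep_l2 (x + y) t = rep_l2 x t + rep_l2 y t" for x y :: "'a l2"
    unfolding plus_l2_def by (intro rep_l2_to_l2 sq_integrable_add sq_integrable_rep_l2)
  have rep_scale: "AE t in ?M. rep_l2 (c *\<^sub>C x) t = c * rep_l2 x t" for c and x :: "'a l2"
    unfolding scaleC_l2_def by (intro rep_l2_to_l2 sq_integrable_scale sq_integrable_rep_l2)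
  have rep_zero: "AE t in ?M. rep_l2 (0 :: 'a l2) t = 0"
    unfolding zero_l2_def by (intro rep_l2_to_l2 sq_integrable_zero)
  have eqI: "x = y" if "AE t in ?M. rep_l2 x t = rep_l2 y t" for x y :: "'a l2"
    using that to_l2_eq_iff[OF sq_integrable_rep_l2[of x] sq_integrable_rep_l2[of y]] by simp
  have assoc: "x + y + z = x + (y + z)" for x y z :: "'a l2"
    using rep_add[of x y] rep_add[of "x + y" z] rep_add[of x "y + z"] rep_add[of y z]
    by (intro eqI, eventually_elim) simp
  have comm: "x + y = y + x" for x y :: "'a l2"
    using rep_add[of x y] rep_add[of y x] by (intro eqI, eventually_elim) simp
  have zero: "0 + x = x" for x :: "'a l2"
    using rep_add[of 0 x] rep_zero by (intro eqI, eventually_elim) simp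
  have C_add_right: "c *\<^sub>C (x + y) = c *\<^sub>C x + c *\<^sub>C y" for c and x y :: "'a l2"
    using rep_scale[of c "x + y"] rep_add[of x y] rep_add[of "c *\<^sub>C x" "c *\<^sub>C y"]
      rep_scale[of c x] rep_scale[of c y]
    by (intro eqI, eventually_elim) (simp add: distrib_left)
  have C_add_left: "(c + d) *\<^sub>C x = c *\<^sub>C x + d *\<^sub>C x" for c d and x :: "'a l2"
    using rep_scale[of "c + d" x] rep_add[of "c *\<^sub>C x" "d *\<^sub>C x"] rep_scale[of c x] rep_scale[of d x]
    by (intro eqI, eventually_elim) (simp add: distrib_right)
  have C_C: "c *\<^sub>C d *\<^sub>C x = (c * d) *\<^sub>C x" for c d and x :: "'a l2"
    using rep_scale[of c "d *\<^sub>C x"] rep_scale[of d x] rep_scale[of "c * d" x]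
    by (intro eqI, eventually_elim) simp
  have C_one: "1 *\<^sub>C x = x" for x :: "'a l2"
    by (simp add: scaleC_l2_def)
  have C_zero: "0 *\<^sub>C x = 0" for x :: "'a l2"
    by (simp add: scaleC_l2_def zero_l2_def)
  have meas: "(\<lambda>t. rep_l2 x t * cnj (rep_l2 y t)) \<in> borel_measurable ?M" for x y :: "'a l2"
    using sq_integrable_mult[OF sq_integrable_rep_l2[of x] sq_integrable_rep_l2[of y]] by auto
  have int: "integrable ?M (\<lambda>t. rep_l2 x t * cnj (rep_l2 y t))" for x y :: "'a l2"
    by (intro sq_integrable_mult sq_integrable_rep_l2)
  have ci_comm: "cinner x y = cnj (cinner y x)" for x y :: "'a l2"
    unfolding cinner_l2_def Bochner_Integration.integral_cnj[symmetric] by (simp add: mult.commute)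
  have ci_add: "cinner (x + y) z = cinner x z + cinner y z" for x y z :: "'a l2"
  proof -
    have "cinner (x + y) z =
        (\<integral>t. rep_l2 x t * cnj (rep_l2 z t) + rep_l2 y t * cnj (rep_l2 z t) \<partial>?M)"
      unfolding cinner_l2_def using rep_add[of x y]
      by (intro integral_cong_AE meas borel_measurable_add)
        (erule eventually_mono, simp add: distrib_right)
    then show ?thesis by (simp add: cinner_l2_def int)
  qed
  have ci_scale: "cinner (c *\<^sub>C x) y = c * cinner x y" for c and x y :: "'a l2"
  proof -
    have "cinner (c *\<^sub>C x) y = (\<integral>t. c * (rep_l2 x t * cnj (rep_l2 y t)) \<partial>?M)"
      unfolding cinner_l2_def using rep_scale[of c x]
      by (intro integral_cong_AE meas borel_measurable_times borel_measurable_const)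
        (erule eventually_mono, simp add: mult.assoc)
    then show ?thesis by (simp add: cinner_l2_def)
  qed
  have ci_self: "cinner x x = complex_of_real (\<integral>t. (cmod (rep_l2 x t))\<^sup>2 \<partial>?M)" for x :: "'a l2"
    unfolding cinner_l2_def complex_norm_square[symmetric] by (rule integral_complex_of_real)
  have ci_nonneg: "0 \<le> Re (cinner x x)" for x :: "'a l2"
    by (simp add: ci_self)
  have ci_zero: "Re (cinner x x) = 0 \<longleftrightarrow> x = 0" for x :: "'a l2"
  proof -
    have "(\<integral>t. (cmod (rep_l2 x t))\<^sup>2 \<partial>?M) = 0 \<longleftrightarrow> (AE t in ?M. (cmod (rep_l2 x t))\<^sup>2 = 0)"
      using sq_integrable_rep_l2[of x]
      by (intro integral_nonneg_eq_0_iff_AE) (auto simp: sq_integrable_def)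
    also have "\<dots> \<longleftrightarrow> (AE t in ?M. rep_l2 x t = 0)" by simp
    also have "\<dots> \<longleftrightarrow> to_l2 (rep_l2 x) = (0 :: 'a l2)"
      unfolding zero_l2_def by (rule to_l2_eq_iff[symmetric]) (simp_all add: sq_integrable_zero)
    finally show ?thesis by (simp add: ci_self)
  qed
  show "x + y + z = x + (y + z)" by (rule assoc)
  show "x + y = y + x" by (rule comm)
  show "0 + x = x" by (rule zero)
  show "- x + x = 0"
    using C_add_left[of "-1" 1 x] by (simp add: uminus_l2_def C_one C_zero)
  show "x - y = x + - y" by (simp add: minus_l2_def uminus_l2_def)
  show "r *\<^sub>R (x + y) = r *\<^sub>R x + r *\<^sub>R y" by (simp add: scaleR_l2_def C_add_right)
  show "(r + s) *\<^sub>R x = r *\<^sub>R x + s *\<^sub>R x" by (simp add: scaleR_l2_def C_add_left)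
  show "r *\<^sub>R s *\<^sub>R x = (r * s) *\<^sub>R x" by (simp add: scaleR_l2_def C_C)
  show "1 *\<^sub>R x = x" by (simp add: scaleR_l2_def C_one)
  show "dist x y = norm (x - y)" by (simp add: dist_l2_def)
  show "sgn x = inverse (norm x) *\<^sub>R x" by (simp add: sgn_l2_def)
  show "uniformity = (INF e\<in>{0<..}. principal {(x, y :: 'a l2). dist x y < e})"
    by (simp add: uniformity_l2_def)
  show "open U \<longleftrightarrow> (\<forall>x\<in>U. \<forall>\<^sub>F (x', y) in uniformity. x' = x \<longrightarrow> y \<in> U)" for U :: "'a l2 set"
    by (simp add: open_l2_def)
  show "inner x y = inner y x"
    using ci_comm[of x y] by (simp add: inner_l2_def)
  show "inner (x + y) z = inner x z + inner y z" by (simp add: inner_l2_def ci_add)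
  show "inner (r *\<^sub>R x) y = r * inner x y" by (simp add: inner_l2_def scaleR_l2_def ci_scale)
  show "0 \<le> inner x x" by (simp add: inner_l2_def ci_nonneg)
  show "inner x x = 0 \<longleftrightarrow> x = 0" by (simp add: inner_l2_def ci_zero)
  show "norm x = sqrt (inner x x)" by (simp add: norm_l2_def)
  show "c *\<^sub>C (x + y) = c *\<^sub>C x + c *\<^sub>C y" by (rule C_add_right)
  show "(c + d) *\<^sub>C x = c *\<^sub>C x + d *\<^sub>C x" by (rule C_add_left)
  show "c *\<^sub>C d *\<^sub>C x = (c * d) *\<^sub>C x" by (rule C_C)
  show "r *\<^sub>R x = complex_of_real r *\<^sub>C x" by (simp add: scaleR_l2_def)
  show "cinner x y = cnj (cinner y x)" by (rule ci_comm)
  show "cinner (x + y) z = cinner x z + cinner y z" by (rule ci_add)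
  show "cinner (c *\<^sub>C x) y = c * cinner x y" by (rule ci_scale)
  show "inner x y = Re (cinner x y)" by (simp add: inner_l2_def)
qed

end


section \<open>Forms and their operators\<close>

definition dense_embedding :: "('v::complex_inner \<Rightarrow> 'h::complex_inner) \<Rightarrow> bool" where
  "dense_embedding \<iota> \<longleftrightarrow> bounded_linear \<iota> \<and> (\<forall>c v. \<iota> (c *\<^sub>C v) = c *\<^sub>C \<iota> v) \<and> inj \<iota> \<and>
     closure (range \<iota>) = UNIV"

type_synonym 'v form = "real \<Rightarrow> 'v \<Rightarrow> 'v \<Rightarrow> complex"

definition sesquilinear :: "('v::complex_inner \<Rightarrow> 'v \<Rightarrow> complex) \<Rightarrow> bool" where
  "sesquilinear b \<longleftrightarrow>
     (\<forall>v v' z. b (v + v') z = b v z + b v' z) \<and> (\<forall>c v z. b (c *\<^sub>C v) z = c * b v z) \<and>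
     (\<forall>v z z'. b v (z + z') = b v z + b v z') \<and> (\<forall>c v z. b v (c *\<^sub>C z) = cnj c * b v z)"

definition bounded_coercive_form :: "real \<Rightarrow> 'v::complex_inner form \<Rightarrow> bool" where
  "bounded_coercive_form T a \<longleftrightarrow> (\<forall>t\<in>{0..T}. sesquilinear (a t)) \<and>
     (\<exists>\<epsilon>>0. \<exists>M>0. \<forall>t\<in>{0..T}. \<forall>v z.
        Re (a t v v) \<ge> \<epsilon> * (norm v)\<^sup>2 \<and> cmod (a t v z) \<le> M * norm v * norm z)"

definition symmetric_form :: "real \<Rightarrow> 'v form \<Rightarrow> bool" where
  "symmetric_form T a \<longleftrightarrow> (\<forall>t\<in>{0..T}. \<forall>v z. a t v z = cnj (a t z v))"

text \<open>The antidual $V'$ consists of the antilinear elements of the space of bounded real-linear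
  maps from $V$ to the complex numbers; the norm of that space restricts to the norm of $V'$.
  Similarly the norm of \<open>'v \<Rightarrow>\<^sub>L 'v \<Rightarrow>\<^sub>L complex\<close> restricts to the norm of $B(V,V')$.\<close>

definition form_op :: "'v::complex_inner form \<Rightarrow> real \<Rightarrow> 'v \<Rightarrow>\<^sub>L 'v \<Rightarrow>\<^sub>L complex" where
  "form_op a t = Blinfun (\<lambda>v. Blinfun (\<lambda>z. a t v z))"

definition emb_dual :: "('v::complex_inner \<Rightarrow> 'h::complex_inner) \<Rightarrow> 'h \<Rightarrow> 'v \<Rightarrow>\<^sub>L complex" where
  "emb_dual \<iota> h = Blinfun (\<lambda>z. cinner h (\<iota> z))"

definition part_rel ::
    "('v::complex_inner \<Rightarrow> 'h::complex_inner) \<Rightarrow> 'v form \<Rightarrow> real \<Rightarrow> 'h \<Rightarrow> 'h \<Rightarrow> bool" where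
  "part_rel \<iota> a t x y \<longleftrightarrow> (\<exists>v. x = \<iota> v \<and> form_op a t v = emb_dual \<iota> y)"

definition part_dom ::
    "('v::complex_inner \<Rightarrow> 'h::complex_inner) \<Rightarrow> 'v form \<Rightarrow> real \<Rightarrow> 'h set" where
  "part_dom \<iota> a t = {x. \<exists>y. part_rel \<iota> a t x y}"

definition part_op ::
    "('v::complex_inner \<Rightarrow> 'h::complex_inner) \<Rightarrow> 'v form \<Rightarrow> real \<Rightarrow> 'h \<Rightarrow> 'h" where
  "part_op \<iota> a t x = (THE y. part_rel \<iota> a t x y)"


section \<open>Vector-valued function spaces on $[0,T]$\<close>

definition bochner_measurable :: "real \<Rightarrow> (real \<Rightarrow> 'y::real_normed_vector) \<Rightarrow> bool" where
  "bochner_measurable T g \<longleftrightarrow>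
     (\<exists>s. (\<forall>n. simple_function (lebesgue_on {0..T}) (s n)) \<and>
        (AE t in lebesgue_on {0..T}. (\<lambda>n::nat. s n t) \<longlonglongrightarrow> g t))"

definition ennreal_powr :: "ennreal \<Rightarrow> real \<Rightarrow> ennreal" where
  "ennreal_powr x r = (if x = \<infinity> then \<infinity> else ennreal (enn2real x powr r))"

definition Lp_norm :: "ennreal \<Rightarrow> real \<Rightarrow> (real \<Rightarrow> 'y::real_normed_vector) \<Rightarrow> ennreal" where
  "Lp_norm p T g =
     (if p = \<infinity> then esssup (lebesgue_on {0..T}) (\<lambda>t. ennreal (norm (g t)))
      else ennreal_powr (\<integral>\<^sup>+t. ennreal (norm (g t) powr enn2real p) \<partial>lebesgue_on {0..T})
             (1 / enn2real p))"

definition in_Lp :: "ennreal \<Rightarrow> real \<Rightarrow> (real \<Rightarrow> 'y::real_normed_vector) \<Rightarrow> bool" where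
  "in_Lp p T g \<longleftrightarrow> bochner_measurable T g \<and> Lp_norm p T g < \<infinity>"

text \<open>The diagonal contributes nothing, since \<open>norm (g t - g t) powr q = 0\<close>.\<close>

definition frac_sobolev ::
    "real \<Rightarrow> real \<Rightarrow> real \<Rightarrow> (real \<Rightarrow> 'y::real_normed_vector) \<Rightarrow> bool" where
  "frac_sobolev \<alpha> q T g \<longleftrightarrow> bochner_measurable T g \<and>
     (\<integral>\<^sup>+t. (\<integral>\<^sup>+s. ennreal (norm (g t - g s) powr q / \<bar>t - s\<bar> powr (1 + \<alpha> * q))
        \<partial>lebesgue_on {0..T}) \<partial>lebesgue_on {0..T}) < \<infinity>"

text \<open>\<open>g\<close> is the continuous representative of an element of $W^{1,p}([0,T];Y)$ with weak
  derivative \<open>g'\<close>. For Bochner integrable \<open>g'\<close> the gauge integral in a Banach space agrees with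
  the Bochner integral.\<close>

definition sobolev_deriv :: "ennreal \<Rightarrow> real \<Rightarrow> (real \<Rightarrow> 'y::real_normed_vector) \<Rightarrow>
    (real \<Rightarrow> 'y) \<Rightarrow> bool" where
  "sobolev_deriv p T g g' \<longleftrightarrow> in_Lp p T g \<and> in_Lp p T g' \<and>
     (\<forall>t\<in>{0..T}. (g' has_integral (g t - g 0)) {0..t})"


section \<open>Real interpolation by the K-method\<close>

definition K_functional ::
    "'x::real_normed_vector set \<Rightarrow> ('x \<Rightarrow> real) \<Rightarrow> real \<Rightarrow> 'x \<Rightarrow> real" where
  "K_functional D nD s x = (INF y\<in>D. nD y + s * norm (x - y))"

text \<open>The norm of $(D,X)_{\theta,p}$ where \<open>D\<close> is a subspace of \<open>X\<close> with its own norm \<open>nD\<close>;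
  the space consists of the elements of finite norm.\<close>

definition interp_norm ::
    "'x::real_normed_vector set \<Rightarrow> ('x \<Rightarrow> real) \<Rightarrow> real \<Rightarrow> ennreal \<Rightarrow> 'x \<Rightarrow> ennreal" where
  "interp_norm D nD \<theta> p x =
     (if p = \<infinity> then (SUP s\<in>{0<..}. ennreal (s powr (-\<theta>) * K_functional D nD s x))
      else ennreal_powr
        (\<integral>\<^sup>+s\<in>{0<..}. ennreal ((s powr (-\<theta>) * K_functional D nD s x) powr enn2real p / s) \<partial>lborel)
        (1 / enn2real p))"

text \<open>The norm of $(D(A(0)),H)_{1/p,p}$, where \<open>1/p = 0\<close> for \<open>p = \<infinity>\<close>. At the
  endpoint \<open>p = 1\<close> the K-method gives only the zero vector, so that there maximal regularity
  concerns zero initial values.\<close>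

definition initial_norm ::
    "ennreal \<Rightarrow> ('v::complex_inner \<Rightarrow> 'h::complex_inner) \<Rightarrow> 'v form \<Rightarrow> 'h \<Rightarrow> ennreal" where
  "initial_norm p \<iota> a =
     interp_norm (part_dom \<iota> a 0) (\<lambda>x. norm x + norm (part_op \<iota> a 0 x)) (enn2real (1 / p)) p"


section \<open>Non-autonomous problems\<close>

text \<open>\<open>u\<close> is a solution in $H$ with weak derivative \<open>u'\<close>.\<close>

definition Lp_solution :: "ennreal \<Rightarrow> real \<Rightarrow> ('v::complex_inner \<Rightarrow> 'h::complex_inner) \<Rightarrow>
    'v form \<Rightarrow> (real \<Rightarrow> 'h) \<Rightarrow> 'h \<Rightarrow> (real \<Rightarrow> 'h) \<Rightarrow> (real \<Rightarrow> 'h) \<Rightarrow> bool" where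
  "Lp_solution p T \<iota> a f u0 u u' \<longleftrightarrow>
     sobolev_deriv p T u u' \<and> u 0 = u0 \<and>
     (AE t in lebesgue_on {0..T}. u t \<in> part_dom \<iota> a t) \<and>
     in_Lp p T (\<lambda>t. part_op \<iota> a t (u t)) \<and>
     (AE t in lebesgue_on {0..T}. u' t + part_op \<iota> a t (u t) = f t)"

definition maximal_Lp_regularity ::
    "ennreal \<Rightarrow> real \<Rightarrow> ('v::complex_inner \<Rightarrow> 'h::complex_inner) \<Rightarrow> 'v form \<Rightarrow> bool" where
  "maximal_Lp_regularity p T \<iota> a \<longleftrightarrow>
     (\<forall>f u0. in_Lp p T f \<and> initial_norm p \<iota> a u0 < \<infinity> \<longrightarrow>
        (\<exists>u u'. Lp_solution p T \<iota> a f u0 u u') \<and>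
        (\<forall>u u' v v'. Lp_solution p T \<iota> a f u0 u u' \<and> Lp_solution p T \<iota> a f u0 v v' \<longrightarrow>
           (\<forall>t\<in>{0..T}. u t = v t))) \<and>
     (\<exists>C>0. \<forall>f u0 u u'. in_Lp p T f \<and> initial_norm p \<iota> a u0 < \<infinity> \<and>
        Lp_solution p T \<iota> a f u0 u u' \<longrightarrow>
        Lp_norm p T u + Lp_norm p T u' + Lp_norm p T (\<lambda>t. part_op \<iota> a t (u t))
          \<le> ennreal C * (Lp_norm p T f + initial_norm p \<iota> a u0))"

text \<open>Solutions in $V'$, in the class $L^2([0,T];V) \cap W^{1,2}([0,T];V')$.\<close>

definition integrated_solution :: "real \<Rightarrow> ('v::complex_inner \<Rightarrow> 'h::complex_inner) \<Rightarrow>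
    'v form \<Rightarrow> (real \<Rightarrow> 'v \<Rightarrow>\<^sub>L complex) \<Rightarrow> (real \<Rightarrow> 'v) \<Rightarrow> bool" where
  "integrated_solution T \<iota> a f u \<longleftrightarrow> in_Lp 2 T u \<and>
     (\<exists>u'. sobolev_deriv 2 T (\<lambda>t. emb_dual \<iota> (\<iota> (u t))) u' \<and>
        (AE t in lebesgue_on {0..T}. u' t + form_op a t (u t) = f t))"


section \<open>The example\<close>

definition wgt :: "real \<Rightarrow> real" where
  "wgt x = (x * \<bar>ln x\<bar>) powr (-3/2)"

definition phi :: "real \<Rightarrow> real" where
  "phi x = wgt x"

definition amp :: "real \<Rightarrow> real" where
  "amp x = x * \<bar>ln x\<bar>"

typedef flat_tag = "UNIV :: unit set" by simp
typedef wgt_tag = "UNIV :: unit set" by simp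

instantiation flat_tag :: measure_tag
begin
definition tag_measure_flat_tag :: "flat_tag itself \<Rightarrow> real measure" where
  "tag_measure_flat_tag _ = lebesgue_on {0..1/2}"
instance ..
end

instantiation wgt_tag :: measure_tag
begin
definition tag_measure_wgt_tag :: "wgt_tag itself \<Rightarrow> real measure" where
  "tag_measure_wgt_tag _ = density (lebesgue_on {0..1/2}) (\<lambda>x. ennreal (wgt x))"
instance ..
end

type_synonym H_space = "flat_tag l2"
type_synonym V_space = "wgt_tag l2"

text \<open>Both measures have the same null sets and \<open>wgt\<close> is bounded away from zero almost
  everywhere on $[0,1/2]$, so this is the inclusion of $V$ in $H$.\<close>

definition V_to_H :: "V_space \<Rightarrow> H_space" where
  "V_to_H v = to_l2 (rep_l2 v)"

definition u_fun :: "real \<Rightarrow> real \<Rightarrow> real \<Rightarrow> complex" where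
  "u_fun d t x = complex_of_real (amp x * (sin (t * phi x) + d))"

definition u_ex :: "real \<Rightarrow> real \<Rightarrow> V_space" where
  "u_ex d t = to_l2 (u_fun d t)"

end

theory Submission
  imports Defs
begin

text \<open>Multiplication by the weight represents the embedding of $V$ in $V'$, so in $V'$ the path
  $u$ becomes \<open>dual_path\<close>, whose derivative is represented by \<open>amp \<cdot> cos (t \<phi>)\<close>. As an element of
  $H$ this derivative would be $\cos(t\phi)/\sqrt{x|\log x|}$, which is not square integrable.
  A multiple of the inner product plus a rank-one form turns $u$ into a solution; the form is as regular
  in time as $u$ and its derivative. Both have the modulus of continuity $(\delta/|\log\delta|)^{1/2}$:
  the upper bound splits the integral at the point where $\delta\phi = 1$, and the lower bound, for the
  sum of a forward and a backward difference of $u$, comes from a neighbourhood of that point.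

  Maximal regularity fails since, for the right-hand side $(1+t)u(t)$ and initial value $0$, the only
  candidate is $t\,u(t)$. Uniqueness is an energy estimate. A solution with values in $D(A(t))$ is not known
  to be in $L^2(V)$, so the energy identity is proved for truncations to $\{w \le n\}$, and
  coercivity provides the majorant for the limit.\<close>


section \<open>Complex inner products\<close>

text \<open>The exponents make the example borderline. With c = \<open>amp\<close> and w = c^(-3/2),
  the squared modulus of the would-be derivative in H is cos^2(t \<phi>)/c, whose integral at 0
  diverges only like log log. The same choice makes the Gagliardo integral of order 1/2 and exponent
  q behave like the integral of |log x|^(-q/2)/x, which is finite at 0 exactly for q > 2. The time
  regularity of the form involves that of \<open>velocity\<close>, hence of cosines, while the
  hypothesis of the reduction concerns sines, which can be stationary where cosines move. Increments
  are therefore not compared pointwise; both are compared with one integral over |t - s|, which is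
  why the modulus is needed from above and from below. A large d makes the pairing of u with the
  vector of the rank-one part uniformly positive: the H-norm of u contributes a term quadratic in d,
  against a linear one from the derivative and a quadratic one with the small factor
  \<open>coercivity\<close>.\<close>

lemma cinner_add_right: "cinner x (y + z) = cinner x y + cinner x (z::'a::complex_inner)"
  by (metis cinner_add_left cinner_commute complex_cnj_add)

lemma cinner_scaleC_right: "cinner x (c *\<^sub>C y) = cnj c * cinner x (y::'a::complex_inner)"
  by (metis cinner_scaleC_left cinner_commute complex_cnj_mult)

lemma cinner_scaleR_left: "cinner (r *\<^sub>R x) y = of_real r * cinner x (y::'a::complex_inner)"
  by (simp add: scaleR_scaleC cinner_scaleC_left)

lemma cinner_scaleR_right: "cinner x (r *\<^sub>R y) = of_real r * cinner x (y::'a::complex_inner)"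
  by (simp add: scaleR_scaleC cinner_scaleC_right)

lemma cinner_diff_left: "cinner (x - y) z = cinner x z - cinner y (z::'a::complex_inner)"
  using cinner_add_left[of "x - y" y z] by simp

lemma cinner_diff_right: "cinner x (y - z) = cinner x y - cinner x (z::'a::complex_inner)"
  using cinner_add_right[of x "y - z" z] by simp

lemma cinner_self: "cinner x x = of_real ((norm (x::'a::complex_inner))\<^sup>2)"
proof -
  have "Im (cinner x x) = 0"
    by (metis cinner_commute add.inverse_inverse cnj.simps(2) equal_neg_zero)
  moreover have "Re (cinner x x) = (norm x)\<^sup>2"
    by (simp add: inner_eq_Re_cinner[symmetric] power2_norm_eq_inner)
  ultimately show ?thesis by (simp add: complex_eq_iff)
qed

lemma norm_scaleC: "norm (c *\<^sub>C x) = cmod c * norm (x::'a::complex_inner)"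
proof -
  have "complex_of_real ((norm (c *\<^sub>C x))\<^sup>2) = c * cnj c * of_real ((norm x)\<^sup>2)"
    by (simp only: cinner_self[symmetric] cinner_scaleC_left cinner_scaleC_right ac_simps)
  also have "\<dots> = complex_of_real ((cmod c * norm x)\<^sup>2)"
    by (simp only: complex_norm_square[symmetric] power_mult_distrib of_real_mult)
  finally have "(norm (c *\<^sub>C x))\<^sup>2 = (cmod c * norm x)\<^sup>2" by (simp only: of_real_eq_iff)
  then show ?thesis by (rule power2_eq_imp_eq) simp_all
qed

lemma cmod_cinner_le: "cmod (cinner x y) \<le> norm x * norm (y::'a::complex_inner)"
proof (cases "cinner x y = 0")
  case False
  \<comment> \<open>A unimodular factor rotates the complex inner product onto the positive axis,
    where the real Cauchy-Schwarz inequality applies.\<close>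
  define c where "c = cnj (cinner x y) / cmod (cinner x y)"
  have c: "cmod c = 1" using False by (simp add: c_def norm_divide)
  have "complex_of_real ((cmod (cinner x y))\<^sup>2) = cinner x y * cnj (cinner x y)"
    by (rule complex_norm_square)
  then have "c * cinner x y = of_real (cmod (cinner x y))"
    using False unfolding c_def by (simp add: power2_eq_square field_simps)
  then have "cmod (cinner x y) = Re (cinner (c *\<^sub>C x) y)"
    by (simp add: cinner_scaleC_left)
  also have "\<dots> \<le> norm (c *\<^sub>C x) * norm y"
    using norm_cauchy_schwarz[of "c *\<^sub>C x" y] by (simp add: inner_eq_Re_cinner)
  finally show ?thesis by (simp add: norm_scaleC c)
qed simp

lemma bounded_bilinear_cinner: "bounded_bilinear (cinner :: 'a::complex_inner \<Rightarrow> 'a \<Rightarrow> complex)"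
proof
  show "\<exists>K. \<forall>a b. cmod (cinner a (b::'a)) \<le> norm a * norm b * K"
    using cmod_cinner_le by (intro exI[of _ 1]) auto
qed (simp_all add: cinner_add_left cinner_add_right cinner_scaleR_left cinner_scaleR_right
      scaleR_conv_of_real)

lemmas bounded_linear_cinner_right = bounded_bilinear.bounded_linear_right[OF bounded_bilinear_cinner]

text \<open>The Riesz identification of V with V', to be distinguished from the embedding of H in V'
  given by \<open>emb_dual\<close>. Functionals of the example are written as \<open>riesz\<close>
  of an explicit vector; whether they come from H is a separate question.\<close>

definition riesz :: "'a::complex_inner \<Rightarrow> 'a \<Rightarrow>\<^sub>L complex" where
  "riesz v = Blinfun (cinner v)"

lemma riesz_apply [simp]: "blinfun_apply (riesz v) z = cinner v z"
  unfolding riesz_def by (simp add: bounded_linear_Blinfun_apply[OF bounded_linear_cinner_right])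

lemma bounded_linear_riesz: "bounded_linear riesz"
proof (rule bounded_linear_intro[where K=1])
  show "norm (riesz (x::'a)) \<le> norm x * 1" for x
    by (rule norm_blinfun_bound) (auto simp: cmod_cinner_le)
qed (auto intro!: blinfun_eqI simp: cinner_add_left cinner_scaleR_left scaleR_conv_of_real blinfun.bilinear_simps)


section \<open>Rank-one perturbations of the inner product\<close>

text \<open>If \<open>b\<close> is the inner product of u and \<open>h\<close>, this form sends u to
  \<open>k *\<^sub>R u + h\<close>. A symmetric coercive form can thus be prescribed at one vector,
  as long as that inner product is positive. In the example the whole time dependence sits in
  \<open>h\<close> and \<open>b\<close>.\<close>

definition rank_one_form :: "real \<Rightarrow> 'v::complex_inner \<Rightarrow> real \<Rightarrow> 'v \<Rightarrow> 'v \<Rightarrow> complex" where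
  "rank_one_form k h b v z = of_real k * cinner v z + cinner v h * cinner h z / of_real b"

lemma sesquilinear_rank_one_form: "sesquilinear (rank_one_form k h b)"
  unfolding sesquilinear_def rank_one_form_def
  by (auto simp: cinner_add_left cinner_add_right cinner_scaleC_left cinner_scaleC_right
      algebra_simps add_divide_distrib)

lemma rank_one_form_commute: "rank_one_form k h b v z = cnj (rank_one_form k h b z v)"
  unfolding rank_one_form_def
  by (simp add: cinner_commute[of v z] cinner_commute[of v h] cinner_commute[of h z] mult.commute)

lemma Re_rank_one_form_ge:
  assumes "0 < b" shows "k * (norm v)\<^sup>2 \<le> Re (rank_one_form k h b v v)"
proof -
  have "cinner v h * cinner h v / of_real b = of_real ((cmod (cinner v h))\<^sup>2 / b)"
    unfolding cinner_commute[of h v] by (simp add: complex_norm_square[symmetric])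
  moreover have "complex_of_real k * cinner v v = of_real (k * (norm v)\<^sup>2)"
    by (simp add: cinner_self)
  ultimately have "Re (rank_one_form k h b v v) = k * (norm v)\<^sup>2 + (cmod (cinner v h))\<^sup>2 / b"
    unfolding rank_one_form_def by (simp only: Re_complex_of_real plus_complex.sel)
  then show ?thesis using assms by simp
qed

lemma cmod_rank_one_form_le:
  assumes "0 < b0" "b0 \<le> b" "norm h \<le> M" "0 \<le> k"
  shows "cmod (rank_one_form k h b v z) \<le> (k + M\<^sup>2 / b0) * norm v * norm z"
proof -
  have M: "0 \<le> M" using assms(3) norm_ge_zero order.trans by blast
  have "cmod (cinner v h) * cmod (cinner h z) \<le> (norm v * M) * (M * norm z)"
    using assms M by (intro mult_mono order.trans[OF cmod_cinner_le]) (auto intro!: mult_mono)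
  then have "cmod (cinner v h) * cmod (cinner h z) / b \<le> (norm v * M) * (M * norm z) / b0"
    using assms M by (intro frac_le) auto
  moreover have "k * cmod (cinner v z) \<le> k * (norm v * norm z)"
    using assms by (intro mult_left_mono cmod_cinner_le) auto
  moreover have "cmod (rank_one_form k h b v z) \<le>
      k * cmod (cinner v z) + cmod (cinner v h) * cmod (cinner h z) / b"
    unfolding rank_one_form_def
    using assms by (intro norm_triangle_le) (simp add: norm_mult norm_divide)
  ultimately show ?thesis by (simp add: power2_eq_square algebra_simps)
qed

text \<open>\<open>Blinfun\<close> evaluates as intended only on bounded linear maps, so boundedness
  is checked first in the second argument and then, for the resulting functionals, in the
  first.\<close>

lemma blinfun_apply_form_op:
  assumes a: "sesquilinear (a t)" and M: "0 \<le> M" "\<And>v z. cmod (a t v z) \<le> M * norm v * norm z"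
  shows "blinfun_apply (blinfun_apply (form_op a t) v) z = a t v z"
proof -
  have lin1: "bounded_linear (a t v)" for v
    using a M unfolding sesquilinear_def
    by (intro bounded_linear_intro[where K="M * norm v"])
       (auto simp: scaleR_scaleC scaleR_conv_of_real mult.commute)
  then have ap: "blinfun_apply (Blinfun (a t v)) z = a t v z" for v z
    by (simp add: bounded_linear_Blinfun_apply)
  have "bounded_linear (\<lambda>v. Blinfun (a t v))"
  proof (rule bounded_linear_intro[where K=M])
    show "norm (Blinfun (a t v)) \<le> norm v * M" for v
      using M(1) by (intro norm_blinfun_bound) (auto simp: ap M(2) mult.commute[of "norm v"])
  qed (use a in \<open>auto intro!: blinfun_eqI simp: sesquilinear_def ap blinfun.bilinear_simps
        scaleR_scaleC scaleR_conv_of_real\<close>)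
  then show ?thesis unfolding form_op_def by (simp add: bounded_linear_Blinfun_apply ap)
qed

lemma norm_diff_rank_one_form_op_le:
  fixes h :: "real \<Rightarrow> 'v::complex_inner"
  assumes "0 < b0" "b0 \<le> b t" "b0 \<le> b s" "norm (h t) \<le> M" "norm (h s) \<le> M" "0 \<le> k"
  defines "a \<equiv> \<lambda>t. rank_one_form k (h t) (b t)"
  shows "norm (form_op a t - form_op a s) \<le>
    2 * M / b0 * norm (h t - h s) + M\<^sup>2 / b0\<^sup>2 * \<bar>b t - b s\<bar>"
proof -
  have M: "0 \<le> M" using assms(4) norm_ge_zero order.trans by blast
  let ?M = "k + M\<^sup>2 / b0"
  have ap: "blinfun_apply (blinfun_apply (form_op a r) v) z = a r v z" if "r = t \<or> r = s" for r v z
    using assms that M by (intro blinfun_apply_form_op[where M="k + M\<^sup>2/b0"])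
      (auto simp: a_def sesquilinear_rank_one_form intro!: cmod_rank_one_form_le add_nonneg_nonneg)
  let ?D = "2 * M / b0 * norm (h t - h s) + M\<^sup>2 / b0\<^sup>2 * \<bar>b t - b s\<bar>"
  have D: "0 \<le> ?D" using assms M by simp
  have "cmod (a t v z - a s v z) \<le> ?D * norm v * norm z" for v z
  proof -
    have bt: "b t \<noteq> 0" "b s \<noteq> 0" "0 < b t" "0 < b s" using assms by auto
    \<comment> \<open>One factor is exchanged at a time: the two occurrences of \<open>h\<close>,
      then the denominator.\<close>
    have "a t v z - a s v z = cinner v (h t - h s) * cinner (h t) z / of_real (b t)
       + cinner v (h s) * cinner (h t - h s) z / of_real (b t)
       - cinner v (h s) * cinner (h s) z * of_real (b t - b s) / of_real (b t * b s)"
      using bt unfolding a_def rank_one_form_def cinner_diff_left cinner_diff_right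
      by (simp add: field_simps)
    also have "cmod \<dots> \<le> cmod (cinner v (h t - h s)) * cmod (cinner (h t) z) / b t
       + cmod (cinner v (h s)) * cmod (cinner (h t - h s) z) / b t
       + cmod (cinner v (h s)) * cmod (cinner (h s) z) * \<bar>b t - b s\<bar> / (b t * b s)"
      using bt by (intro norm_triangle_le norm_triangle_le_diff add_mono)
       (simp_all add: norm_mult norm_divide flip: of_real_diff of_real_mult)
    also have "\<dots> \<le> (norm v * norm (h t - h s)) * (M * norm z) / b0
       + (norm v * M) * (norm (h t - h s) * norm z) / b0
       + (norm v * M) * (M * norm z) * \<bar>b t - b s\<bar> / (b0 * b0)"
      using assms M bt
      by (intro add_mono frac_le mult_mono order.trans[OF cmod_cinner_le]) (auto intro!: mult_mono)
    also have "\<dots> = ?D * norm v * norm z"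
      using assms by (simp add: field_simps power2_eq_square)
    finally show ?thesis .
  qed
  then show ?thesis
    using D by (intro norm_blinfun_bound mult_nonneg_nonneg)
      (auto simp: ap blinfun.bilinear_simps norm_ge_zero)
qed

section \<open>Calculus in $L^2$\<close>

context
  fixes M :: "real measure"
  assumes M: "M = tag_measure TYPE('a::measure_tag)"
begin

lemma sq_integrable_rep [simp, intro]: "sq_integrable M (rep_l2 (x::'a l2))"
  by (simp add: M)

lemma rep_to_l2:
  assumes "sq_integrable M f" shows "AE x in M. rep_l2 (to_l2 f :: 'a l2) x = f x"
  using rep_l2_to_l2[where 'a='a] assms unfolding M by blast

lemma to_l2_cong:
  assumes "sq_integrable M f" "sq_integrable M g" "AE x in M. f x = g x"
  shows "(to_l2 f :: 'a l2) = to_l2 g"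
  using assms to_l2_eq_iff[where 'a='a] unfolding M by blast

lemma to_l2_add:
  assumes "sq_integrable M f" "sq_integrable M g"
  shows "(to_l2 (\<lambda>x. f x + g x) :: 'a l2) = to_l2 f + to_l2 g"
  unfolding plus_l2_def using rep_to_l2[OF assms(1)] rep_to_l2[OF assms(2)]
  by (intro to_l2_cong sq_integrable_add assms sq_integrable_rep, eventually_elim) simp

lemma to_l2_scaleC:
  assumes "sq_integrable M f"
  shows "(to_l2 (\<lambda>x. c * f x) :: 'a l2) = c *\<^sub>C to_l2 f"
  unfolding scaleC_l2_def using rep_to_l2[OF assms(1)]
  by (intro to_l2_cong sq_integrable_scale assms sq_integrable_rep, eventually_elim) simp

lemma sq_integrable_diff:
  assumes "sq_integrable M f" "sq_integrable M g"
  shows "sq_integrable M (\<lambda>x. f x - g x)"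
  using sq_integrable_add[OF assms(1) sq_integrable_scale[OF assms(2), of "-1"]] by simp

lemma to_l2_diff:
  assumes "sq_integrable M f" "sq_integrable M g"
  shows "(to_l2 (\<lambda>x. f x - g x) :: 'a l2) = to_l2 f - to_l2 g"
  using to_l2_add[OF sq_integrable_diff[OF assms] assms(2)] by (simp add: algebra_simps)

lemma cinner_to_l2:
  assumes "sq_integrable M f" "sq_integrable M g"
  shows "cinner (to_l2 f :: 'a l2) (to_l2 g) = (\<integral>x. f x * cnj (g x) \<partial>M)"
  unfolding cinner_l2_def M[symmetric]
  using rep_to_l2[OF assms(1)] rep_to_l2[OF assms(2)]
  by (intro integral_cong_AE borel_measurable_integrable sq_integrable_mult assms
      sq_integrable_rep, eventually_elim) simp_all

lemma norm_to_l2_power2: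
  assumes "sq_integrable M f"
  shows "(norm (to_l2 f :: 'a l2))\<^sup>2 = (\<integral>x. (cmod (f x))\<^sup>2 \<partial>M)"
proof -
  have "complex_of_real ((norm (to_l2 f :: 'a l2))\<^sup>2) = (\<integral>x. f x * cnj (f x) \<partial>M)"
    unfolding cinner_self[symmetric] by (rule cinner_to_l2[OF assms assms])
  also have "\<dots> = of_real (\<integral>x. (cmod (f x))\<^sup>2 \<partial>M)"
    unfolding complex_norm_square[symmetric] by (rule integral_complex_of_real)
  finally show ?thesis by (simp only: of_real_eq_iff)
qed

lemma sq_integrable_restrict:
  assumes f: "sq_integrable M f" and A: "A \<in> sets M"
  shows "sq_integrable M (\<lambda>x. if x \<in> A then f x else 0)"
  unfolding sq_integrable_def
proof
  show *: "(\<lambda>x. if x \<in> A then f x else 0) \<in> borel_measurable M"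
    using f A unfolding sq_integrable_def by (intro measurable_If_set) auto
  show "integrable M (\<lambda>x. (cmod (if x \<in> A then f x else 0))\<^sup>2)"
    by (rule Bochner_Integration.integrable_bound[where f="\<lambda>x. (cmod (f x))\<^sup>2"])
      (use f * in \<open>auto simp: sq_integrable_def\<close>)
qed

text \<open>At almost every point the truncation is eventually exact, and the square of
  \<open>f\<close> dominates. Used for both measures: in H it yields density of V, in V convergence
  of the truncated energies.\<close>

lemma tendsto_to_l2_restrict:
  assumes f: "sq_integrable M f" and A: "\<And>n. A n \<in> sets M"
    and ev: "AE x in M. \<forall>\<^sub>F n in sequentially. x \<in> A n"
  shows "(\<lambda>n::nat. to_l2 (\<lambda>x. if x \<in> A n then f x else 0) :: 'a l2) \<longlonglongrightarrow> to_l2 f"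
proof -
  let ?f = "\<lambda>n x. if x \<in> A n then f x else 0"
  have "(\<lambda>n. \<integral>x. (cmod (?f n x - f x))\<^sup>2 \<partial>M) \<longlonglongrightarrow> (\<integral>x. 0 \<partial>M)"
  proof (rule integral_dominated_convergence[where w="\<lambda>x. (cmod (f x))\<^sup>2"])
    show "AE x in M. (\<lambda>n. (cmod (?f n x - f x))\<^sup>2) \<longlonglongrightarrow> 0"
      using ev
    proof eventually_elim
      case (elim x)
      then have "\<forall>\<^sub>F n in sequentially. (cmod (?f n x - f x))\<^sup>2 = 0"
        by eventually_elim simp
      then show ?case by (rule tendsto_eventually)
    qed
    show "(\<lambda>x. (cmod (?f n x - f x))\<^sup>2) \<in> borel_measurable M" for n
      using sq_integrable_diff[OF sq_integrable_restrict[OF f A] f] unfolding sq_integrable_def by auto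
  qed (use f in \<open>auto simp: sq_integrable_def\<close>)
  then have "(\<lambda>n. (norm (to_l2 (?f n) - to_l2 f :: 'a l2))\<^sup>2) \<longlonglongrightarrow> 0"
    by (simp add: to_l2_diff[symmetric] norm_to_l2_power2 sq_integrable_diff
        sq_integrable_restrict f A)
  then have "(\<lambda>n. sqrt ((norm (to_l2 (?f n) - to_l2 f :: 'a l2))\<^sup>2)) \<longlonglongrightarrow> sqrt 0"
    by (rule tendsto_real_sqrt)
  then have "(\<lambda>n. norm (to_l2 (?f n) - to_l2 f :: 'a l2)) \<longlonglongrightarrow> 0" by simp
  then show ?thesis by (simp add: tendsto_norm_zero_iff LIM_zero_iff)
qed

end


section \<open>The weighted space and its embedding\<close>

abbreviation flat :: "real measure" where "flat \<equiv> lebesgue_on {0..1/2}"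
abbreviation weighted :: "real measure" where "weighted \<equiv> density flat (\<lambda>x. ennreal (wgt x))"

text \<open>Oriented so that they discharge the assumption of the preceding context, whose results
  then speak of \<open>flat\<close> and \<open>weighted\<close> directly.\<close>

lemmas flat_tag = tag_measure_flat_tag_def[of "TYPE(flat_tag)", symmetric]
lemmas wgt_tag = tag_measure_wgt_tag_def[of "TYPE(wgt_tag)", symmetric]

section \<open>Envelope and weight on (0,1)\<close>

lemma amp_nonneg: "0 \<le> x \<Longrightarrow> 0 \<le> amp x"
  by (simp add: amp_def)

lemma amp_pos: "0 < x \<Longrightarrow> x < 1 \<Longrightarrow> 0 < amp x"
  by (simp add: amp_def mult_pos_neg)

lemma amp_le_1: "0 \<le> x \<Longrightarrow> x \<le> 1 \<Longrightarrow> amp x \<le> 1"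
proof (cases "x = 0")
  case False
  assume x: "0 \<le> x" "x \<le> 1"
  then have "- ln x \<le> 1 / x - 1"
    using ln_le_minus_one[of "1 / x"] False by (simp add: ln_div)
  then show ?thesis using x False by (simp add: amp_def field_simps)
qed (simp add: amp_def)

text \<open>Trading the real power for a square root makes later identities algebraic in
  \<open>sqrt (amp x)\<close>. At x = 0 both sides are 0 by the conventions for \<open>powr\<close>
  and division.\<close>

lemma wgt_eq: "0 \<le> x \<Longrightarrow> wgt x = 1 / (amp x * sqrt (amp x))"
  unfolding wgt_def amp_def
  by (cases "x * \<bar>ln x\<bar> = 0")
     (simp_all add: powr_minus_divide powr_half_sqrt[symmetric] powr_add[symmetric] powr_mult_base)

lemma wgt_pos: "0 < x \<Longrightarrow> x < 1 \<Longrightarrow> 0 < wgt x"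
  using amp_pos[of x] by (simp add: wgt_def amp_def)

lemma wgt_nonneg [simp]: "0 \<le> wgt x"
  by (simp add: wgt_def)

lemma wgt_ge_1: "0 < x \<Longrightarrow> x < 1 \<Longrightarrow> 1 \<le> wgt x"
  using amp_pos[of x] amp_le_1[of x]
  by (simp add: wgt_eq mult_le_one)

text \<open>This is what the exponent -3/2 achieves: the V-norm of \<open>amp\<close> times p is the
  integral of p squared against the bounded density \<open>sqrt (amp x)\<close>.\<close>

lemma amp_power2_wgt: "0 \<le> x \<Longrightarrow> (amp x)\<^sup>2 * wgt x = sqrt (amp x)"
  using amp_nonneg[of x] by (cases "amp x = 0") (auto simp: wgt_eq power2_eq_square field_simps)

lemma borel_measurable_wgt [measurable]: "wgt \<in> borel_measurable borel"
  unfolding wgt_def[abs_def] by measurable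

lemma borel_measurable_amp [measurable]: "amp \<in> borel_measurable borel"
  unfolding amp_def[abs_def] by measurable

lemma borel_measurable_flatI [intro]: "f \<in> borel_measurable borel \<Longrightarrow> f \<in> borel_measurable flat"
  by (simp add: measurable_completion measurable_restrict_space1)

lemma borel_measurable_wgt_flat [measurable]: "wgt \<in> borel_measurable flat"
  by (rule borel_measurable_flatI) simp

lemma AE_flat: "AE x in flat. 0 < x \<and> x < 1"
proof -
  have "AE x in lebesgue. x \<noteq> (0::real)"
    using AE_completion[OF AE_lborel_singleton] .
  then have "AE x in lebesgue. x \<in> {0..1/2} \<longrightarrow> (0::real) < x \<and> x < 1"
    by eventually_elim auto
  then show ?thesis by (subst AE_restrict_space_iff) auto
qed

lemma AE_weighted_iff: "(AE x in weighted. P x) \<longleftrightarrow> (AE x in flat. P x)"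
proof -
  have "(AE x in weighted. P x) \<longleftrightarrow> (AE x in flat. 0 < ennreal (wgt x) \<longrightarrow> P x)"
    by (rule AE_density) measurable
  also have "\<dots> \<longleftrightarrow> (AE x in flat. P x)"
  proof
    assume "AE x in flat. 0 < ennreal (wgt x) \<longrightarrow> P x"
    with AE_flat show "AE x in flat. P x" by eventually_elim (simp add: wgt_pos)
  qed (auto elim: eventually_mono)
  finally show ?thesis .
qed

lemma borel_measurable_weighted [simp]: "borel_measurable weighted = borel_measurable flat"
  by (rule measurable_cong_sets) simp_all

lemma sq_integrable_weighted_iff:
  "sq_integrable weighted f \<longleftrightarrow>
    f \<in> borel_measurable flat \<and> integrable flat (\<lambda>x. wgt x * (cmod (f x))\<^sup>2)"
  unfolding sq_integrable_def borel_measurable_weighted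
  by (intro conj_cong refl) (subst integrable_density, auto)

lemma integral_weighted:
  fixes f :: "real \<Rightarrow> 'b::{banach, second_countable_topology}"
  assumes "f \<in> borel_measurable flat"
  shows "(\<integral>x. f x \<partial>weighted) = (\<integral>x. wgt x *\<^sub>R f x \<partial>flat)"
  using assms by (intro integral_density) auto

lemma integrable_weightedD:
  "sq_integrable weighted f \<Longrightarrow> integrable flat (\<lambda>x. wgt x * (cmod (f x))\<^sup>2)"
  by (simp add: sq_integrable_weighted_iff)

lemma sq_integrable_flatI:
  assumes "sq_integrable weighted f" shows "sq_integrable flat f"
  unfolding sq_integrable_def
proof
  show f: "f \<in> borel_measurable flat" using assms by (simp add: sq_integrable_weighted_iff)
  show "integrable flat (\<lambda>x. (cmod (f x))\<^sup>2)"
  proof (rule Bochner_Integration.integrable_bound)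
    show "integrable flat (\<lambda>x. wgt x * (cmod (f x))\<^sup>2)"
      using assms by (simp add: sq_integrable_weighted_iff)
    show "AE x in flat. norm ((cmod (f x))\<^sup>2) \<le> norm (wgt x * (cmod (f x))\<^sup>2)"
      using AE_flat
    proof eventually_elim
      case (elim x)
      then show ?case using wgt_ge_1[of x] by (simp add: mult_le_cancel_right1)
    qed
  qed (use f in auto)
qed

lemma sq_integrable_rep_V [simp]:
  "sq_integrable weighted (rep_l2 (v::V_space))" "sq_integrable flat (rep_l2 (v::V_space))"
  using sq_integrable_rep[OF wgt_tag] sq_integrable_flatI by auto

lemma sq_integrable_rep_H [simp]: "sq_integrable flat (rep_l2 (h::H_space))"
  using sq_integrable_rep[OF flat_tag] by auto

section \<open>The embedding of V in H\<close>

lemma rep_V_to_H: "AE x in flat. rep_l2 (V_to_H v) x = rep_l2 v x"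
  unfolding V_to_H_def by (rule rep_to_l2[OF flat_tag]) simp

lemma V_to_H_to_l2:
  assumes "sq_integrable weighted f" shows "V_to_H (to_l2 f) = to_l2 f"
  unfolding V_to_H_def
  using rep_to_l2[OF wgt_tag assms]
  by (intro to_l2_cong[OF flat_tag]) (auto intro: sq_integrable_flatI assms simp: AE_weighted_iff)

lemma V_to_H_add: "V_to_H (v + w) = V_to_H v + V_to_H w"
proof -
  have "V_to_H (v + w) = V_to_H (to_l2 (\<lambda>x. rep_l2 v x + rep_l2 w x))"
    by (simp add: plus_l2_def)
  also have "\<dots> = to_l2 (\<lambda>x. rep_l2 v x + rep_l2 w x)"
    by (rule V_to_H_to_l2) (intro sq_integrable_add sq_integrable_rep_V)
  also have "\<dots> = V_to_H v + V_to_H w"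
    unfolding V_to_H_def by (rule to_l2_add[OF flat_tag]) simp_all
  finally show ?thesis .
qed

lemma V_to_H_scaleC: "V_to_H (c *\<^sub>C v) = c *\<^sub>C V_to_H v"
proof -
  have "V_to_H (c *\<^sub>C v) = V_to_H (to_l2 (\<lambda>x. c * rep_l2 v x))"
    by (simp add: scaleC_l2_def)
  also have "\<dots> = to_l2 (\<lambda>x. c * rep_l2 v x)"
    by (rule V_to_H_to_l2) (intro sq_integrable_scale sq_integrable_rep_V)
  also have "\<dots> = c *\<^sub>C V_to_H v"
    unfolding V_to_H_def by (rule to_l2_scaleC[OF flat_tag]) simp_all
  finally show ?thesis .
qed

lemma norm_weighted_power2:
  assumes "sq_integrable weighted f"
  shows "(norm (to_l2 f :: V_space))\<^sup>2 = (\<integral>x. wgt x * (cmod (f x))\<^sup>2 \<partial>flat)"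
proof -
  have "f \<in> borel_measurable flat" using assms by (simp add: sq_integrable_weighted_iff)
  then have "(\<integral>x. (cmod (f x))\<^sup>2 \<partial>weighted) = (\<integral>x. wgt x *\<^sub>R (cmod (f x))\<^sup>2 \<partial>flat)"
    by (intro integral_weighted) measurable
  then show ?thesis using norm_to_l2_power2[OF wgt_tag assms] by simp
qed

lemma norm_V_power2: "(norm (v::V_space))\<^sup>2 = (\<integral>x. wgt x * (cmod (rep_l2 v x))\<^sup>2 \<partial>flat)"
  using norm_weighted_power2[OF sq_integrable_rep_V(1), of v] by simp

lemma norm_H_power2: "(norm (h::H_space))\<^sup>2 = (\<integral>x. (cmod (rep_l2 h x))\<^sup>2 \<partial>flat)"
  using norm_to_l2_power2[OF flat_tag sq_integrable_rep_H, of h] by simp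

lemma norm_V_to_H_le: "norm (V_to_H v) \<le> norm v"
proof -
  have "(norm (V_to_H v))\<^sup>2 = (\<integral>x. (cmod (rep_l2 v x))\<^sup>2 \<partial>flat)"
    unfolding V_to_H_def by (rule norm_to_l2_power2[OF flat_tag]) simp
  also have "\<dots> \<le> (\<integral>x. wgt x * (cmod (rep_l2 v x))\<^sup>2 \<partial>flat)"
  proof (rule integral_mono_AE)
    show "AE x in flat. (cmod (rep_l2 v x))\<^sup>2 \<le> wgt x * (cmod (rep_l2 v x))\<^sup>2"
      using AE_flat
      by eventually_elim (use wgt_ge_1 in \<open>auto simp: mult_le_cancel_right1\<close>)
  qed (use sq_integrable_rep_V[of v] integrable_weightedD in \<open>auto simp: sq_integrable_def\<close>)
  also have "\<dots> = (norm v)\<^sup>2" by (simp add: norm_V_power2)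
  finally show ?thesis by (rule power2_le_imp_le) simp
qed

lemma bounded_linear_V_to_H: "bounded_linear V_to_H"
  by (rule bounded_linear_intro[where K=1])
     (simp_all add: V_to_H_add scaleR_scaleC V_to_H_scaleC norm_V_to_H_le)

lemma inj_V_to_H: "inj V_to_H"
proof (rule injI)
  fix v w :: V_space assume eq: "V_to_H v = V_to_H w"
  have "AE x in flat. rep_l2 v x = rep_l2 w x"
    using rep_V_to_H[of v] rep_V_to_H[of w] by eventually_elim (simp add: eq)
  then have "(to_l2 (rep_l2 v) :: V_space) = to_l2 (rep_l2 w)"
    by (intro to_l2_cong[OF wgt_tag]) (simp_all add: AE_weighted_iff)
  then show "v = w" by simp
qed


section \<open>Truncation to the region of bounded weight\<close>

definition wgt_le :: "nat \<Rightarrow> real set" where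
  "wgt_le n = {x. wgt x \<le> real n} \<inter> {0..1/2}"

text \<open>A map from H to V: where the weight is at most n the two norms are comparable. It is a
  spectral cutoff of multiplication by the weight, the operator that represents the inner product of
  V in H.\<close>

definition truncate :: "nat \<Rightarrow> H_space \<Rightarrow> V_space" where
  "truncate n h = to_l2 (\<lambda>x. if x \<in> wgt_le n then rep_l2 h x else 0)"

lemma sets_wgt_le [measurable]: "wgt_le n \<in> sets flat"
proof -
  have "{x\<in>space flat. wgt x \<le> real n} \<in> sets flat" by measurable
  then show ?thesis by (simp add: wgt_le_def Int_def conj_commute)
qed

lemma integrable_truncate:
  "integrable flat (\<lambda>x. wgt x *
     (cmod (if x \<in> wgt_le n then rep_l2 (h::H_space) x else 0))\<^sup>2)"
  (is "integrable flat (\<lambda>x. wgt x * (cmod (?f x))\<^sup>2)")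
proof (rule Bochner_Integration.integrable_bound)
  show "integrable flat (\<lambda>x. real n * (cmod (rep_l2 h x))\<^sup>2)"
    using sq_integrable_rep_H[of h] by (auto simp: sq_integrable_def)
  have "?f \<in> borel_measurable flat"
    using sq_integrable_restrict[OF flat_tag sq_integrable_rep_H sets_wgt_le, of n h]
    by (simp add: sq_integrable_def)
  then show "(\<lambda>x. wgt x * (cmod (?f x))\<^sup>2) \<in> borel_measurable flat" by measurable
  show "AE x in flat. norm (wgt x * (cmod (?f x))\<^sup>2) \<le> norm (real n * (cmod (rep_l2 h x))\<^sup>2)"
    by (auto simp: wgt_le_def mult_right_mono)
qed

lemma sq_integrable_truncate:
  "sq_integrable weighted
     (\<lambda>x. if x \<in> wgt_le n then rep_l2 (h::H_space) x else 0)"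
  unfolding sq_integrable_weighted_iff
  using sq_integrable_restrict[OF flat_tag sq_integrable_rep_H sets_wgt_le, of n h] integrable_truncate
  by (simp add: sq_integrable_def)

lemma rep_truncate:
  "AE x in flat. rep_l2 (truncate n h) x = (if wgt x \<le> real n then rep_l2 h x else 0)"
proof -
  have "AE x in flat. rep_l2 (truncate n h) x =
      (if x \<in> wgt_le n then rep_l2 h x else 0)"
    using rep_to_l2[OF wgt_tag sq_integrable_truncate, of n h]
    unfolding truncate_def AE_weighted_iff .
  moreover have "AE x in flat. x \<in> {0..1/2}" using AE_space[of flat] by simp
  ultimately show ?thesis by eventually_elim (simp add: wgt_le_def)
qed

lemma eq_V_iff: "(v::V_space) = w \<longleftrightarrow> (AE x in flat. rep_l2 v x = rep_l2 w x)"
  using to_l2_eq_iff[of "rep_l2 v" "rep_l2 w", where 'a=wgt_tag]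
  unfolding AE_weighted_iff[symmetric] wgt_tag by simp

lemma rep_add_V: "AE x in flat. rep_l2 (v + w :: V_space) x = rep_l2 v x + rep_l2 w x"
  unfolding plus_l2_def AE_weighted_iff[symmetric]
  by (intro rep_to_l2[OF wgt_tag] sq_integrable_add) simp_all

lemma rep_add_H: "AE x in flat. rep_l2 (v + w :: H_space) x = rep_l2 v x + rep_l2 w x"
  unfolding plus_l2_def by (intro rep_to_l2[OF flat_tag] sq_integrable_add) simp_all

lemma rep_scaleC_V: "AE x in flat. rep_l2 (c *\<^sub>C v :: V_space) x = c * rep_l2 v x"
  unfolding scaleC_l2_def AE_weighted_iff[symmetric]
  by (intro rep_to_l2[OF wgt_tag] sq_integrable_scale) simp_all

lemma rep_scaleC_H: "AE x in flat. rep_l2 (c *\<^sub>C v :: H_space) x = c * rep_l2 v x"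
  unfolding scaleC_l2_def by (intro rep_to_l2[OF flat_tag] sq_integrable_scale) simp_all

lemma norm_truncate_le: "norm (truncate n h) \<le> norm h * sqrt (real n)"
proof -
  have "(norm (truncate n h))\<^sup>2 =
      (\<integral>x. wgt x * (cmod (if x \<in> wgt_le n then rep_l2 h x else 0))\<^sup>2 \<partial>flat)"
    unfolding truncate_def by (rule norm_weighted_power2[OF sq_integrable_truncate])
  also have "\<dots> \<le> (\<integral>x. real n * (cmod (rep_l2 h x))\<^sup>2 \<partial>flat)"
    using integrable_truncate sq_integrable_rep_H[of h]
    by (intro integral_mono) (auto simp: sq_integrable_def wgt_le_def mult_right_mono)
  also have "\<dots> = (norm h * sqrt (real n))\<^sup>2"
    by (simp add: norm_H_power2 power_mult_distrib)
  finally show ?thesis by (rule power2_le_imp_le) simp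
qed

lemma bounded_linear_truncate: "bounded_linear (truncate n)"
proof (rule bounded_linear_intro)
  show "truncate n (h + g) = truncate n h + truncate n g" for h g
    unfolding eq_V_iff
    using rep_truncate[of n "h + g"] rep_truncate[of n h] rep_truncate[of n g]
      rep_add_V[of "truncate n h" "truncate n g"] rep_add_H[of h g]
    by eventually_elim simp
  show "truncate n (r *\<^sub>R h) = r *\<^sub>R truncate n h" for r h
    unfolding eq_V_iff scaleR_scaleC
    using rep_truncate[of n "complex_of_real r *\<^sub>C h"] rep_truncate[of n h]
      rep_scaleC_V[of "of_real r" "truncate n h"] rep_scaleC_H[of "of_real r" h]
    by eventually_elim simp
  show "norm (truncate n h) \<le> norm h * sqrt (real n)" for h by (rule norm_truncate_le)
qed

text \<open>Multiplication by an indicator is self-adjoint. The symmetry is what turns a difference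
  of truncated energies into a single pairing later on.\<close>

lemma cinner_truncate:
  "cinner h (V_to_H (truncate n g)) = cinner (V_to_H (truncate n h)) g"
proof -
  have "cinner h (V_to_H (truncate n g)) =
      (\<integral>x. rep_l2 h x * cnj (rep_l2 (V_to_H (truncate n g)) x) \<partial>flat)"
    by (simp add: cinner_l2_def flip: flat_tag)
  also have "\<dots> = (\<integral>x. rep_l2 (V_to_H (truncate n h)) x * cnj (rep_l2 g x) \<partial>flat)"
    using rep_V_to_H[of "truncate n g"] rep_V_to_H[of "truncate n h"]
      rep_truncate[of n h] rep_truncate[of n g]
    by (intro integral_cong_AE borel_measurable_integrable sq_integrable_mult,
        simp, simp, simp, simp, eventually_elim) simp
  also have "\<dots> = cinner (V_to_H (truncate n h)) g"
    by (simp add: cinner_l2_def flip: flat_tag)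
  finally show ?thesis .
qed

lemma eventually_wgt_le: "AE x in flat. \<forall>\<^sub>F n in sequentially. x \<in> wgt_le n"
proof (rule AE_I2)
  fix x assume "x \<in> space flat"
  moreover have "\<forall>\<^sub>F n in sequentially. wgt x \<le> real n"
    using filterlim_real_sequentially by (simp add: filterlim_at_top)
  ultimately show "\<forall>\<^sub>F n in sequentially. x \<in> wgt_le n"
    by (auto simp: wgt_le_def elim: eventually_mono)
qed

lemma V_to_H_truncate_tendsto: "(\<lambda>n. V_to_H (truncate n h)) \<longlonglongrightarrow> h"
  using tendsto_to_l2_restrict[OF flat_tag sq_integrable_rep_H sets_wgt_le eventually_wgt_le, of h]
  unfolding truncate_def by (simp add: V_to_H_to_l2[OF sq_integrable_truncate])

lemma truncate_V_to_H:
  "truncate n (V_to_H v) = to_l2 (\<lambda>x. if x \<in> wgt_le n then rep_l2 v x else 0)"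
  unfolding truncate_def
  by (rule to_l2_cong[OF wgt_tag])
    (use rep_V_to_H[of v] in \<open>auto simp: AE_weighted_iff elim: eventually_mono
      intro!: sq_integrable_truncate sq_integrable_restrict[OF wgt_tag]\<close>)

lemma truncate_V_to_H_tendsto: "(\<lambda>n. truncate n (V_to_H v)) \<longlonglongrightarrow> v"
  using tendsto_to_l2_restrict[OF wgt_tag sq_integrable_rep_V(1), of "\<lambda>n. wgt_le n" v]
    eventually_wgt_le sets_wgt_le
  unfolding truncate_V_to_H by (simp add: AE_weighted_iff)

text \<open>Unlike \<open>norm_truncate_le\<close>, whose constant grows with n, the contraction
  properties in V and in H are uniform in n and supply the majorant for the limit of the
  energies.\<close>

lemma norm_truncate_V_to_H_le: "norm (truncate n (V_to_H v)) \<le> norm v"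
proof -
  have "(norm (truncate n (V_to_H v)))\<^sup>2 = (\<integral>x. wgt x * (cmod (rep_l2 (truncate n (V_to_H v)) x))\<^sup>2 \<partial>flat)"
    by (rule norm_V_power2)
  also have "\<dots> \<le> (\<integral>x. wgt x * (cmod (rep_l2 v x))\<^sup>2 \<partial>flat)"
  proof (rule integral_mono_AE)
    show "AE x in flat. wgt x * (cmod (rep_l2 (truncate n (V_to_H v)) x))\<^sup>2 \<le> wgt x * (cmod (rep_l2 v x))\<^sup>2"
      using rep_truncate[of n "V_to_H v"] rep_V_to_H[of v] by eventually_elim simp
  qed (auto intro: integrable_weightedD)
  also have "\<dots> = (norm v)\<^sup>2" by (simp add: norm_V_power2)
  finally show ?thesis by (rule power2_le_imp_le) simp
qed

lemma norm_V_to_H_truncate_le: "norm (V_to_H (truncate n h)) \<le> norm h"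
proof -
  have "(norm (V_to_H (truncate n h)))\<^sup>2 = (\<integral>x. (cmod (rep_l2 (V_to_H (truncate n h)) x))\<^sup>2 \<partial>flat)"
    by (rule norm_H_power2)
  also have "\<dots> \<le> (\<integral>x. (cmod (rep_l2 h x))\<^sup>2 \<partial>flat)"
  proof (rule integral_mono_AE)
    show "AE x in flat. (cmod (rep_l2 (V_to_H (truncate n h)) x))\<^sup>2 \<le> (cmod (rep_l2 h x))\<^sup>2"
      using rep_truncate[of n h] rep_V_to_H[of "truncate n h"] by eventually_elim simp
  qed (use sq_integrable_rep_H[of h] sq_integrable_rep_H[of "V_to_H (truncate n h)"] in
    \<open>auto simp: sq_integrable_def\<close>)
  also have "\<dots> = (norm h)\<^sup>2" by (simp add: norm_H_power2)
  finally show ?thesis by (rule power2_le_imp_le) simp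
qed

lemma dense_embedding_V_to_H: "dense_embedding V_to_H"
proof -
  have "h \<in> closure (range V_to_H)" for h
    unfolding closure_sequential
    by (rule exI[of _ "\<lambda>n. V_to_H (truncate n h)"]) (auto intro: V_to_H_truncate_tendsto)
  then show ?thesis
    unfolding dense_embedding_def using bounded_linear_V_to_H V_to_H_scaleC inj_V_to_H by auto
qed

lemma emb_dual_apply [simp]: "blinfun_apply (emb_dual V_to_H h) z = cinner h (V_to_H z)"
proof -
  have "bounded_linear (\<lambda>z. cinner h (V_to_H z))"
    using bounded_linear_compose[OF bounded_linear_cinner_right bounded_linear_V_to_H, of h]
    by (simp add: o_def)
  then show ?thesis unfolding emb_dual_def by (simp add: bounded_linear_Blinfun_apply)
qed

text \<open>Density of V in H: the difference h - g is tested with its own truncations. Injectivity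
  makes the value of the part of the operator in H unique, as the description operator in
  \<open>part_op\<close> requires.\<close>

lemma inj_emb_dual: "emb_dual V_to_H h = emb_dual V_to_H g \<longleftrightarrow> h = g"
proof
  assume "emb_dual V_to_H h = emb_dual V_to_H g"
  then have "cinner h (V_to_H z) = cinner g (V_to_H z)" for z by (metis emb_dual_apply)
  then have "cinner (h - g) (V_to_H (truncate n (h - g))) = 0" for n by (simp add: cinner_diff_left)
  moreover have "(\<lambda>n. cinner (h - g) (V_to_H (truncate n (h - g)))) \<longlonglongrightarrow> cinner (h - g) (h - g)"
    by (intro bounded_linear.tendsto[OF bounded_linear_cinner_right] V_to_H_truncate_tendsto)
  ultimately have "cinner (h - g) (h - g) = 0" by (simp add: LIMSEQ_const_iff)
  then show "h = g" by (simp add: cinner_self)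
qed simp

section \<open>Vectors with the envelope of the example\<close>

text \<open>Every vector of the example is the envelope times a bounded Borel function. Tracking
  only that function reduces statements in V to pointwise ones and settles square integrability once
  and for all.\<close>

definition profile :: "(real \<Rightarrow> real) \<Rightarrow> bool" where
  "profile p \<longleftrightarrow> p \<in> borel_measurable borel \<and> (\<exists>B. \<forall>x\<in>{0..1/2}. \<bar>p x\<bar> \<le> B)"

definition amp_mult :: "(real \<Rightarrow> real) \<Rightarrow> V_space" where
  "amp_mult p = to_l2 (\<lambda>x. complex_of_real (amp x * p x))"

lemma profile_add:
  assumes "profile p" "profile q" shows "profile (\<lambda>x. p x + q x)"
proof -
  from assms obtain A B where "\<forall>x\<in>{0..1/2}. \<bar>p x\<bar> \<le> A" "\<forall>x\<in>{0..1/2}. \<bar>q x\<bar> \<le> B"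
    by (auto simp: profile_def)
  then have "\<forall>x\<in>{0..1/2}. \<bar>p x + q x\<bar> \<le> A + B" by (meson abs_triangle_ineq add_mono order.trans)
  then show ?thesis using assms unfolding profile_def by (intro conjI borel_measurable_add) auto
qed

lemma profile_mult:
  assumes "profile p" "profile q" shows "profile (\<lambda>x. p x * q x)"
proof -
  from assms obtain A B where AB: "\<forall>x\<in>{0..1/2}. \<bar>p x\<bar> \<le> A" "\<forall>x\<in>{0..1/2}. \<bar>q x\<bar> \<le> B"
    by (auto simp: profile_def)
  have "\<forall>x\<in>{0..1/2}. \<bar>p x * q x\<bar> \<le> A * B"
  proof
    fix x :: real assume x: "x \<in> {0..1/2}"
    then have "\<bar>p x\<bar> \<le> A" "\<bar>q x\<bar> \<le> B" using AB by auto
    then show "\<bar>p x * q x\<bar> \<le> A * B" unfolding abs_mult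
      by (intro mult_mono) (auto intro: order.trans[OF abs_ge_zero])
  qed
  then show ?thesis using assms unfolding profile_def by (intro conjI borel_measurable_times) auto
qed

lemma profile_const [simp]: "profile (\<lambda>_. c)"
  by (auto simp: profile_def)

lemma profile_diff:
  assumes "profile p" "profile q" shows "profile (\<lambda>x. p x - q x)"
  using profile_add[OF assms(1) profile_mult[OF profile_const[of "-1"] assms(2)]]
  by simp

lemma profile_power2: "profile p \<Longrightarrow> profile (\<lambda>x. (p x)\<^sup>2)"
  unfolding power2_eq_square by (rule profile_mult)

lemma borel_measurable_phi [measurable]: "phi \<in> borel_measurable borel"
  unfolding phi_def[abs_def] by measurable

lemma profile_trig [simp]:
  "profile (\<lambda>x. sin (t * phi x))" "profile (\<lambda>x. cos (t * phi x))"
  unfolding profile_def by (auto intro!: exI[of _ 1])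

lemma profile_min: "0 \<le> b \<Longrightarrow> profile (\<lambda>x. min 2 (b * phi x))"
  unfolding profile_def by (auto intro!: exI[of _ 2] simp: phi_def min_def)

lemma inverse_wgt_le_1: "0 \<le> x \<Longrightarrow> x \<le> 1/2 \<Longrightarrow> 1 / wgt x \<le> 1"
  using wgt_ge_1[of x] wgt_pos[of x] by (cases "x = 0") (auto simp: wgt_def)

lemma profile_div_wgt:
  assumes "profile p" shows "profile (\<lambda>x. p x / wgt x)"
proof -
  have "profile (\<lambda>x. 1 / wgt x)"
    unfolding profile_def
  proof (intro conjI exI ballI)
    show "(\<lambda>x. 1 / wgt x) \<in> borel_measurable borel" by measurable
    show "\<bar>1 / wgt x\<bar> \<le> 1" if "x \<in> {0..1/2}" for x
      using inverse_wgt_le_1[of x] that by simp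
  qed
  from profile_mult[OF assms this] show ?thesis by simp
qed

lemma profile_sqrt_amp: "profile (\<lambda>x. sqrt (amp x))"
  unfolding profile_def
proof (intro conjI exI ballI)
  show "(\<lambda>x. sqrt (amp x)) \<in> borel_measurable borel" by measurable
  show "\<bar>sqrt (amp x)\<bar> \<le> 1" if "x \<in> {0..1/2}" for x
    using amp_le_1[of x] amp_nonneg[of x] that by simp
qed

lemma integrable_profile:
  assumes "profile p" shows "integrable flat p"
proof -
  obtain B where B: "\<forall>x\<in>{0..1/2}. \<bar>p x\<bar> \<le> B" using assms by (auto simp: profile_def)
  show ?thesis
  proof (rule finite_measure.integrable_const_bound)
    show "finite_measure flat" by (rule finite_measure_lebesgue_on) simp
    show "AE x in flat. norm (p x) \<le> B" using B by (intro AE_I2) simp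
    show "p \<in> borel_measurable flat" using assms by (auto simp: profile_def)
  qed
qed

lemma integrable_sqrt_amp_mult:
  "profile p \<Longrightarrow> integrable flat (\<lambda>x. sqrt (amp x) * p x)"
  by (intro integrable_profile profile_mult profile_sqrt_amp)

lemma integral_flat_cong:
  fixes p q :: "real \<Rightarrow> real"
  assumes "p \<in> borel_measurable borel" "q \<in> borel_measurable borel" "\<And>x. 0 < x \<Longrightarrow> x < 1 \<Longrightarrow> p x = q x"
  shows "(\<integral>x. p x \<partial>flat) = (\<integral>x. q x \<partial>flat)"
    and "integrable flat p \<longleftrightarrow> integrable flat q"
proof -
  have ae: "AE x in flat. p x = q x" using AE_flat by eventually_elim (use assms(3) in auto)
  show "(\<integral>x. p x \<partial>flat) = (\<integral>x. q x \<partial>flat)"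
    by (rule integral_cong_AE[OF borel_measurable_flatI[OF assms(1)] borel_measurable_flatI[OF assms(2)] ae])
  show "integrable flat p \<longleftrightarrow> integrable flat q"
    by (rule integrable_cong_AE[OF borel_measurable_flatI[OF assms(1)] borel_measurable_flatI[OF assms(2)] ae])
qed

lemma AE_flat_nonneg: "AE x in flat. 0 \<le> x \<and> x \<le> 1/2"
  by (rule AE_I2) simp

lemma sq_integrable_amp_mult:
  assumes "profile p"
  shows "sq_integrable weighted (\<lambda>x. complex_of_real (amp x * p x))"
proof -
  have [measurable]: "p \<in> borel_measurable borel" using assms by (auto simp: profile_def)
  have meas: "(\<lambda>x. complex_of_real (amp x * p x)) \<in> borel_measurable flat"
    by (rule borel_measurable_flatI) measurable
  have "integrable flat (\<lambda>x. sqrt (amp x) * (p x)\<^sup>2) \<longleftrightarrow>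
      integrable flat (\<lambda>x. wgt x * (cmod (of_real (amp x * p x)))\<^sup>2)"
    by (rule integral_flat_cong(2), measurable)
      (simp add: amp_power2_wgt[symmetric] norm_mult power_mult_distrib ac_simps del: of_real_mult)
  with integrable_sqrt_amp_mult[OF profile_power2[OF assms]] meas show ?thesis
    by (simp add: sq_integrable_weighted_iff)
qed

lemma norm_amp_mult_power2:
  assumes "profile p"
  shows "(norm (amp_mult p))\<^sup>2 = (\<integral>x. sqrt (amp x) * (p x)\<^sup>2 \<partial>flat)"
proof -
  have [measurable]: "p \<in> borel_measurable borel" using assms by (auto simp: profile_def)
  have "(norm (amp_mult p))\<^sup>2 = (\<integral>x. wgt x * (cmod (of_real (amp x * p x)))\<^sup>2 \<partial>flat)"
    unfolding amp_mult_def by (rule norm_weighted_power2[OF sq_integrable_amp_mult[OF assms]])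
  also have "\<dots> = (\<integral>x. sqrt (amp x) * (p x)\<^sup>2 \<partial>flat)"
    by (rule integral_flat_cong(1), measurable)
      (simp add: amp_power2_wgt[symmetric] norm_mult power_mult_distrib ac_simps del: of_real_mult)
  finally show ?thesis .
qed

lemma amp_mult_diff:
  assumes "profile p" "profile q"
  shows "amp_mult (\<lambda>x. p x - q x) = amp_mult p - amp_mult q"
  using to_l2_diff[OF wgt_tag sq_integrable_amp_mult[OF assms(1)] sq_integrable_amp_mult[OF assms(2)]]
  unfolding amp_mult_def by (simp add: algebra_simps)

lemma amp_mult_scaleR:
  assumes "profile p"
  shows "amp_mult (\<lambda>x. c * p x) = c *\<^sub>R amp_mult p"
  using to_l2_scaleC[OF wgt_tag sq_integrable_amp_mult[OF assms(1)], of "of_real c"]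
  unfolding amp_mult_def by (simp add: scaleR_scaleC mult.left_commute)

lemma cinner_amp_mult_left:
  assumes "profile p" "sq_integrable weighted f"
  shows "cinner (amp_mult p) (to_l2 f) = (\<integral>x. of_real (wgt x * amp x * p x) * cnj (f x) \<partial>flat)"
proof -
  have [measurable]: "p \<in> borel_measurable borel" using assms by (auto simp: profile_def)
  have [measurable]: "f \<in> borel_measurable flat" using assms(2) by (simp add: sq_integrable_weighted_iff)
  have *: "(\<lambda>x. complex_of_real (amp x * p x)) \<in> borel_measurable flat"
    by (rule borel_measurable_flatI) measurable
  have **: "(\<lambda>x. cnj (f x)) \<in> borel_measurable flat"
    by (rule borel_measurable_continuous_on[where f=cnj]) (auto intro: continuous_intros)
  have "cinner (amp_mult p) (to_l2 f) = (\<integral>x. of_real (amp x * p x) * cnj (f x) \<partial>weighted)"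
    unfolding amp_mult_def
    by (rule cinner_to_l2[OF wgt_tag sq_integrable_amp_mult[OF assms(1)] assms(2)])
  also have "\<dots> = (\<integral>x. wgt x *\<^sub>R (of_real (amp x * p x) * cnj (f x)) \<partial>flat)"
    by (intro integral_weighted borel_measurable_times * **)
  finally show ?thesis by (simp add: scaleR_conv_of_real mult.assoc)
qed

lemma cinner_amp_mult:
  assumes "profile p" "profile q"
  shows "cinner (amp_mult p) (amp_mult q) = of_real (\<integral>x. sqrt (amp x) * (p x * q x) \<partial>flat)"
proof -
  have [measurable]: "p \<in> borel_measurable borel" "q \<in> borel_measurable borel"
    using assms by (auto simp: profile_def)
  have "cinner (amp_mult p) (amp_mult q) =
      (\<integral>x. of_real (wgt x * amp x * p x) * cnj (of_real (amp x * q x)) \<partial>flat)"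
    unfolding amp_mult_def[of q]
    by (rule cinner_amp_mult_left[OF assms(1) sq_integrable_amp_mult[OF assms(2)]])
  also have "\<dots> = (\<integral>x. complex_of_real (wgt x * amp x * p x * (amp x * q x)) \<partial>flat)"
    by simp
  also have "\<dots> = of_real (\<integral>x. wgt x * amp x * p x * (amp x * q x) \<partial>flat)"
    by (rule integral_complex_of_real)
  also have "(\<integral>x. wgt x * amp x * p x * (amp x * q x) \<partial>flat) = (\<integral>x. sqrt (amp x) * (p x * q x) \<partial>flat)"
    by (rule integral_flat_cong(1), measurable)
      (simp add: amp_power2_wgt[symmetric] power2_eq_square ac_simps)
  finally show ?thesis .
qed

text \<open>The inner product of H is that of V after division by the weight; since the weight is at
  least 1, the quotient is again a profile.\<close>

lemma emb_dual_V_to_H_amp_mult: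
  assumes "profile p"
  shows "emb_dual V_to_H (V_to_H (amp_mult p)) = riesz (amp_mult (\<lambda>x. p x / wgt x))"
proof (rule blinfun_eqI)
  fix z :: V_space
  have [measurable]: "p \<in> borel_measurable borel" using assms by (auto simp: profile_def)
  have z: "sq_integrable flat (rep_l2 z)" by simp
  note p = sq_integrable_amp_mult[OF assms]
  have "cinner (V_to_H (amp_mult p)) (V_to_H z) = (\<integral>x. of_real (amp x * p x) * cnj (rep_l2 z x) \<partial>flat)"
    unfolding amp_mult_def V_to_H_to_l2[OF p] unfolding V_to_H_def
    by (rule cinner_to_l2[OF flat_tag sq_integrable_flatI[OF p] z])
  also have "\<dots> = (\<integral>x. of_real (wgt x * amp x * (p x / wgt x)) * cnj (rep_l2 z x) \<partial>flat)"
  proof (rule integral_cong_AE)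
    have c: "(\<lambda>x. cnj (rep_l2 z x)) \<in> borel_measurable flat" using z
      by (intro borel_measurable_continuous_on[where f=cnj]) (auto intro: continuous_intros simp: sq_integrable_def)
    show "(\<lambda>x. of_real (amp x * p x) * cnj (rep_l2 z x)) \<in> borel_measurable flat"
      by (intro borel_measurable_times c borel_measurable_flatI) measurable
    show "(\<lambda>x. of_real (wgt x * amp x * (p x / wgt x)) * cnj (rep_l2 z x)) \<in> borel_measurable flat"
      by (intro borel_measurable_times c borel_measurable_flatI) measurable
    show "AE x in flat. of_real (amp x * p x) * cnj (rep_l2 z x) =
        of_real (wgt x * amp x * (p x / wgt x)) * cnj (rep_l2 z x)"
      using AE_flat by eventually_elim (use wgt_pos in \<open>auto simp: less_imp_neq[symmetric]\<close>)
  qed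
  also have "\<dots> = cinner (amp_mult (\<lambda>x. p x / wgt x)) z"
    using cinner_amp_mult_left[OF profile_div_wgt[OF assms], of "rep_l2 z"] by simp
  finally show "blinfun_apply (emb_dual V_to_H (V_to_H (amp_mult p))) z =
      blinfun_apply (riesz (amp_mult (\<lambda>x. p x / wgt x))) z" by simp
qed


section \<open>The time derivative\<close>

abbreviation amp32 :: "real \<Rightarrow> real" where "amp32 x \<equiv> amp x * sqrt (amp x)"

lemma ln_le_minus_2: "0 < x \<Longrightarrow> x \<le> exp (-2) \<Longrightarrow> ln x \<le> (-2::real)"
  using ln_mono[of x "exp (-2)"] by simp

lemma exp_minus_2_bounds: "exp (-2) \<le> (1/2::real)" "1 / 16 \<le> exp (-2::real)"
proof -
  have *: "exp (-2) = inverse ((exp 1)\<^sup>2 :: real)"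
    by (simp add: exp_minus flip: exp_of_nat_mult[of 2 1])
  have "2\<^sup>2 \<le> (exp 1 :: real)\<^sup>2" using exp_ge_add_one_self[of 1] by (intro power_mono) auto
  then show "exp (-2) \<le> (1/2::real)" unfolding * by (simp add: field_simps)
  have "(exp 1 :: real)\<^sup>2 \<le> 3\<^sup>2" using exp_le by (intro power_mono) auto
  then show "1 / 16 \<le> exp (-2::real)" unfolding * by (simp add: field_simps)
qed

lemma DERIV_amp:
  assumes "0 < x" "x < 1" shows "(amp has_field_derivative - ln x - 1) (at x)"
proof (rule has_field_derivative_transform_within_open)
  show "((\<lambda>x. x * (- ln x)) has_field_derivative - ln x - 1) (at x)"
    using assms by (auto intro!: derivative_eq_intros)
  show "x \<in> {0<..<1}" using assms by simp
  show "y * (- ln y) = amp y" if "y \<in> {0<..<1}" for y using that by (simp add: amp_def)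
qed simp

lemma DERIV_amp_sqrt_amp:
  assumes "0 < x" "x < 1"
  shows "(amp32 has_field_derivative 3/2 * sqrt (amp x) * (- ln x - 1)) (at x)"
proof -
  have a: "0 < amp x" using assms by (rule amp_pos)
  define r where "r = sqrt (amp x)"
  have r: "0 < r" "amp x = r * r" using a by (auto simp: r_def)
  have "(- ln x - 1) * sqrt (amp x) + inverse (sqrt (amp x)) / 2 * (- ln x - 1) * amp x =
      3/2 * sqrt (amp x) * (- ln x - 1)"
    unfolding r_def[symmetric] unfolding r(2) using r(1) by (simp add: field_simps)
  with DERIV_mult[OF DERIV_amp[OF assms] DERIV_chain2[OF DERIV_real_sqrt[OF a] DERIV_amp[OF assms]]]
  show ?thesis by (simp only:)
qed

text \<open>The integrand \<open>cos\<^sup>2 (t \<phi>) / amp\<close> has, up to a bounded error, an explicit antiderivative,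
  obtained by integrating the oscillating part of \<open>cos\<^sup>2\<close> by parts.\<close>

lemma antiderivative_cos_power2:
  fixes t x :: real
  assumes t: "0 < t" and x: "0 < x" "x \<le> exp (-2)"
  defines "g \<equiv> \<lambda>x. amp32 x / (3 * t * (- ln x - 1))"
  defines "F \<equiv> \<lambda>x. - (1/2) * ln (- ln x) - (1/2) * (g x * sin (2 * t / amp32 x))"
  shows "\<exists>D. (F has_field_derivative D) (at x) \<and> D \<le> (cos (t * phi x))\<^sup>2 / amp x + 1 / t"
    and "\<bar>g x\<bar> \<le> 1 / (3 * t)"
proof -
  \<comment> \<open>\<open>g\<close> is 1/\<open>amp\<close> divided by minus the derivative of the
    phase 2 t \<phi>. Differentiating the sine in \<open>F\<close> therefore returns cos(2 t
    \<phi>)/(2 \<open>amp\<close>), and only half of g' times the sine is left as error. The double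
    logarithm accounts for the mean part 1/(2 \<open>amp\<close>) of the integrand.\<close>
  define L where "L = - ln x"
  define r where "r = sqrt (amp x)"
  have L: "2 \<le> L" using ln_le_minus_2[OF x] by (simp add: L_def)
  have x1: "x < 1" using x exp_minus_2_bounds by simp
  have a: "amp x = x * L" using x1 x by (simp add: amp_def L_def)
  have r: "0 < r" "r \<le> 1" "r * r = x * L"
    using x L amp_le_1[of x] x1 amp_nonneg[of x] by (simp_all add: r_def a)
  have eq: "ln x = - L" "amp x = r * r" "\<bar>r\<bar> = r" using r(1) by (simp_all add: L_def a r(3))
  have phi: "phi x = 1 / (r * r * r)" using x wgt_eq[of x] by (simp add: phi_def eq)
  have "\<bar>g x\<bar> = r * r * r / (3 * t * (L - 1))"
    using L r(1) t by (simp add: g_def eq abs_mult)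
  also have "\<dots> \<le> 1 / (3 * t)"
  proof (intro frac_le)
    show "r * r * r \<le> 1" using r(1,2) by (simp add: mult_le_one)
    show "3 * t \<le> 3 * t * (L - 1)" using L t by simp
  qed (use t in auto)
  finally show "\<bar>g x\<bar> \<le> 1 / (3 * t)" .
  define s where "s = sin (2 * t * phi x)"
  define c where "c = cos (2 * t * phi x)"
  define g' where "g' = (3/2 * r + r * L / (L - 1)\<^sup>2) / (3 * t)"
  have Nx: "amp32 x = r * r * r" by (simp add: eq)
  have n: "(amp32 has_field_derivative 3/2 * r * (L - 1)) (at x)"
    using DERIV_amp_sqrt_amp[OF x(1) x1] by (simp add: r_def L_def)
  have dg: "(g has_field_derivative g') (at x)"
  proof -
    have d: "((\<lambda>x. 3 * t * (- ln x - 1)) has_field_derivative - (3 * t / x)) (at x)"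
      using x by (auto intro!: derivative_eq_intros)
    have "((\<lambda>x. amp32 x / (3 * t * (- ln x - 1))) has_field_derivative
        (3/2 * r * (L - 1) * (3 * t * (- ln x - 1)) - amp32 x * - (3 * t / x))
         / ((3 * t * (- ln x - 1)) * (3 * t * (- ln x - 1)))) (at x)"
      by (rule DERIV_divide[OF n d]) (use L t in \<open>auto simp: eq\<close>)
    moreover have "(3/2 * r * (L - 1) * (3 * t * (- ln x - 1)) - amp32 x * - (3 * t / x))
         / ((3 * t * (- ln x - 1)) * (3 * t * (- ln x - 1))) = g'"
      using x L t r(1) by (simp add: eq g'_def divide_simps power2_eq_square) (simp add: algebra_simps r(3))
    ultimately show ?thesis unfolding g_def by simp
  qed
  have "(0 * amp32 x - 2 * t * (3/2 * r * (L - 1))) /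
      (amp32 x * amp32 x) =
      - (3 * t * (L - 1) / (r * r * r * r * r))"
    unfolding Nx using r(1) by (simp add: field_simps)
  moreover have "amp32 x \<noteq> 0" unfolding Nx using r(1) by simp
  ultimately have dphi: "((\<lambda>x. 2 * t / amp32 x) has_field_derivative
      - (3 * t * (L - 1) / (r * r * r * r * r))) (at x)"
    using DERIV_divide[OF DERIV_const[of "2 * t"] n] by (simp only: not_False_eq_True simp_thms)
  have arg: "2 * t / amp32 x = 2 * t * phi x"
    by (simp add: eq phi)
  have gx: "g x = r * r * r / (3 * t * (L - 1))" by (simp add: g_def eq)
  have dln: "((\<lambda>x. ln (- ln x)) has_field_derivative - (1 / x) / L) (at x)"
    using x L by (auto intro!: derivative_eq_intros simp: eq(1))
  have dsin: "((\<lambda>x. sin (2 * t / amp32 x)) has_field_derivative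
      c * - (3 * t * (L - 1) / (r * r * r * r * r))) (at x)"
    using DERIV_chain2[OF DERIV_sin dphi] unfolding arg c_def .
  have "(F has_field_derivative - (1/2) * (- (1 / x) / L) -
      (1/2) * (g' * s + c * - (3 * t * (L - 1) / (r * r * r * r * r)) * g x)) (at x)"
    unfolding F_def using DERIV_diff[OF DERIV_cmult[OF dln] DERIV_cmult[OF DERIV_mult[OF dg dsin]]]
    unfolding arg s_def .
  moreover have "- (1/2) * (- (1 / x) / L) -
      (1/2) * (g' * s + c * - (3 * t * (L - 1) / (r * r * r * r * r)) * g x) =
      (1 + c) / (2 * amp x) - g' * s / 2"
    unfolding gx using x L t r(1) by (simp add: eq r(3)[symmetric]) (simp add: field_simps)
  moreover have "(1 + c) / (2 * amp x) = (cos (t * phi x))\<^sup>2 / amp x"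
    using cos_double_cos[of "t * phi x"] by (simp add: c_def field_simps)
  moreover have "- (g' * s / 2) \<le> 1 / t"
  proof -
    \<comment> \<open>The difference of the two sides is (2 L - 1)(L - 2), and L is at least 2 on
      the interval considered.\<close>
    have "L \<le> 2 * (L - 1)\<^sup>2"
      using L mult_nonneg_nonneg[of "2 * L - 1" "L - 2"] by (simp add: power2_eq_square algebra_simps)
    then have "L / (L - 1)\<^sup>2 \<le> 2" using L by (simp add: field_simps)
    then have "r * (L / (L - 1)\<^sup>2) \<le> 1 * 2" using r L by (intro mult_mono) auto
    then have "3/2 * r + r * L / (L - 1)\<^sup>2 \<le> 6" using r by simp
    then have "g' \<le> 6 / (3 * t)" unfolding g'_def using t by (intro divide_right_mono) auto
    moreover have "0 \<le> g'" unfolding g'_def using r L t by auto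
    moreover have "\<bar>s\<bar> \<le> 1" by (simp add: s_def)
    ultimately have "\<bar>g' * s\<bar> \<le> 6 / (3 * t) * 1" unfolding abs_mult using t by (intro mult_mono) auto
    moreover have "6 / (3 * t) = 2 * (1 / t)" by simp
    ultimately show ?thesis by linarith
  qed
  ultimately show "\<exists>D. (F has_field_derivative D) (at x) \<and> D \<le> (cos (t * phi x))\<^sup>2 / amp x + 1 / t"
    by - (rule exI, rule conjI, assumption, linarith)
qed

text \<open>A common form for t > 0 and for t = 0, where nothing oscillates and the construction
  above would divide by zero. What matters is that \<open>F\<close> tends to minus infinity at 0, at
  the rate of a double logarithm.\<close>

lemma antiderivative_cos_power2_exists:
  fixes t :: real assumes "0 \<le> t"
  shows "\<exists>F C K. (\<forall>x\<in>{0<..exp (-2)}. \<exists>D. (F has_field_derivative D) (at x) \<and> D \<le> (cos (t * phi x))\<^sup>2 / amp x + C)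
     \<and> (\<forall>x\<in>{0<..exp (-2)}. F x \<le> K - ln (- ln x) / 2) \<and> 0 \<le> C"
proof (cases "t = 0")
  case False
  with assms have t: "0 < t" by simp
  let ?g = "\<lambda>x::real. amp32 x / (3 * t * (- ln x - 1))"
  let ?F = "\<lambda>x. - (1/2) * ln (- ln x) - (1/2) * (?g x * sin (2 * t / amp32 x))"
  have "?F x \<le> 1 / (3 * t) - ln (- ln x) / 2" if x: "x \<in> {0<..exp (-2)}" for x
  proof -
    have "\<bar>?g x * sin (2 * t / amp32 x)\<bar> \<le> 1 / (3 * t) * 1"
      unfolding abs_mult by (intro mult_mono antiderivative_cos_power2(2) t) (use x t in auto)
    moreover have "- (1/2) * Q - (1/2) * P \<le> B - Q / 2" if "\<bar>P\<bar> \<le> B * 1" for P Q B :: real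
      using that by (auto simp: abs_if split: if_splits)
    ultimately show ?thesis by blast
  qed
  moreover have "\<exists>D. (?F has_field_derivative D) (at x) \<and> D \<le> (cos (t * phi x))\<^sup>2 / amp x + 1 / t"
    if "x \<in> {0<..exp (-2)}" for x
    by (rule antiderivative_cos_power2(1)) (use that t in auto)
  ultimately show ?thesis using t
    by (intro exI[of _ ?F] exI[of _ "1 / t"] exI[of _ "1 / (3 * t)"]) auto
next
  case True
  have lnx: "2 \<le> - ln x" "x < 1" if x: "x \<in> {0<..exp (-2)}" for x :: real
  proof -
    show "2 \<le> - ln x" using x ln_mono[of x "exp (-2)"] by simp
    show "x < 1" using x exp_minus_2_bounds by auto
  qed
  have "\<exists>D. ((\<lambda>x. - ln (- ln x)) has_field_derivative D) (at x) \<and> D \<le> (cos (t * phi x))\<^sup>2 / amp x + 0"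
    if x: "x \<in> {0<..exp (-2)}" for x
    using lnx[OF x] x True
    by (intro exI[of _ "1 / (x * (- ln x))"] conjI) (auto intro!: derivative_eq_intros simp: amp_def field_simps)
  moreover have "- ln (- ln x) \<le> 0 - ln (- ln x) / 2" if "x \<in> {0<..exp (-2)}" for x :: real
    using lnx[OF that] by simp
  ultimately show ?thesis by (intro exI[of _ "\<lambda>x. - ln (- ln x)"] exI[of _ 0]) auto
qed

text \<open>Multiplied by \<open>amp\<close>, this is cos(t \<phi>)/sqrt(\<open>amp\<close>), the
  pointwise time derivative of u, cut off near 0 so that it belongs to V. It serves as its own test
  function.\<close>

definition cutoff_profile :: "real \<Rightarrow> real \<Rightarrow> real \<Rightarrow> real" where
  "cutoff_profile t b x = indicator {b..1/2} x * (cos (t * phi x) * phi x)"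

text \<open>The squared H-norm of the cut-off derivative, and at the same time its pairing with the
  uncut derivative.\<close>

definition cutoff_integral :: "real \<Rightarrow> real \<Rightarrow> real" where
  "cutoff_integral t b = (\<integral>x. indicator {b..1/2} x * ((cos (t * phi x))\<^sup>2 / amp x) \<partial>flat)"

lemma amp_ge_on_interval:
  assumes "0 < b" "b \<le> x" "x \<le> 1/2" shows "b * ln 2 \<le> amp x"
proof -
  have "ln x \<le> - ln 2" using assms ln_mono[of x "1/2"] by (simp add: ln_div)
  then have "ln 2 \<le> \<bar>ln x\<bar>" by simp
  then show ?thesis unfolding amp_def using assms by (intro mult_mono) auto
qed

lemma wgt_le_on_interval:
  assumes "0 < b" "b \<le> x" "x \<le> 1/2" shows "wgt x \<le> (b * ln 2) powr (-3/2)"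
  using amp_ge_on_interval[OF assms] assms(1) unfolding wgt_def amp_def
  by (intro powr_mono2') auto

lemma profile_indicator_mult:
  assumes "p \<in> borel_measurable borel" "\<And>x. b \<le> x \<Longrightarrow> x \<le> 1/2 \<Longrightarrow> \<bar>p x\<bar> \<le> B" "0 \<le> B"
  shows "profile (\<lambda>x. indicator {b..1/2} x * p x)"
  unfolding profile_def
proof (intro conjI exI ballI)
  show "(\<lambda>x. indicator {b..1/2} x * p x) \<in> borel_measurable borel"
    using assms(1) by measurable
  show "\<bar>indicator {b..1/2} x * p x\<bar> \<le> B" for x
    using assms(2)[of x] assms(3) by (auto simp: indicator_def)
qed

lemma profile_cutoff:
  assumes "0 < b" shows "profile (cutoff_profile t b)"
proof -
  have [measurable]: "(\<lambda>x. cos (t * phi x)) \<in> borel_measurable borel" by measurable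
  have "\<bar>cos (t * phi x) * phi x\<bar> \<le> (b * ln 2) powr (-3/2)" if "b \<le> x" "x \<le> 1/2" for x
  proof -
    have "\<bar>cos (t * phi x)\<bar> * phi x \<le> 1 * (b * ln 2) powr (-3/2)"
      using wgt_le_on_interval[OF assms that] by (intro mult_mono) (auto simp: phi_def)
    then show ?thesis by (simp add: abs_mult phi_def)
  qed
  then show ?thesis unfolding cutoff_profile_def[abs_def]
    by (intro profile_indicator_mult[where B="(b * ln 2) powr (-3/2)"]) measurable
qed

lemma integrable_cutoff:
  assumes "0 < b"
  shows "integrable flat (\<lambda>x. indicator {b..1/2} x * ((cos (t * phi x))\<^sup>2 / amp x))"
proof (rule integrable_profile, rule profile_indicator_mult)
  show "(\<lambda>x. (cos (t * phi x))\<^sup>2 / amp x) \<in> borel_measurable borel" by measurable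
  show "\<bar>(cos (t * phi x))\<^sup>2 / amp x\<bar> \<le> 1 / (b * ln 2)" if "b \<le> x" "x \<le> 1/2" for x
  proof -
    have "0 < b * ln 2" using assms by simp
    moreover have "(cos (t * phi x))\<^sup>2 \<le> 1" by (simp add: abs_square_le_1)
    ultimately have "(cos (t * phi x))\<^sup>2 / amp x \<le> 1 / (b * ln 2)"
      using amp_ge_on_interval[OF assms that] by (intro frac_le) auto
    then show ?thesis using amp_nonneg[of x] that assms by simp
  qed
  show "0 \<le> 1 / (b * ln 2)" using assms by simp
qed

lemma sqrt_amp_mult_phi: "0 < x \<Longrightarrow> x < 1 \<Longrightarrow> sqrt (amp x) * phi x = 1 / amp x"
  using amp_pos[of x] by (simp add: phi_def wgt_eq)

lemma cinner_cos_cutoff: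
  assumes "0 < b"
  shows "cinner (amp_mult (\<lambda>x. cos (t * phi x))) (amp_mult (cutoff_profile t b)) =
      of_real (cutoff_integral t b)"
    and "cinner (amp_mult (\<lambda>x. cutoff_profile t b x / wgt x)) (amp_mult (cutoff_profile t b)) =
      of_real (cutoff_integral t b)"
proof -
  have [measurable]: "cutoff_profile t b \<in> borel_measurable borel"
    using profile_cutoff[OF assms] by (auto simp: profile_def)
  have 1: "(\<integral>x. sqrt (amp x) * (cos (t * phi x) * cutoff_profile t b x) \<partial>flat) = cutoff_integral t b"
    unfolding cutoff_integral_def
  proof (rule integral_flat_cong(1))
    fix x :: real assume x: "0 < x" "x < 1"
    have "sqrt (amp x) * (cos (t * phi x) * cutoff_profile t b x) =
        indicator {b..1/2} x * ((cos (t * phi x))\<^sup>2 * (sqrt (amp x) * phi x))"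
      by (simp add: cutoff_profile_def power2_eq_square ac_simps)
    then show "sqrt (amp x) * (cos (t * phi x) * cutoff_profile t b x) =
        indicator {b..1/2} x * ((cos (t * phi x))\<^sup>2 / amp x)"
      using x by (simp add: sqrt_amp_mult_phi)
  qed measurable
  have 2: "(\<integral>x. sqrt (amp x) * (cutoff_profile t b x / wgt x * cutoff_profile t b x) \<partial>flat) = cutoff_integral t b"
    unfolding cutoff_integral_def
  proof (rule integral_flat_cong(1))
    fix x :: real assume x: "0 < x" "x < 1"
    have "cutoff_profile t b x / wgt x = indicator {b..1/2} x * cos (t * phi x)"
      using wgt_pos[OF x] by (simp add: cutoff_profile_def phi_def)
    then have "sqrt (amp x) * (cutoff_profile t b x / wgt x * cutoff_profile t b x) =
        indicator {b..1/2} x * ((cos (t * phi x))\<^sup>2 * (sqrt (amp x) * phi x))"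
      by (simp add: cutoff_profile_def power2_eq_square indicator_def)
    then show "sqrt (amp x) * (cutoff_profile t b x / wgt x * cutoff_profile t b x) =
        indicator {b..1/2} x * ((cos (t * phi x))\<^sup>2 / amp x)"
      using x by (simp add: sqrt_amp_mult_phi)
  qed measurable
  note cut = profile_cutoff[OF assms]
  show "cinner (amp_mult (\<lambda>x. cos (t * phi x))) (amp_mult (cutoff_profile t b)) =
      of_real (cutoff_integral t b)"
    by (subst cinner_amp_mult[OF _ cut]) (simp_all only: profile_trig 1)
  show "cinner (amp_mult (\<lambda>x. cutoff_profile t b x / wgt x)) (amp_mult (cutoff_profile t b)) =
      of_real (cutoff_integral t b)"
    by (subst cinner_amp_mult[OF profile_div_wgt[OF cut] cut]) (simp only: 2)
qed

lemma cutoff_integral_ge: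
  assumes F: "\<forall>x\<in>{0<..exp (-2)}. \<exists>D. (F has_field_derivative D) (at x) \<and> D \<le> (cos (t * phi x))\<^sup>2 / amp x + C"
    and C: "0 \<le> C" and b: "0 < b" "b \<le> exp (-2)"
  shows "F (exp (-2)) - F b \<le> cutoff_integral t b + C"
proof -
  let ?c = "exp (-2) :: real"
  let ?h = "\<lambda>x. indicator {b..1/2} x * ((cos (t * phi x))\<^sup>2 / amp x)"
  have c: "?c \<le> 1/2"
  proof -
    have "2 \<le> exp (2::real)" using exp_ge_add_one_self[of 2] by simp
    then show ?thesis by (simp add: exp_minus field_simps)
  qed
  obtain D where D: "\<And>x. x \<in> {0<..?c} \<Longrightarrow> (F has_field_derivative D x) (at x)"
      "\<And>x. x \<in> {0<..?c} \<Longrightarrow> D x \<le> (cos (t * phi x))\<^sup>2 / amp x + C"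
    using F by metis
  have FTC: "(D has_integral (F ?c - F b)) {b..?c}"
  proof (rule fundamental_theorem_of_calculus[OF b(2)])
    fix x assume "x \<in> {b..?c}"
    then have "(F has_field_derivative D x) (at x)" using D(1)[of x] b by auto
    then show "(F has_vector_derivative D x) (at x within {b..?c})"
      by (simp add: has_real_derivative_iff_has_vector_derivative[symmetric] has_field_derivative_at_within)
  qed
  have hL: "?h integrable_on {0..1/2}" "cutoff_integral t b = integral {0..1/2} ?h"
    using integrable_cutoff[OF b(1)] unfolding cutoff_integral_def
    by (auto intro: integrable_on_lebesgue_on lebesgue_integral_eq_integral)
  have h2: "?h integrable_on {b..?c}"
    using hL(1) by (rule integrable_on_subinterval) (use b c in auto)
  have "integral {b..?c} D \<le> integral {b..?c} (\<lambda>x. ?h x + C)"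
    using FTC h2 D(2) b c by (intro integral_le integrable_add) (auto simp: indicator_def)
  also have "\<dots> = integral {b..?c} ?h + C * (?c - b)"
    using h2 b by (subst Henstock_Kurzweil_Integration.integral_add) auto
  also have "\<dots> \<le> integral {0..1/2} ?h + C * 1"
  proof (intro add_mono mult_left_mono C)
    show "integral {b..?c} ?h \<le> integral {0..1/2} ?h"
      using b c hL h2 amp_nonneg by (intro integral_subset_le) (auto simp: indicator_def)
    show "?c - b \<le> 1" using b by (simp add: order.trans[of _ "?c"])
  qed
  finally show ?thesis using FTC hL(2) by (simp add: integral_unique)
qed

lemma cutoff_integral_unbounded:
  assumes "0 \<le> t" shows "\<exists>b>0. K < cutoff_integral t b"
proof -
  obtain F C K' where
    F: "\<forall>x\<in>{0<..exp (-2)}. \<exists>D. (F has_field_derivative D) (at x) \<and> D \<le> (cos (t * phi x))\<^sup>2 / amp x + C"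
    and K': "\<forall>x\<in>{0<..exp (-2)}. F x \<le> K' - ln (- ln x) / 2" and C: "0 \<le> C"
    using antiderivative_cos_power2_exists[OF assms] by blast
  \<comment> \<open>The double exponential in \<open>b\<close> makes ln(-ln b) equal to A, so
    \<open>F b\<close> lies below K' - A/2 and the bound on the cut-off integral exceeds K.\<close>
  define A where "A = max 1 (2 * (K + K' + C - F (exp (-2)) + 1))"
  define b where "b = exp (- exp A)"
  have "1 \<le> A" by (simp add: A_def)
  then have "2 \<le> exp A" using exp_ge_add_one_self[of A] by linarith
  then have b: "0 < b" "b \<le> exp (-2)" by (simp_all add: b_def)
  have "ln b = - exp A" by (simp add: b_def)
  then have "F b \<le> K' - A / 2" using bspec[OF K', of b] b by simp
  moreover have "F (exp (-2)) - F b \<le> cutoff_integral t b + C" by (rule cutoff_integral_ge[OF F C b])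
  moreover have "2 * (K + K' + C - F (exp (-2)) + 1) \<le> A" by (simp add: A_def)
  moreover have "K < I" if "Fb \<le> K' - A / 2" "F2 - Fb \<le> I + C" "2 * (K + K' + C - F2 + 1) \<le> A"
    for Fb F2 I :: real using that by argo
  ultimately have "K < cutoff_integral t b" by blast
  then show ?thesis using b by blast
qed

text \<open>A representative h in H, tested with the cut-off derivative z, would give I = <h,z> with
  I = ||z||^2 in H. Cauchy-Schwarz then yields I <= ||h||^2 for every cutoff, although the integrals
  I are unbounded.\<close>

lemma cos_not_in_range_emb_dual:
  assumes "0 \<le> t"
  shows "riesz (amp_mult (\<lambda>x. cos (t * phi x))) \<notin> range (emb_dual V_to_H)"
proof
  assume "riesz (amp_mult (\<lambda>x. cos (t * phi x))) \<in> range (emb_dual V_to_H)"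
  then obtain h where h: "riesz (amp_mult (\<lambda>x. cos (t * phi x))) = emb_dual V_to_H h" by blast
  obtain b where b: "0 < b" "(norm h)\<^sup>2 < cutoff_integral t b"
    using cutoff_integral_unbounded[OF assms] by blast
  define z where "z = amp_mult (cutoff_profile t b)"
  let ?I = "cutoff_integral t b"
  have I: "0 < ?I" using b(2) by (rule order.strict_trans1[OF zero_le_power2])
  have hz: "cinner h (V_to_H z) = of_real ?I"
    using cinner_cos_cutoff(1)[OF b(1), of t] arg_cong[OF h, of "\<lambda>f. blinfun_apply f z"]
    by (simp add: z_def)
  have "cinner (V_to_H z) (V_to_H z) = of_real ?I"
    using cinner_cos_cutoff(2)[OF b(1), of t]
      arg_cong[OF emb_dual_V_to_H_amp_mult[OF profile_cutoff[OF b(1)], of t], of "\<lambda>f. blinfun_apply f z"]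
    by (simp add: z_def)
  then have nz: "(norm (V_to_H z))\<^sup>2 = ?I" unfolding cinner_self of_real_eq_iff .
  have "?I \<le> norm h * norm (V_to_H z)"
    using cmod_cinner_le[of h "V_to_H z"] I by (simp add: hz)
  then have "?I\<^sup>2 \<le> (norm h * norm (V_to_H z))\<^sup>2" using I by (intro power_mono) auto
  then have "?I * ?I \<le> (norm h)\<^sup>2 * ?I" unfolding power_mult_distrib nz by (simp add: power2_eq_square)
  then have "?I \<le> (norm h)\<^sup>2" using I by simp
  then show False using b(2) by simp
qed

section \<open>The modulus of continuity\<close>

text \<open>The squared V-norm obtained when each difference of sines or cosines is replaced by its
  elementary bound, the minimum of 2 and the phase shift. It no longer depends on the base point
  t.\<close>

definition modulus :: "real \<Rightarrow> real" where
  "modulus \<delta> = (\<integral>x. sqrt (amp x) * (min 2 (\<delta> * phi x))\<^sup>2 \<partial>flat)"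

text \<open>Where the phase shift is of order one. It is bounded below so that the shift is felt,
  and above by 3/2 < pi/2 so that its cosine stays nonnegative.\<close>

definition resonant :: "real \<Rightarrow> real set" where
  "resonant \<delta> = {x. 1 \<le> \<delta> * phi x \<and> \<delta> * phi x \<le> 3/2}"

definition resonant_mass :: "real \<Rightarrow> real" where
  "resonant_mass \<delta> = (\<integral>x. sqrt (amp x) * indicator (resonant \<delta>) x \<partial>flat)"

lemma sets_resonant [measurable]: "resonant \<delta> \<in> sets borel"
  unfolding resonant_def by measurable

lemma profile_resonant: "profile (indicator (resonant \<delta>))"
  unfolding profile_def
  by (intro conjI exI[of _ 1] ballI borel_measurable_indicator sets_resonant) (simp add: indicator_def)

lemma amp_mono:
  assumes "0 \<le> x" "x \<le> y" "y \<le> exp (-2)" shows "amp x \<le> amp y"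
proof (cases "x = 0")
  case False
  show ?thesis
  proof (rule DERIV_nonneg_imp_nondecreasing[OF assms(2)])
    fix z assume z: "x \<le> z" "z \<le> y"
    then have "0 < z" "z \<le> exp (-2)" using assms False by auto
    moreover have "z < 1" using calculation exp_minus_2_bounds by linarith
    ultimately show "\<exists>d. (amp has_field_derivative d) (at z) \<and> 0 \<le> d"
      using ln_le_minus_2[of z] by (intro exI[of _ "- ln z - 1"] conjI DERIV_amp) auto
  qed
qed (use assms amp_nonneg[of y] in \<open>simp add: amp_def\<close>)

lemma resonance_point:
  assumes "0 < \<delta>" "\<delta> \<le> 1/4" "\<delta> \<le> amp32 (exp (-2))"
  obtains X where "0 < X" "X \<le> exp (-2)" "amp32 X = \<delta>"
proof -
  let ?N = "\<lambda>x. amp32 x"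
  \<comment> \<open>Left end for the intermediate value theorem: ln(2/\<delta>) <= 2/\<delta> gives
    \<open>amp ?y\<close> at most \<delta>, and the remaining factor \<open>sqrt (amp ?y)\<close> is
    at most 1.\<close>
  let ?y = "\<delta>\<^sup>2 / 4"
  have "\<delta>\<^sup>2 \<le> (1/4)\<^sup>2" using assms by (intro power_mono) auto
  then have y: "0 < ?y" "?y \<le> exp (-2)" "?y < 1"
    using exp_minus_2_bounds assms by (auto simp: power2_eq_square)
  have "?y = (\<delta> / 2)\<^sup>2" by (simp add: power2_eq_square)
  then have "ln ?y = 2 * ln (\<delta> / 2)" using assms by (simp only: ln_realpow)
  then have "- ln ?y = 2 * ln (2 / \<delta>)" using assms by (simp add: ln_div)
  also have "ln (2 / \<delta>) \<le> 2 / \<delta>" using ln_le_minus_one[of "2 / \<delta>"] assms by simp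
  finally have "amp ?y \<le> ?y * (4 / \<delta>)"
    unfolding amp_def using y by (intro mult_left_mono) auto
  also have "?y * (4 / \<delta>) = \<delta>" using assms by (simp add: power2_eq_square)
  finally have "amp ?y \<le> \<delta>" .
  moreover have "sqrt (amp ?y) \<le> 1" using amp_le_1[of ?y] y by simp
  ultimately have "?N ?y \<le> \<delta> * 1" using amp_nonneg[of ?y] y by (intro mult_mono) auto
  moreover have "continuous_on {?y..exp (-2)} ?N"
  proof (rule continuous_at_imp_continuous_on, rule ballI)
    fix x assume "x \<in> {?y..exp (-2)}"
    then have "?y \<le> x" "x \<le> exp (-2)" by auto
    then have "0 < x" "x < 1" using y(1) exp_minus_2_bounds by linarith+
    from DERIV_isCont[OF DERIV_amp_sqrt_amp[OF this]] show "isCont ?N x" .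
  qed
  ultimately obtain X where "?y \<le> X" "X \<le> exp (-2)" "?N X = \<delta>"
    using IVT'[of ?N ?y \<delta> "exp (-2)"] assms y by auto
  moreover from this have "0 < X" using y(1) by linarith
  ultimately show ?thesis using that by blast
qed

section \<open>Asymptotics at the point X where the phase shift equals 1\<close>

context
  fixes \<delta> X L r :: real
  assumes X: "0 < X" "X \<le> exp (-2)" and \<delta>: "amp32 X = \<delta>"
    and L_def: "L = - ln X" and r_def: "r = sqrt (amp X)"
begin

text \<open>The order of the modulus is visible in r * X = \<delta> / L: density times length at the
  resonance point. It follows from X L = r^2 and r^3 = \<delta>.\<close>

lemma resonance_point_simps:
  shows "2 \<le> L" "0 < r" "r \<le> 1" "amp X = r * r" "X * L = r * r" "r * r * r = \<delta>" "r * X = \<delta> / L" "X < 1" "0 < \<delta>"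
proof -
  show L: "2 \<le> L" using ln_le_minus_2[OF X] by (simp add: L_def)
  show X1: "X < 1" using X exp_minus_2_bounds by linarith
  have "0 < amp X" "amp X \<le> 1" using amp_pos[of X] amp_le_1[of X] X X1 by auto
  then show r: "0 < r" "r \<le> 1" "amp X = r * r" by (auto simp: r_def)
  show XL: "X * L = r * r" using r(3) X1 X by (simp add: amp_def L_def)
  show d: "r * r * r = \<delta>" using \<delta> unfolding r_def[symmetric] unfolding r(3) .
  then show "0 < \<delta>" using r(1) by auto
  have "r * X * L = r * (r * r)" unfolding XL[symmetric] by simp
  then show "r * X = \<delta> / L" using L unfolding d[symmetric] by (simp add: eq_divide_eq)
qed

text \<open>Taking logarithms of r^3 = \<delta> and r^2 = X L gives -ln \<delta> = 3/2 (L - ln L),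
  and ln L lies between 0 and L/2. This converts bounds stated through X into bounds in
  \<delta>.\<close>

lemma resonance_point_ln: "3/4 * L \<le> - ln \<delta>" "- ln \<delta> \<le> 3/2 * L"
proof -
  have [simp]: "r \<noteq> 0" using resonance_point_simps(2) by auto
  note [simp] = resonance_point_simps(2,9)
  have "ln \<delta> = 3 * ln r"
    using ln_mult[of "r * r" r] ln_mult[of r r] by (simp flip: resonance_point_simps(6))
  moreover have "2 * ln r = ln X + ln L"
    using ln_mult[of r r] ln_mult[of X L] X resonance_point_simps(1) by (simp add: resonance_point_simps(5))
  ultimately have eq: "- ln \<delta> = 3/2 * (L - ln L)" by (simp add: L_def)
  have "0 \<le> ln L" using resonance_point_simps(1) by simp
  then show "- ln \<delta> \<le> 3/2 * L" unfolding eq by simp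
  have "ln (L / 2) \<le> L / 2 - 1" using resonance_point_simps(1) by (intro ln_le_minus_one) simp
  moreover have "ln 2 \<le> (1::real)" using ln_le_minus_one[of 2] by simp
  ultimately have "ln L \<le> L / 2" using resonance_point_simps(1) by (simp add: ln_div)
  then show "3/4 * L \<le> - ln \<delta>" unfolding eq by simp
qed

text \<open>The interval [7X/8, X] is resonant: there \<open>amp\<close> is at least 7/8 r^2 and its
  root at least 9/10 r, so the phase shift lies between 1 and 80/63 < 3/2. Its length X/8 times the
  lower bound r/2 of the integrand is the claimed mass.\<close>

lemma resonant_mass_ge: "\<delta> / L / 16 \<le> resonant_mass \<delta>"
proof -
  note s = resonance_point_simps
  let ?f = "\<lambda>x. sqrt (amp x) * indicator (resonant \<delta>) x"
  let ?Y = "7/8 * X"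
  have Y: "0 < ?Y" "?Y \<le> X" using X by auto
  have f: "?f integrable_on {0..1/2}" "resonant_mass \<delta> = integral {0..1/2} ?f"
    using integrable_sqrt_amp_mult[OF profile_resonant] unfolding resonant_mass_def
    by (auto intro: integrable_on_lebesgue_on lebesgue_integral_eq_integral)
  have f2: "?f integrable_on {?Y..X}"
    using f(1) by (rule integrable_on_subinterval) (use X Y exp_minus_2_bounds in auto)
  have pt: "r / 2 \<le> ?f x" if x: "x \<in> {?Y..X}" for x
  proof -
    have x0: "0 < x" "x \<le> X" "x < 1" using x Y s(8) by auto
    have "L \<le> - ln x" using x0 X by (simp add: L_def ln_mono)
    then have "?Y * L \<le> x * (- ln x)" using x Y s(1) by (intro mult_mono) auto
    then have lo: "7/8 * (r * r) \<le> amp x" using x0 s(5) by (simp add: amp_def)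
    have up: "amp x \<le> r * r" using amp_mono[of x X] x0 X s(4) by simp
    have q: "9/10 * r \<le> sqrt (amp x)"
    proof (rule real_le_rsqrt)
      have "(9/10 * r)\<^sup>2 = 81/100 * (r * r)" by (simp add: power2_eq_square)
      also have "\<dots> \<le> 7/8 * (r * r)" using s(2) by (intro mult_right_mono) auto
      finally show "(9/10 * r)\<^sup>2 \<le> amp x" using lo by simp
    qed
    have q2: "sqrt (amp x) \<le> r" using up s(2) by (intro real_le_lsqrt) (auto simp: power2_eq_square)
    have "7/8 * (r * r) * (9/10 * r) \<le> amp32 x"
      using lo q s(2) amp_nonneg[of x] x0 by (intro mult_mono) auto
    moreover have "amp32 x \<le> (r * r) * r"
      using up q2 s(2) amp_pos[of x] x0 by (intro mult_mono) auto
    moreover have "0 < amp32 x" using amp_pos[of x] x0 by simp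
    moreover have "\<delta> * phi x = \<delta> / amp32 x" using x0 by (simp add: phi_def wgt_eq)
    moreover have bnd: "1 \<le> e / N \<and> e / N \<le> 3/2" if "7/8 * (r * r) * (9/10 * r) \<le> N" "N \<le> r * r * r" "0 < N" "r * r * r = e"
      for N e :: real using that by (simp add: field_simps)
    ultimately have "1 \<le> \<delta> * phi x \<and> \<delta> * phi x \<le> 3/2"
      using bnd[of "amp32 x" \<delta>] s(6) by presburger
    then have "x \<in> resonant \<delta>" by (simp add: resonant_def)
    then show ?thesis using q s(2) by simp
  qed
  have "\<delta> / L / 16 = (X - ?Y) * (r / 2)" unfolding s(7)[symmetric] by simp
  also have "\<dots> = integral {?Y..X} (\<lambda>_. r / 2)" using Y by simp
  also have "\<dots> \<le> integral {?Y..X} ?f" by (rule integral_le[OF _ f2]) (use pt in auto)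
  also have "\<dots> \<le> integral {0..1/2} ?f"
    using Y X exp_minus_2_bounds f(1) f2 amp_nonneg by (intro integral_subset_le) auto
  finally show ?thesis using f(2) by simp
qed

text \<open>The left side of the inequality is \<open>amp\<close> to the power -5/2. The derivative
  of the stated function is that power times 3/2 - 5/(2 l) with l = -ln x >= 2, a factor of at least
  1/4; hence the 4.\<close>

lemma DERIV_reciprocal_envelope:
  assumes "0 < x" "x \<le> exp (-2)"
  shows "\<exists>D. ((\<lambda>x. - 1 / (amp32 x * (- ln x))) has_field_derivative D) (at x) \<and>
    sqrt (amp x) * (phi x)\<^sup>2 \<le> 4 * D"
proof -
  have x1: "x < 1" using assms exp_minus_2_bounds by linarith
  have l: "2 \<le> - ln x" using ln_le_minus_2[OF assms] by simp
  define l where "l = - ln x"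
  define s where "s = sqrt (amp x)"
  have s: "0 < s" "amp x = s * s" using amp_pos[of x] assms x1 by (auto simp: s_def)
  have xl: "x * l = s * s" using x1 assms s(2) by (simp add: amp_def l_def)
  have l2: "2 \<le> l" using l by (simp add: l_def)
  have dl: "((\<lambda>x. - ln x) has_field_derivative - (1 / x)) (at x)"
    using assms by (auto intro!: derivative_eq_intros)
  define D where "D = (3/2 - 5/2 / l) / (s * s * s * s * s)"
  have "((\<lambda>x. amp32 x * (- ln x)) has_field_derivative
      (3/2 * s * (l - 1)) * l + - (1 / x) * (s * s * s)) (at x)"
    using DERIV_mult[OF DERIV_amp_sqrt_amp[OF assms(1) x1] dl]
    unfolding s_def[symmetric] l_def[symmetric] unfolding s(2) .
  from DERIV_divide[OF DERIV_const[of "-1"] this]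
  have "((\<lambda>x. - 1 / (amp32 x * (- ln x))) has_field_derivative
      (0 * (s * s * s * l) - - 1 * ((3/2 * s * (l - 1)) * l + - (1 / x) * (s * s * s))) / ((s * s * s * l) * (s * s * s * l))) (at x)"
    unfolding s_def[symmetric] l_def[symmetric] unfolding s(2) using s(1) l2 by simp
  moreover have "(0 * (s * s * s * l) - - 1 * ((3/2 * s * (l - 1)) * l + - (1 / x) * (s * s * s))) / ((s * s * s * l) * (s * s * s * l)) = D"
  proof -
    have "1 / x = l / (s * s)" using xl s(1) assms(1) l2 by (simp add: field_simps)
    then show ?thesis unfolding D_def using s(1) l2
      by (simp only:) (simp add: divide_simps, simp add: algebra_simps)
  qed
  moreover have "sqrt (amp x) * (phi x)\<^sup>2 \<le> 4 * D"
  proof -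
    have "phi x = 1 / (s * s * s)"
      using wgt_eq[of x] assms s(1) by (simp add: phi_def s(2))
    then have "sqrt (amp x) * (phi x)\<^sup>2 = 1 / (s * s * s * s * s)"
      using s(1) by (simp add: power2_eq_square flip: s_def)
    also have "\<dots> \<le> (4 * (3/2 - 5/2 / l)) / (s * s * s * s * s)"
      using s(1) l2 by (intro divide_right_mono) (auto simp: field_simps)
    finally show ?thesis by (simp add: D_def)
  qed
  ultimately show ?thesis by metis
qed

text \<open>On [0, X] the minimum is at most 2, which gives 4 r X. On [X, exp(-2)] it is at most the
  phase shift, and the antiderivative above gives 4 \<delta>/L from its value at X. On the rest the
  integrand is of order \<delta>^2.\<close>

lemma modulus_le: "modulus \<delta> \<le> 8 * (\<delta> / L) + 32768 * \<delta>\<^sup>2"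
proof -
  note s = resonance_point_simps
  let ?c = "exp (-2) :: real"
  let ?f = "\<lambda>x. sqrt (amp x) * (min 2 (\<delta> * phi x))\<^sup>2"
  let ?G = "\<lambda>x. - 1 / (amp32 x * (- ln x))"
  have c: "X \<le> ?c" "?c \<le> 1/2" using X exp_minus_2_bounds by auto
  have f: "?f integrable_on {0..1/2}" "modulus \<delta> = integral {0..1/2} ?f"
    using integrable_sqrt_amp_mult[OF profile_power2[OF profile_min[of \<delta>]]] s(9)
    unfolding modulus_def
    by (auto intro: integrable_on_lebesgue_on lebesgue_integral_eq_integral)
  have sub: "?f integrable_on {a..b}" if "0 \<le> a" "b \<le> 1/2" for a b
    using f(1) by (rule integrable_on_subinterval) (use that in auto)
  have mn: "0 \<le> min 2 (\<delta> * phi x)" for x using s(9) by (simp add: phi_def)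
  have f_le: "?f x \<le> \<delta>\<^sup>2 * (sqrt (amp x) * (phi x)\<^sup>2)" if "0 \<le> x" for x
  proof -
    have "(min 2 (\<delta> * phi x))\<^sup>2 \<le> (\<delta> * phi x)\<^sup>2" by (intro power_mono mn) simp
    from mult_left_mono[OF this, of "sqrt (amp x)"] show ?thesis
      using amp_nonneg[OF that] by (simp add: power_mult_distrib ac_simps)
  qed
  have "integral {0..X} ?f \<le> integral {0..X} (\<lambda>_. 4 * r)"
  proof (rule integral_le[OF sub])
    fix x assume x: "x \<in> {0..X}"
    then have "amp x \<le> r * r" using amp_mono[of x X] X s(4) by simp
    then have "sqrt (amp x) \<le> r" using s(2) by (intro real_le_lsqrt) (auto simp: power2_eq_square)
    moreover have "(min 2 (\<delta> * phi x))\<^sup>2 \<le> 2\<^sup>2" by (intro power_mono mn) simp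
    ultimately have "?f x \<le> r * 2\<^sup>2" using s(2) by (intro mult_mono) auto
    then show "?f x \<le> 4 * r" by simp
  qed (use X c in auto)
  then have 1: "integral {0..X} ?f \<le> 4 * (\<delta> / L)"
    unfolding s(7)[symmetric] using X by (simp add: ac_simps)
  have "\<forall>x\<in>{X..?c}. \<exists>D. (?G has_field_derivative D) (at x) \<and> sqrt (amp x) * (phi x)\<^sup>2 \<le> 4 * D"
    by (intro ballI DERIV_reciprocal_envelope) (use X(1) in auto)
  from bchoice[OF this] obtain D where D: "\<And>x. x \<in> {X..?c} \<Longrightarrow> (?G has_field_derivative D x) (at x)"
      "\<And>x. x \<in> {X..?c} \<Longrightarrow> sqrt (amp x) * (phi x)\<^sup>2 \<le> 4 * D x"
    by blast
  have FTC: "(D has_integral (?G ?c - ?G X)) {X..?c}"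
  proof (rule fundamental_theorem_of_calculus[OF c(1)])
    fix x assume "x \<in> {X..?c}"
    then show "(?G has_vector_derivative D x) (at x within {X..?c})"
      using D(1)[of x] by (simp add: has_real_derivative_iff_has_vector_derivative[symmetric] has_field_derivative_at_within)
  qed
  have "integral {X..?c} ?f \<le> integral {X..?c} (\<lambda>x. \<delta>\<^sup>2 * 4 * D x)"
  proof (rule integral_le[OF sub])
    show "(\<lambda>x. \<delta>\<^sup>2 * 4 * D x) integrable_on {X..?c}"
      using FTC by (intro integrable_on_mult_right) auto
    fix x assume x: "x \<in> {X..?c}"
    have "\<delta>\<^sup>2 * (sqrt (amp x) * (phi x)\<^sup>2) \<le> \<delta>\<^sup>2 * (4 * D x)"
      using D(2)[OF x] by (intro mult_left_mono) auto
    then show "?f x \<le> \<delta>\<^sup>2 * 4 * D x" using f_le[of x] x X by simp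
  qed (use X c in auto)
  also have "\<dots> = \<delta>\<^sup>2 * 4 * (?G ?c - ?G X)" using FTC by (simp add: integral_unique)
  also have "\<dots> \<le> \<delta>\<^sup>2 * 4 * (1 / (\<delta> * L))"
  proof (rule mult_left_mono)
    have "?G ?c \<le> 0" using amp_nonneg[of ?c] by simp
    moreover have "?G X = - (1 / (\<delta> * L))" unfolding \<delta> by (simp add: L_def)
    ultimately show "?G ?c - ?G X \<le> 1 / (\<delta> * L)" by linarith
  qed simp
  also have "\<dots> = 4 * (\<delta> / L)" using s(9) by (simp add: power2_eq_square)
  finally have 2: "integral {X..?c} ?f \<le> 4 * (\<delta> / L)" .
  \<comment> \<open>Away from 0 the envelope is at least 1/16 times 1/2, so its power -5/2 is at
    most 32^3 = 32768; the half power is estimated by a whole one because the envelope is at most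
    1.\<close>
  have "integral {?c..1/2} ?f \<le> integral {?c..1/2} (\<lambda>_. \<delta>\<^sup>2 * 32768)"
  proof (rule integral_le[OF sub])
    fix x assume x: "x \<in> {?c..1/2}"
    then have x0: "0 < x" using X(1) c(1) by simp
    have "1/2 \<le> ln (2::real)" using ln_le_minus_one[of "1/2"] by (simp add: ln_div)
    then have "1/16 * (1/2) \<le> ?c * ln 2" using exp_minus_2_bounds by (intro mult_mono) auto
    also have "\<dots> \<le> amp x" by (rule amp_ge_on_interval) (use x in auto)
    finally have a: "1/32 \<le> amp x" by simp
    have a1: "amp x \<le> 1" using x x0 by (intro amp_le_1) auto
    have sa: "amp x \<le> sqrt (amp x)" using a a1 by (intro real_le_rsqrt) (simp add: power2_eq_square mult_le_cancel_left1)
    have "phi x = 1 / amp32 x" using x0 by (simp add: phi_def wgt_eq)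
    then have "sqrt (amp x) * (phi x)\<^sup>2 = 1 / (amp x * amp x * sqrt (amp x))"
    proof -
      have "s * (1 / (s * s * s))\<^sup>2 = 1 / (s * s * (s * s) * s)" if "0 < s" for s :: real
        using that by (simp add: power2_eq_square field_simps)
      from this[of "sqrt (amp x)"] show ?thesis
        using a \<open>phi x = _\<close> by simp
    qed
    also have "\<dots> \<le> 1 / (1/32 * (1/32) * (1/32))"
      using a sa by (intro frac_le mult_mono) auto
    finally have "\<delta>\<^sup>2 * (sqrt (amp x) * (phi x)\<^sup>2) \<le> \<delta>\<^sup>2 * 32768" by (intro mult_left_mono) auto
    then show "?f x \<le> \<delta>\<^sup>2 * 32768" using f_le[of x] x0 by simp
  qed (use c in auto)
  also have "\<dots> = (1/2 - ?c) * (\<delta>\<^sup>2 * 32768)" using c by simp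
  also have "\<dots> \<le> 1 * (\<delta>\<^sup>2 * 32768)" by (intro mult_right_mono) (use exp_gt_zero[of "-2::real"] in linarith, simp)
  finally have 3: "integral {?c..1/2} ?f \<le> \<delta>\<^sup>2 * 32768" by simp
  have "integral {0..1/2} ?f = integral {0..X} ?f + (integral {X..?c} ?f + integral {?c..1/2} ?f)"
    using X c f(1) sub[of X "1/2"] by (simp add: Henstock_Kurzweil_Integration.integral_combine)
  then show ?thesis unfolding f(2) using 1 2 3 by linarith
qed

end

lemma modulus_bounds:
  "\<exists>\<delta>0>0. \<exists>C>0. \<exists>c>0. \<delta>0 \<le> 1/4 \<and> (\<forall>\<delta>\<in>{0<..\<delta>0}. modulus \<delta> \<le> C * (\<delta> / (- ln \<delta>)) \<and>
     c * (\<delta> / (- ln \<delta>)) \<le> resonant_mass \<delta>)"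
proof -
  define d where "d = min (1/4) (amp32 (exp (-2)))"
  have "0 < amp (exp (-2))" by (intro amp_pos) auto
  then have d: "0 < d" "d \<le> 1/4" by (auto simp: d_def)
  \<comment> \<open>The upper constant has to cover 8 * 3/2 + 32768, as \<delta>^2 <= \<delta>/(-ln
    \<delta>); the lower one is 3/4 divided by 16.\<close>
  have *: "modulus \<delta> \<le> 40000 * (\<delta> / (- ln \<delta>)) \<and> 3/64 * (\<delta> / (- ln \<delta>)) \<le> resonant_mass \<delta>"
    if \<delta>: "0 < \<delta>" "\<delta> \<le> d" for \<delta>
  proof -
    obtain X where X: "0 < X" "X \<le> exp (-2)" "amp32 X = \<delta>"
      by (rule resonance_point[of \<delta>]) (use \<delta> in \<open>auto simp: d_def\<close>)
    define L where "L = - ln X"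
    define l where "l = - ln \<delta>"
    have L: "2 \<le> L" "3/4 * L \<le> l" "l \<le> 3/2 * L"
      using resonance_point_simps(1)[OF X L_def refl] resonance_point_ln[OF X L_def refl]
      by (auto simp: l_def)
    have l: "0 < l" using L by linarith
    have "\<delta> * l \<le> 1" using amp_le_1[of \<delta>] \<delta> d by (simp add: amp_def l_def)
    then have "\<delta> * (\<delta> * l) \<le> \<delta> * 1" using \<delta> by (intro mult_left_mono) auto
    then have "\<delta>\<^sup>2 \<le> \<delta> / l" using l by (simp add: power2_eq_square field_simps)
    moreover have "\<delta> / L \<le> 3/2 * (\<delta> / l)"
      using L l \<delta> by (simp add: field_simps)
    moreover have "modulus \<delta> \<le> 8 * (\<delta> / L) + 32768 * \<delta>\<^sup>2" by (rule modulus_le[OF X L_def refl])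
    moreover have "0 < \<delta> / l" using \<delta> l by simp
    ultimately have m: "modulus \<delta> \<le> 40000 * (\<delta> / l)" by linarith
    have "3/4 * (\<delta> / l) \<le> \<delta> / L" using L l \<delta> by (simp add: field_simps)
    moreover have "3/64 * a \<le> m" if "3/4 * a \<le> b" "b / 16 \<le> m" for a b m :: real
      using that by argo
    ultimately have "3/64 * (\<delta> / l) \<le> resonant_mass \<delta>"
      using resonant_mass_ge[OF X L_def refl] by blast
    with m show ?thesis by (simp add: l_def)
  qed
  show ?thesis by (rule exI[of _ d], intro conjI d(1), rule exI[of _ 40000], intro conjI, simp,
      rule exI[of _ "3/64"]) (use d(2) * in auto)
qed

section \<open>The path and its derivative\<close>

definition dual_path :: "real \<Rightarrow> real \<Rightarrow> V_space" where
  "dual_path d t = amp_mult (\<lambda>x. (sin (t * phi x) + d) / wgt x)"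

definition velocity :: "real \<Rightarrow> V_space" where
  "velocity t = amp_mult (\<lambda>x. cos (t * phi x))"

lemma u_ex_eq: "u_ex d t = amp_mult (\<lambda>x. sin (t * phi x) + d)"
  by (simp add: u_ex_def amp_mult_def u_fun_def[abs_def])

lemma profile_sin_add [simp]: "profile (\<lambda>x. sin (t * phi x) + d)"
  by (intro profile_add) simp_all

lemma profile_sin_add_div_wgt [simp]: "profile (\<lambda>x. (sin (t * phi x) + d) / wgt x)"
  by (intro profile_div_wgt) simp

lemma emb_dual_u_ex: "emb_dual V_to_H (V_to_H (u_ex d t)) = riesz (dual_path d t)"
  unfolding u_ex_eq dual_path_def by (rule emb_dual_V_to_H_amp_mult) simp

lemma integral_sqrt_amp_mono:
  assumes "profile p" "profile q" "\<And>x. 0 < x \<Longrightarrow> x < 1 \<Longrightarrow> p x \<le> q x"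
  shows "(\<integral>x. sqrt (amp x) * p x \<partial>flat) \<le> (\<integral>x. sqrt (amp x) * q x \<partial>flat)"
proof (rule integral_mono_AE)
  show "AE x in flat. sqrt (amp x) * p x \<le> sqrt (amp x) * q x"
    using AE_flat
    by eventually_elim (use assms(3) amp_pos in \<open>auto intro!: mult_left_mono less_imp_le\<close>)
qed (use assms in \<open>auto intro: integrable_sqrt_amp_mult\<close>)

lemma norm_amp_mult_le:
  assumes "profile p" "profile q" "\<And>x. 0 < x \<Longrightarrow> x < 1 \<Longrightarrow> \<bar>p x\<bar> \<le> q x"
  shows "(norm (amp_mult p))\<^sup>2 \<le> (\<integral>x. sqrt (amp x) * (q x)\<^sup>2 \<partial>flat)"
  unfolding norm_amp_mult_power2[OF assms(1)]
proof (rule integral_sqrt_amp_mono)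
  show "(p x)\<^sup>2 \<le> (q x)\<^sup>2" if "0 < x" "x < 1" for x
    using assms(3)[OF that] by (metis abs_ge_zero power2_abs power_mono)
qed (intro profile_power2 assms)+

lemma abs_sin_diff_le: "\<bar>sin a - sin b\<bar> \<le> min 2 \<bar>a - b\<bar>" for a b :: real
proof -
  have "\<bar>sin a - sin b\<bar> \<le> 2" using abs_sin_le_one[of a] abs_sin_le_one[of b] by linarith
  moreover have "sin a - sin b = 2 * sin ((a - b) / 2) * cos ((a + b) / 2)"
    by (rule sin_diff_sin)
  then have "\<bar>sin a - sin b\<bar> = 2 * \<bar>sin ((a - b) / 2)\<bar> * \<bar>cos ((a + b) / 2)\<bar>" by (simp add: abs_mult)
  moreover have "2 * \<bar>sin ((a - b) / 2)\<bar> * \<bar>cos ((a + b) / 2)\<bar> \<le> 2 * \<bar>(a - b) / 2\<bar> * 1"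
    by (intro mult_mono abs_sin_x_le_abs_x) auto
  ultimately show ?thesis by simp
qed

lemma abs_cos_diff_le: "\<bar>cos a - cos b\<bar> \<le> min 2 \<bar>a - b\<bar>" for a b :: real
  using abs_sin_diff_le[of "pi/2 - a" "pi/2 - b"] by (simp add: sin_diff abs_minus_commute)

lemma phi_nonneg [simp]: "0 \<le> phi x" by (simp add: phi_def)

lemma abs_trig_diff_le:
  "\<bar>sin (t * phi x) - sin (s * phi x)\<bar> \<le> min 2 (\<bar>t - s\<bar> * phi x)"
  "\<bar>cos (t * phi x) - cos (s * phi x)\<bar> \<le> min 2 (\<bar>t - s\<bar> * phi x)"
  using abs_sin_diff_le[of "t * phi x" "s * phi x"] abs_cos_diff_le[of "t * phi x" "s * phi x"]
  by (simp_all add: left_diff_distrib[symmetric] abs_mult)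

abbreviation osc :: "real \<Rightarrow> real \<Rightarrow> real" where "osc t s \<equiv> sqrt (modulus \<bar>t - s\<bar>)"

lemma norm_u_ex_diff: "(norm (u_ex d t - u_ex d s))\<^sup>2 \<le> modulus \<bar>t - s\<bar>"
proof -
  have "u_ex d t - u_ex d s = amp_mult (\<lambda>x. (sin (t * phi x) + d) - (sin (s * phi x) + d))"
    unfolding u_ex_eq by (rule amp_mult_diff[symmetric]) simp_all
  also have "(norm \<dots>)\<^sup>2 \<le> modulus \<bar>t - s\<bar>"
    unfolding modulus_def
  proof (rule norm_amp_mult_le)
    show "\<bar>(sin (t * phi x) + d) - (sin (s * phi x) + d)\<bar> \<le> min 2 (\<bar>t - s\<bar> * phi x)" for x
      using abs_trig_diff_le(1)[of t x s] by simp
  qed (intro profile_diff profile_min; simp)+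
  finally show ?thesis .
qed

lemma norm_velocity_diff: "(norm (velocity t - velocity s))\<^sup>2 \<le> modulus \<bar>t - s\<bar>"
proof -
  have "velocity t - velocity s = amp_mult (\<lambda>x. cos (t * phi x) - cos (s * phi x))"
    unfolding velocity_def by (rule amp_mult_diff[symmetric]) simp_all
  also have "(norm \<dots>)\<^sup>2 \<le> modulus \<bar>t - s\<bar>"
    unfolding modulus_def
  proof (rule norm_amp_mult_le)
    show "\<bar>cos (t * phi x) - cos (s * phi x)\<bar> \<le> min 2 (\<bar>t - s\<bar> * phi x)" for x
      using abs_trig_diff_le(2)[of t x s] by simp
  qed (intro profile_diff profile_min; simp)+
  finally show ?thesis .
qed

lemma norm_dual_path_diff: "(norm (dual_path d t - dual_path d s))\<^sup>2 \<le> modulus \<bar>t - s\<bar>"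
proof -
  have "dual_path d t - dual_path d s =
      amp_mult (\<lambda>x. (sin (t * phi x) + d) / wgt x - (sin (s * phi x) + d) / wgt x)"
    unfolding dual_path_def by (rule amp_mult_diff[symmetric]) simp_all
  also have "(norm \<dots>)\<^sup>2 \<le> modulus \<bar>t - s\<bar>"
    unfolding modulus_def
  proof (rule norm_amp_mult_le)
    fix x :: real assume x: "0 < x" "x < 1"
    have "\<bar>(sin (t * phi x) + d) / wgt x - (sin (s * phi x) + d) / wgt x\<bar> =
        \<bar>sin (t * phi x) - sin (s * phi x)\<bar> / wgt x"
      using wgt_pos[OF x] by (simp flip: diff_divide_distrib)
    also have "\<dots> \<le> \<bar>sin (t * phi x) - sin (s * phi x)\<bar> / 1"
      using wgt_ge_1[OF x] by (intro divide_left_mono) auto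
    also have "\<dots> \<le> min 2 (\<bar>t - s\<bar> * phi x)" using abs_trig_diff_le(1) by simp
    finally show "\<bar>(sin (t * phi x) + d) / wgt x - (sin (s * phi x) + d) / wgt x\<bar> \<le> min 2 (\<bar>t - s\<bar> * phi x)" .
  qed (intro profile_diff profile_min; simp)+
  finally show ?thesis .
qed

lemma sin_taylor_bound: "\<bar>sin b - sin a - (b - a) * cos a\<bar> \<le> \<bar>b - a\<bar> * min 2 \<bar>b - a\<bar>" for a b :: real
proof -
  have "\<exists>z. \<bar>z - a\<bar> \<le> \<bar>b - a\<bar> \<and> sin b - sin a = (b - a) * cos z"
  proof (cases a b rule: linorder_cases)
    case less
    from MVT2[OF less DERIV_sin] show ?thesis using less by (metis abs_of_pos diff_gt_0_iff_gt diff_right_mono less_imp_le)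
  next
    case greater
    from MVT2[OF greater DERIV_sin] obtain z where "b < z" "z < a" "sin a - sin b = (a - b) * cos z" by metis
    then show ?thesis by (intro exI[of _ z]) (auto simp: algebra_simps)
  qed simp
  then obtain z where z: "\<bar>z - a\<bar> \<le> \<bar>b - a\<bar>" "sin b - sin a = (b - a) * cos z" by blast
  have "\<bar>sin b - sin a - (b - a) * cos a\<bar> = \<bar>b - a\<bar> * \<bar>cos z - cos a\<bar>"
    unfolding z(2) by (simp flip: abs_mult right_diff_distrib)
  also have "\<dots> \<le> \<bar>b - a\<bar> * min 2 \<bar>b - a\<bar>"
    using abs_cos_diff_le[of z a] z(1) by (intro mult_left_mono) auto
  finally show ?thesis .
qed

text \<open>Dividing the Taylor remainder of the sine by the weight, which equals \<phi>, turns the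
  increment of the phase into s - t. One factor |s - t| comes out, and what remains is the function
  under the modulus. This gives differentiability in V'.\<close>

lemma norm_dual_path_taylor:
  "(norm (dual_path d s - dual_path d t - (s - t) *\<^sub>R velocity t))\<^sup>2 \<le> (s - t)\<^sup>2 * modulus \<bar>s - t\<bar>"
proof -
  let ?q = "\<lambda>x. \<bar>s - t\<bar> * min 2 (\<bar>s - t\<bar> * phi x)"
  have eq: "dual_path d s - dual_path d t - (s - t) *\<^sub>R velocity t =
      amp_mult (\<lambda>x. (sin (s * phi x) + d) / wgt x - (sin (t * phi x) + d) / wgt x - (s - t) * cos (t * phi x))"
    unfolding dual_path_def velocity_def amp_mult_scaleR[OF profile_trig(2), symmetric]
    by (simp add: amp_mult_diff profile_diff profile_mult[OF profile_const])
  have "(norm (dual_path d s - dual_path d t - (s - t) *\<^sub>R velocity t))\<^sup>2 \<le> (\<integral>x. sqrt (amp x) * (?q x)\<^sup>2 \<partial>flat)"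
    unfolding eq
  proof (rule norm_amp_mult_le)
    fix x :: real assume x: "0 < x" "x < 1"
    have w: "0 < phi x" "wgt x = phi x" using wgt_pos[OF x] by (simp_all add: phi_def)
    have "(sin (s * phi x) + d) / wgt x - (sin (t * phi x) + d) / wgt x - (s - t) * cos (t * phi x) =
        (sin (s * phi x) - sin (t * phi x) - (s * phi x - t * phi x) * cos (t * phi x)) / phi x"
      using w by (simp add: field_simps)
    also have "\<bar>\<dots>\<bar> \<le> \<bar>s * phi x - t * phi x\<bar> * min 2 \<bar>s * phi x - t * phi x\<bar> / phi x"
      unfolding abs_divide using sin_taylor_bound[of "s * phi x" "t * phi x"] w
      by (simp add: divide_right_mono)
    also have "\<bar>s * phi x - t * phi x\<bar> = \<bar>s - t\<bar> * phi x"
      using w by (simp add: abs_mult flip: left_diff_distrib)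
    finally show "\<bar>(sin (s * phi x) + d) / wgt x - (sin (t * phi x) + d) / wgt x - (s - t) * cos (t * phi x)\<bar> \<le> ?q x"
      using w by simp
  qed (intro profile_diff profile_mult[OF profile_const] profile_min; simp)+
  also have "\<dots> = (\<integral>x. (s - t)\<^sup>2 * (sqrt (amp x) * (min 2 (\<bar>s - t\<bar> * phi x))\<^sup>2) \<partial>flat)"
    by (rule Bochner_Integration.integral_cong[OF refl]) (simp add: power_mult_distrib)
  also have "\<dots> = (s - t)\<^sup>2 * modulus \<bar>s - t\<bar>"
    unfolding modulus_def by (rule integral_mult_right_zero)
  finally show ?thesis .
qed

lemma measure_flat [simp]: "Sigma_Algebra.measure flat {0..1/2} = 1/2"
  by (simp add: measure_restrict_space)

lemma norm_amp_mult_le_const: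
  assumes p: "profile p" "\<And>x. 0 < x \<Longrightarrow> x < 1 \<Longrightarrow> \<bar>p x\<bar> \<le> B"
  shows "norm (amp_mult p) \<le> B"
proof -
  have "0 \<le> B" using p(2)[of "1/2"] by simp
  have "(norm (amp_mult p))\<^sup>2 \<le> (\<integral>x. sqrt (amp x) * B\<^sup>2 \<partial>flat)"
    by (rule norm_amp_mult_le[OF p(1) profile_const p(2)])
  also have "\<dots> \<le> (\<integral>x. B\<^sup>2 \<partial>flat)"
  proof (rule integral_mono_AE)
    show "AE x in flat. sqrt (amp x) * B\<^sup>2 \<le> B\<^sup>2"
      using AE_flat by eventually_elim (auto intro!: mult_left_le_one_le amp_le_1 amp_nonneg)
  qed (intro integrable_sqrt_amp_mult integrable_profile profile_const)+
  also have "\<dots> \<le> B\<^sup>2" by simp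
  finally show ?thesis using \<open>0 \<le> B\<close> by (rule power2_le_imp_le)
qed

lemma norm_u_ex_le: "norm (u_ex d t) \<le> 1 + \<bar>d\<bar>"
  unfolding u_ex_eq by (rule norm_amp_mult_le_const) (auto intro: order.trans[OF abs_triangle_ineq])

lemma modulus_nonneg: "0 \<le> modulus \<delta>"
  unfolding modulus_def
  by (rule integral_nonneg_AE) (use AE_flat_nonneg in \<open>eventually_elim, simp add: amp_nonneg\<close>)

lemma modulus_le_2:
  assumes "0 \<le> \<delta>" shows "modulus \<delta> \<le> 2"
proof -
  have "modulus \<delta> \<le> (\<integral>x. 4 \<partial>flat)"
    unfolding modulus_def
  proof (rule integral_mono_AE)
    show "AE x in flat. sqrt (amp x) * (min 2 (\<delta> * phi x))\<^sup>2 \<le> 4"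
      using AE_flat
    proof eventually_elim
      case (elim x)
      then have "(min 2 (\<delta> * phi x))\<^sup>2 \<le> 2\<^sup>2" using assms by (intro power_mono) auto
      moreover have "sqrt (amp x) \<le> 1" using elim amp_le_1[of x] by simp
      ultimately have "sqrt (amp x) * (min 2 (\<delta> * phi x))\<^sup>2 \<le> 1 * 2\<^sup>2" by (intro mult_mono) auto
      then show ?case by simp
    qed
  qed (intro integrable_sqrt_amp_mult integrable_profile profile_power2 profile_min
      profile_const assms)+
  then show ?thesis by simp
qed

text \<open>The gain from the logarithm is given up here; a linear bound suffices for continuity and
  differentiability of the paths.\<close>

lemma modulus_le_linear: "\<exists>\<delta>0>0. \<exists>C>0. \<forall>\<delta>\<in>{0<..\<delta>0}. modulus \<delta> \<le> C * \<delta>"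
proof -
  obtain \<delta>0 C :: real where *: "0 < \<delta>0" "\<delta>0 \<le> 1/4" "0 < C"
    "\<forall>\<delta>\<in>{0<..\<delta>0}. modulus \<delta> \<le> C * (\<delta> / (- ln \<delta>))"
    using modulus_bounds by blast
  have "modulus \<delta> \<le> (2 * C) * \<delta>" if \<delta>: "\<delta> \<in> {0<..\<delta>0}" for \<delta>
  proof -
    have "\<delta> < 1" using \<delta> *(2) by auto
    moreover have "1/2 \<le> - ln \<delta>" using ln_le_minus_one[of \<delta>] \<delta> *(2) by auto
    moreover from this have "0 < - ln \<delta> * (1/2)" by linarith
    ultimately have "\<delta> / (- ln \<delta>) \<le> \<delta> / (1/2)" using \<delta> by (intro divide_left_mono) auto
    then have "C * (\<delta> / (- ln \<delta>)) \<le> C * (\<delta> / (1/2))" using * by (intro mult_left_mono) auto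
    then show ?thesis using bspec[OF *(4) \<delta>] by simp
  qed
  then show ?thesis using * by (intro exI[of _ \<delta>0] conjI exI[of _ "2 * C"]) auto
qed

lemma tendsto_sqrt_modulus: "((\<lambda>s. osc s t) \<longlongrightarrow> 0) (at t)"
proof -
  obtain \<delta>0 C where *: "0 < \<delta>0" "0 < C" "\<forall>\<delta>\<in>{0<..\<delta>0}. modulus \<delta> \<le> C * \<delta>"
    using modulus_le_linear by blast
  have "((\<lambda>s. modulus \<bar>s - t\<bar>) \<longlongrightarrow> 0) (at t)"
  proof (rule tendsto_sandwich)
    show "\<forall>\<^sub>F s in at t. 0 \<le> modulus \<bar>s - t\<bar>" by (simp add: modulus_nonneg)
    show "\<forall>\<^sub>F s in at t. modulus \<bar>s - t\<bar> \<le> C * \<bar>s - t\<bar>"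
      unfolding eventually_at using * by (intro exI[of _ \<delta>0]) (auto simp: dist_real_def)
    have "((\<lambda>s. C * \<bar>s - t\<bar>) \<longlongrightarrow> C * \<bar>t - t\<bar>) (at t)" by (intro tendsto_intros)
    then show "((\<lambda>s. C * \<bar>s - t\<bar>) \<longlongrightarrow> 0) (at t)" by simp
  qed simp
  from tendsto_real_sqrt[OF this] show ?thesis by simp
qed

lemma continuous_on_modulusI:
  fixes g :: "real \<Rightarrow> 'b::real_normed_vector"
  assumes "\<And>t s. t \<in> S \<Longrightarrow> s \<in> S \<Longrightarrow> norm (g t - g s) \<le> K * osc t s"
  shows "continuous_on S g"
  unfolding continuous_on_def
proof
  fix t assume t: "t \<in> S"
  have 0: "((\<lambda>s. K * osc s t) \<longlongrightarrow> K * 0) (at t within S)"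
    by (intro tendsto_mult tendsto_const tendsto_within_subset[OF tendsto_sqrt_modulus]) simp
  have "((\<lambda>s. g s - g t) \<longlongrightarrow> 0) (at t within S)"
  proof (rule Lim_null_comparison)
    show "\<forall>\<^sub>F s in at t within S. norm (g s - g t) \<le> K * osc s t"
      using assms t by (auto simp: eventually_at_filter)
  qed (use 0 in simp)
  then show "(g \<longlongrightarrow> g t) (at t within S)" by (rule Lim_null[THEN iffD2])
qed

lemma norm_path_diff_le:
  "norm (u_ex d t - u_ex d s) \<le> osc t s"
  "norm (velocity t - velocity s) \<le> osc t s"
  "norm (dual_path d t - dual_path d s) \<le> osc t s"
  using norm_u_ex_diff norm_velocity_diff norm_dual_path_diff by (auto intro: real_le_rsqrt)

lemma continuous_on_paths:
  "continuous_on S (u_ex d)" "continuous_on S velocity" "continuous_on S (dual_path d)"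
  by (rule continuous_on_modulusI[where K=1]; simp add: norm_path_diff_le)+

lemma has_vector_derivative_dual_path:
  "(dual_path d has_vector_derivative velocity t) (at t within S)"
  unfolding has_vector_derivative_def has_derivative_within
proof (intro conjI bounded_linear_scaleR_left)
  show "((\<lambda>s. (1 / norm (s - t)) *\<^sub>R (dual_path d s - (dual_path d t + (s - t) *\<^sub>R velocity t))) \<longlongrightarrow> 0)
      (at t within S)"
  proof (rule Lim_null_comparison)
    show "\<forall>\<^sub>F s in at t within S. norm ((1 / norm (s - t)) *\<^sub>R (dual_path d s - (dual_path d t + (s - t) *\<^sub>R velocity t)))
        \<le> osc s t"
      unfolding eventually_at_filter
    proof (intro always_eventually allI impI)
      fix s assume "s \<noteq> t"
      let ?r = "dual_path d s - dual_path d t - (s - t) *\<^sub>R velocity t"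
      have "norm ?r \<le> sqrt ((s - t)\<^sup>2 * modulus \<bar>s - t\<bar>)"
        using norm_dual_path_taylor by (rule real_le_rsqrt)
      then have "norm ?r \<le> \<bar>s - t\<bar> * osc s t" by (simp add: real_sqrt_mult)
      then have "norm ?r / \<bar>s - t\<bar> \<le> osc s t"
        using \<open>s \<noteq> t\<close> by (simp add: field_simps)
      then show "norm ((1 / norm (s - t)) *\<^sub>R (dual_path d s - (dual_path d t + (s - t) *\<^sub>R velocity t)))
        \<le> osc s t" by (simp add: diff_diff_eq)
    qed
    show "((\<lambda>s. osc s t) \<longlongrightarrow> 0) (at t within S)"
      by (rule tendsto_within_subset[OF tendsto_sqrt_modulus]) simp
  qed
qed

text \<open>A single difference of sines can vanish at an unlucky phase b. The sum of the forward
  and backward squares is 2 (sin^2 b (1 - cos a)^2 + cos^2 b sin^2 a) for a phase shift a, and for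
  resonant a both coefficients are at least (1 - cos 1)^2, so the phase drops out.\<close>

lemma norm_u_ex_resonance:
  "2 * (1 - cos 1)\<^sup>2 * resonant_mass \<delta> \<le>
    (norm (u_ex d (t + \<delta>) - u_ex d t))\<^sup>2 + (norm (u_ex d (t - \<delta>) - u_ex d t))\<^sup>2"
proof -
  let ?p = "\<lambda>s x. (sin (s * phi x) + d) - (sin (t * phi x) + d)"
  have p: "profile (?p s)" for s by (intro profile_diff) simp_all
  have diff: "(norm (u_ex d s - u_ex d t))\<^sup>2 = (\<integral>x. sqrt (amp x) * (?p s x)\<^sup>2 \<partial>flat)" for s
    unfolding u_ex_eq amp_mult_diff[OF profile_sin_add profile_sin_add, symmetric]
    by (rule norm_amp_mult_power2[OF p])
  have pt: "2 * (1 - cos 1)\<^sup>2 * indicator (resonant \<delta>) x \<le> (?p (t + \<delta>) x)\<^sup>2 + (?p (t - \<delta>) x)\<^sup>2" for x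
  proof (cases "x \<in> resonant \<delta>")
    case True
    define a where "a = \<delta> * phi x"
    define b where "b = t * phi x"
    have a: "1 \<le> a" "a \<le> 3/2" using True by (auto simp: resonant_def a_def)
    have a2: "a \<le> pi / 2" using a pi_gt3 by simp
    have c: "cos a \<le> cos 1" using a a2 pi_gt3 by (intro cos_monotone_0_pi_le) auto
    have c0: "0 \<le> cos a" using a a2 by (intro cos_ge_zero) auto
    have c1: "cos (1::real) \<le> 1" by simp
    have 1: "(1 - cos 1)\<^sup>2 \<le> (1 - cos a)\<^sup>2" using c c1 by (intro power_mono) auto
    \<comment> \<open>Nonnegativity of cos a gives 1 - cos a <= 1 + cos a, hence (1 - cos a)^2 <=
      sin^2 a.\<close>
    have "(1 - cos a) * (1 - cos a) \<le> (1 - cos a) * (1 + cos a)" using c0 c c1 by (intro mult_left_mono) auto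
    then have "(1 - cos a)\<^sup>2 \<le> 1 - (cos a)\<^sup>2" by (simp add: power2_eq_square algebra_simps)
    then have 2: "(1 - cos 1)\<^sup>2 \<le> (sin a)\<^sup>2" unfolding sin_squared_eq by (rule order.trans[OF 1])
    have "(1 - cos 1)\<^sup>2 = (1 - cos 1)\<^sup>2 * ((sin b)\<^sup>2 + (cos b)\<^sup>2)" by simp
    also have "\<dots> = (sin b)\<^sup>2 * (1 - cos 1)\<^sup>2 + (cos b)\<^sup>2 * (1 - cos 1)\<^sup>2" by (simp only: distrib_left ac_simps)
    also have "\<dots> \<le> (sin b)\<^sup>2 * (1 - cos a)\<^sup>2 + (cos b)\<^sup>2 * (sin a)\<^sup>2"
      using 1 2 by (intro add_mono mult_left_mono) auto
    also have "2 * \<dots> = (sin (b + a) - sin b)\<^sup>2 + (sin (b - a) - sin b)\<^sup>2"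
      unfolding sin_add sin_diff by (simp add: power2_eq_square algebra_simps)
    finally show ?thesis using True by (simp add: a_def b_def algebra_simps)
  qed simp
  have i: "integrable flat (\<lambda>x. sqrt (amp x) * (?p s x)\<^sup>2)" for s
    by (intro integrable_sqrt_amp_mult profile_power2 p)
  have "2 * (1 - cos 1)\<^sup>2 * resonant_mass \<delta> =
      (\<integral>x. sqrt (amp x) * (2 * (1 - cos 1)\<^sup>2 * indicator (resonant \<delta>) x) \<partial>flat)"
    unfolding resonant_mass_def integral_mult_right_zero[symmetric]
    by (rule Bochner_Integration.integral_cong[OF refl]) simp
  also have "\<dots> \<le> (\<integral>x. sqrt (amp x) * ((?p (t + \<delta>) x)\<^sup>2 + (?p (t - \<delta>) x)\<^sup>2) \<partial>flat)"
    using pt by (intro integral_sqrt_amp_mono profile_add profile_power2 p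
        profile_mult[OF profile_const profile_resonant])
  also have "\<dots> = (norm (u_ex d (t + \<delta>) - u_ex d t))\<^sup>2 + (norm (u_ex d (t - \<delta>) - u_ex d t))\<^sup>2"
    unfolding diff distrib_left by (rule Bochner_Integration.integral_add[OF i i])
  finally show ?thesis .
qed

section \<open>Fractional Sobolev regularity\<close>

lemma bochner_measurable_continuous_on:
  fixes g :: "real \<Rightarrow> 'b::real_normed_vector"
  assumes g: "continuous_on {0..T} g" shows "bochner_measurable T g"
  unfolding bochner_measurable_def
proof (intro exI conjI allI)
  \<comment> \<open>Rounding down to multiples of 1/(n+1) leaves finitely many values and keeps the
    sample point in [0,T], where g is continuous.\<close>
  let ?r = "\<lambda>n t. of_int \<lfloor>real (Suc n) * t\<rfloor> / real (Suc n)"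
  show "simple_function (lebesgue_on {0..T}) (\<lambda>t. g (?r n t))" for n
  proof (rule simple_function_compose2[where h="\<lambda>i::int. \<lambda>_::unit. g (of_int i / real (Suc n))" and g="\<lambda>_. ()", unfolded comp_def])
    have "(\<lambda>t. \<lfloor>real (Suc n) * t\<rfloor>) ` {0..T} \<subseteq> {0..\<lfloor>real (Suc n) * T\<rfloor>}"
      by (auto intro!: floor_mono mult_left_mono)
    then have fin: "finite ((\<lambda>t. \<lfloor>real (Suc n) * t\<rfloor>) ` {0..T})" by (rule finite_subset) simp
    have meas: "(\<lambda>t. \<lfloor>real (Suc n) * t\<rfloor>) \<in> measurable (lebesgue_on {0..T}) (count_space UNIV)"
      by (intro measurable_restrict_space1 measurable_completion) measurable
    show "simple_function (lebesgue_on {0..T}) (\<lambda>t. \<lfloor>real (Suc n) * t\<rfloor>)"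
      unfolding simple_function_def
    proof (intro conjI ballI)
      show "finite ((\<lambda>t. \<lfloor>real (Suc n) * t\<rfloor>) ` space (lebesgue_on {0..T}))" using fin by simp
    qed (rule measurable_sets[OF meas], simp)
  qed simp
  show "AE t in lebesgue_on {0..T}. (\<lambda>n. g (?r n t)) \<longlonglongrightarrow> g t"
  proof (rule AE_I2)
    fix t assume t: "t \<in> space (lebesgue_on {0..T})"
    have lim: "(\<lambda>n. ?r n t) \<longlonglongrightarrow> t"
    proof (rule tendsto_sandwich[of "\<lambda>n. t - 1 / real (Suc n)" _ _ "\<lambda>_. t"])
      show "(\<lambda>n. t - 1 / real (Suc n)) \<longlonglongrightarrow> t"
        using tendsto_diff[OF tendsto_const LIMSEQ_inverse_real_of_nat, of t] by (simp add: inverse_eq_divide)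
      have "real (Suc n) * t - 1 \<le> of_int \<lfloor>real (Suc n) * t\<rfloor>" for n by linarith
      then have "(real (Suc n) * t - 1) / real (Suc n) \<le> ?r n t" for n by (intro divide_right_mono) auto
      then show "\<forall>\<^sub>F n in sequentially. t - 1 / real (Suc n) \<le> ?r n t" by (simp add: diff_divide_distrib)
      have "?r n t \<le> (real (Suc n) * t) / real (Suc n)" for n by (intro divide_right_mono) auto
      then show "\<forall>\<^sub>F n in sequentially. ?r n t \<le> t" by simp
    qed simp
    have "?r n t \<in> {0..T}" for n
    proof -
      have "?r n t \<le> (real (Suc n) * t) / real (Suc n)" by (intro divide_right_mono) auto
      then show ?thesis using t by (auto intro: order.trans)
    qed
    then show "(\<lambda>n. g (?r n t)) \<longlonglongrightarrow> g t"
      using g lim t by (intro continuous_on_tendsto_compose[OF g lim]) auto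
  qed
qed

lemma nn_integral_lebesgue_on_eq:
  assumes "f \<in> borel_measurable borel"
  shows "(\<integral>\<^sup>+x. f x \<partial>lebesgue_on {a..b}) = (\<integral>\<^sup>+x. f x * indicator {a..b::real} x \<partial>lborel)"
proof -
  have "(\<integral>\<^sup>+x. f x \<partial>lebesgue_on {a..b}) = (\<integral>\<^sup>+x. f x * indicator {a..b} x \<partial>lebesgue)"
    by (rule nn_integral_restrict_space) simp
  also have "\<dots> = (\<integral>\<^sup>+x. f x * indicator {a..b} x \<partial>lborel)"
    using assms by (intro nn_integral_completion) measurable
  finally show ?thesis .
qed

lemma nn_integral_shift:
  fixes f :: "real \<Rightarrow> ennreal"
  assumes "f \<in> borel_measurable borel"
  shows "(\<integral>\<^sup>+x. f (x - t) \<partial>lborel) = (\<integral>\<^sup>+x. f x \<partial>lborel)"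
    and "(\<integral>\<^sup>+x. f (t - x) \<partial>lborel) = (\<integral>\<^sup>+x. f x \<partial>lborel)"
    and "(\<integral>\<^sup>+x. f (t + x) \<partial>lborel) = (\<integral>\<^sup>+x. f x \<partial>lborel)"
  using nn_integral_real_affine[OF assms, of 1 "-t"] nn_integral_real_affine[OF assms, of "-1" t]
    nn_integral_real_affine[OF assms, of 1 t] by simp_all

text \<open>The Gagliardo integrand as a function of x = |t - s| once the squared increment is
  replaced by x/|ln x|. It vanishes for x <= 0, so one-sided shifts can be added without
  overlap.\<close>

definition log_weight :: "real \<Rightarrow> real \<Rightarrow> real \<Rightarrow> real \<Rightarrow> ennreal" where
  "log_weight \<alpha> q \<delta>1 x = ennreal ((x / (- ln x)) powr (q / 2) / x powr (1 + \<alpha> * q)) * indicator {0<..\<delta>1} x"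

lemma borel_measurable_log_weight [measurable]: "log_weight \<alpha> q \<delta>1 \<in> borel_measurable borel"
  unfolding log_weight_def[abs_def] by measurable

lemma powr_sqrt_mult: "0 \<le> a \<Longrightarrow> 0 \<le> b \<Longrightarrow> sqrt (a * b) powr q = sqrt a powr q * b powr (q / 2)"
  by (simp add: real_sqrt_mult powr_mult powr_half_sqrt[symmetric] powr_powr)

text \<open>Near the diagonal the integrand is a multiple of the logarithmic weight of |t - s|;
  elsewhere it is bounded, since the modulus never exceeds 2 and the denominator is bounded
  below.\<close>

lemma frac_sobolev_of_modulus:
  fixes g :: "real \<Rightarrow> 'b::real_normed_vector"
  assumes q: "0 < q" and \<alpha>: "0 < \<alpha>" and K: "0 \<le> K" and C: "0 < C"
    and g: "\<And>t s. t \<in> {0..T} \<Longrightarrow> s \<in> {0..T} \<Longrightarrow> norm (g t - g s) \<le> K * osc t s"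
    and \<delta>: "0 < \<delta>1" "\<delta>1 \<le> 1/4" and up: "\<And>\<delta>. \<delta> \<in> {0<..\<delta>1} \<Longrightarrow> modulus \<delta> \<le> C * (\<delta> / (- ln \<delta>))"
    and fin: "(\<integral>\<^sup>+x. log_weight \<alpha> q \<delta>1 x \<partial>lborel) < \<infinity>"
  shows "frac_sobolev \<alpha> q T g"
  unfolding frac_sobolev_def
proof
  show "bochner_measurable T g"
    by (intro bochner_measurable_continuous_on continuous_on_modulusI[where K=K] g)
  let ?e = "1 + \<alpha> * q"
  let ?W = "log_weight \<alpha> q \<delta>1"
  define A where "A = (K * sqrt C) powr q"
  define B where "B = (K * sqrt 2) powr q / \<delta>1 powr ?e"
  have e: "0 < ?e" using q \<alpha> by (simp add: add_pos_pos)
  \<comment> \<open>Of the two weights only the one with positive argument contributes, so their sum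
    is the weight of |t - s| without an absolute value, and each summand is a translate or a
    reflected translate.\<close>
  have pt: "ennreal (norm (g t - g s) powr q / \<bar>t - s\<bar> powr ?e) \<le>
      ennreal A * (?W (t - s) + ?W (s - t)) + ennreal B" if t: "t \<in> {0..T}" "s \<in> {0..T}" for t s
  proof (cases "\<bar>t - s\<bar> \<in> {0<..\<delta>1}")
    case True
    let ?\<delta> = "\<bar>t - s\<bar>"
    let ?\<rho> = "?\<delta> / (- ln ?\<delta>)"
    have "ln ?\<delta> < 0" using True \<delta> by auto
    then have \<rho>: "0 \<le> ?\<rho>" by (intro divide_nonneg_nonneg) (use True in simp, linarith)
    have "norm (g t - g s) \<le> K * sqrt (C * ?\<rho>)"
      using up[OF True] K by (intro order.trans[OF g[OF t]] mult_left_mono) auto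
    then have "norm (g t - g s) powr q \<le> (K * sqrt (C * ?\<rho>)) powr q"
      using q by (intro powr_mono2) auto
    also have "\<dots> = A * ?\<rho> powr (q / 2)"
    proof -
      have "(K * sqrt (C * ?\<rho>)) powr q = K powr q * sqrt (C * ?\<rho>) powr q"
        using K C \<rho> by (intro powr_mult)
      also have "\<dots> = K powr q * (sqrt C powr q * ?\<rho> powr (q / 2))"
        using C \<rho> by (subst powr_sqrt_mult) auto
      also have "\<dots> = A * ?\<rho> powr (q / 2)" using K C by (simp add: A_def powr_mult)
      finally show ?thesis .
    qed
    finally have "norm (g t - g s) powr q / ?\<delta> powr ?e \<le> A * (?\<rho> powr (q / 2) / ?\<delta> powr ?e)"
      by (simp add: divide_right_mono)
    then have "ennreal (norm (g t - g s) powr q / ?\<delta> powr ?e) \<le> ennreal A * ?W ?\<delta>"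
      using True by (simp add: log_weight_def A_def ennreal_mult[symmetric] ennreal_leI)
    also have "?W ?\<delta> \<le> ?W (t - s) + ?W (s - t)" by (cases "s \<le> t") (auto simp: abs_if)
    finally show ?thesis by (simp add: mult_left_mono add_increasing2)
  next
    case False
    show ?thesis
    proof (cases "t = s")
      case True
      then show ?thesis by simp
    next
      case False
      then have d: "\<delta>1 < \<bar>t - s\<bar>" using \<open>\<bar>t - s\<bar> \<notin> {0<..\<delta>1}\<close> by auto
      have "norm (g t - g s) \<le> K * sqrt 2"
        using modulus_le_2[of "\<bar>t - s\<bar>"] K by (intro order.trans[OF g[OF t]] mult_left_mono) auto
      then have "norm (g t - g s) powr q / \<bar>t - s\<bar> powr ?e \<le> B"
        unfolding B_def using d \<delta> q e by (intro frac_le powr_mono2) auto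
      then show ?thesis by (intro add_increasing) (auto intro: ennreal_leI)
    qed
  qed
  let ?I = "\<integral>\<^sup>+x. ?W x \<partial>lborel"
  define R where "R = ennreal A * (?I + ?I) + ennreal B * ennreal T"
  have inner: "(\<integral>\<^sup>+s. ennreal (norm (g t - g s) powr q / \<bar>t - s\<bar> powr ?e) \<partial>lebesgue_on {0..T}) \<le> R"
    if t: "t \<in> {0..T}" for t
  proof -
    let ?f = "\<lambda>s. ennreal A * (?W (t - s) + ?W (s - t)) + ennreal B"
    have T: "0 \<le> T" using t by simp
    have "(\<integral>\<^sup>+s. ennreal (norm (g t - g s) powr q / \<bar>t - s\<bar> powr ?e) \<partial>lebesgue_on {0..T}) \<le>
        (\<integral>\<^sup>+s. ?f s \<partial>lebesgue_on {0..T})"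
      by (rule nn_integral_mono) (use pt t in auto)
    also have "\<dots> = (\<integral>\<^sup>+s. ?f s * indicator {0..T} s \<partial>lborel)"
      by (rule nn_integral_lebesgue_on_eq) measurable
    also have "\<dots> \<le> (\<integral>\<^sup>+s. ennreal A * (?W (t - s) + ?W (s - t)) + ennreal B * indicator {0..T} s \<partial>lborel)"
      by (rule nn_integral_mono) (auto simp: indicator_def)
    also have "\<dots> = ennreal A * ((\<integral>\<^sup>+s. ?W (t - s) \<partial>lborel) + (\<integral>\<^sup>+s. ?W (s - t) \<partial>lborel)) + ennreal B * ennreal T"
      using T by (simp add: nn_integral_add nn_integral_cmult)
    also have "\<dots> = R" by (simp add: R_def nn_integral_shift)
    finally show ?thesis .
  qed
  have "(\<integral>\<^sup>+t. (\<integral>\<^sup>+s. ennreal (norm (g t - g s) powr q / \<bar>t - s\<bar> powr ?e)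
        \<partial>lebesgue_on {0..T}) \<partial>lebesgue_on {0..T}) \<le> (\<integral>\<^sup>+t. R \<partial>lebesgue_on {0..T})"
    by (rule nn_integral_mono) (use inner in auto)
  also have "\<dots> = R * emeasure (lebesgue_on {0..T}) {0..T}" by simp
  also have "\<dots> < \<infinity>"
  proof -
    have "R < \<infinity>" using fin by (simp add: R_def ennreal_mult_less_top)
    moreover have "emeasure (lebesgue_on {0..T}) {0..T} < \<infinity>"
      by (simp add: emeasure_restrict_space emeasure_lborel_Icc_eq)
    ultimately show ?thesis by (simp add: ennreal_mult_less_top)
  qed
  finally show "(\<integral>\<^sup>+t. (\<integral>\<^sup>+s. ennreal (norm (g t - g s) powr q / \<bar>t - s\<bar> powr ?e)
        \<partial>lebesgue_on {0..T}) \<partial>lebesgue_on {0..T}) < \<infinity>" .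
qed

text \<open>For t in the middle half of [0,T] both t + \<delta> and t - \<delta> stay in the
  interval, and one of the two increments of u is as large as the modulus allows. If the weight had
  infinite integral, the inner integral would be infinite for each of these t.\<close>

lemma log_weight_finite_of_frac_sobolev:
  assumes T: "0 < T" and q: "0 < q" and \<delta>: "0 < \<delta>1" "\<delta>1 \<le> T / 4" "\<delta>1 \<le> 1/4" and c: "0 < c"
    and lo: "\<And>\<delta>. \<delta> \<in> {0<..\<delta>1} \<Longrightarrow> c * (\<delta> / (- ln \<delta>)) \<le> resonant_mass \<delta>"
    and fr: "frac_sobolev \<alpha> q T (u_ex d)"
  shows "(\<integral>\<^sup>+x. log_weight \<alpha> q \<delta>1 x \<partial>lborel) < \<infinity>"
proof (rule ccontr)
  let ?e = "1 + \<alpha> * q"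
  let ?W = "log_weight \<alpha> q \<delta>1"
  let ?G = "\<lambda>t s. ennreal (norm (u_ex d t - u_ex d s) powr q / \<bar>t - s\<bar> powr ?e)"
  assume "\<not> (\<integral>\<^sup>+x. ?W x \<partial>lborel) < \<infinity>"
  then have inf: "(\<integral>\<^sup>+x. ?W x \<partial>lborel) = \<infinity>" by (metis less_top infinity_ennreal_def)
  define m where "m = (1 - cos 1)\<^sup>2 * c"
  define A where "A = sqrt m powr q"
  have "cos (1::real) < cos 0" by (rule cos_monotone_0_pi) (use pi_gt3 in auto)
  then have m: "0 < m" using c by (simp add: m_def)
  then have A: "0 < A" by (simp add: A_def)
  have inner: "(\<integral>\<^sup>+s. ?G t s \<partial>lebesgue_on {0..T}) = \<infinity>" if t: "t \<in> {T/4..3*T/4}" for t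
  proof -
    let ?H = "\<lambda>s. ?G t s * indicator {0..T} s"
    have [measurable]: "(\<lambda>s. norm (u_ex d t - u_ex d s)) \<in> borel_measurable borel"
      by (intro borel_measurable_continuous_onI continuous_intros continuous_on_paths)
    have G: "?G t \<in> borel_measurable borel" by measurable
    have H: "?H \<in> borel_measurable borel" by measurable
    have pt: "ennreal A * ?W \<delta> \<le> ?H (t + \<delta>) + ?H (t - \<delta>)" for \<delta>
    proof (cases "\<delta> \<in> {0<..\<delta>1}")
      case True
      let ?\<rho> = "\<delta> / (- ln \<delta>)"
      define n1 where "n1 = norm (u_ex d t - u_ex d (t + \<delta>))"
      define n2 where "n2 = norm (u_ex d t - u_ex d (t - \<delta>))"
      have "ln \<delta> < 0" using True \<delta> by auto
      then have \<rho>: "0 \<le> ?\<rho>" by (intro divide_nonneg_nonneg) (use True in simp, linarith)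
      have "2 * (1 - cos 1)\<^sup>2 * (c * ?\<rho>) \<le> 2 * (1 - cos 1)\<^sup>2 * resonant_mass \<delta>"
        using lo[OF True] by (intro mult_left_mono) auto
      also have "\<dots> \<le> n1\<^sup>2 + n2\<^sup>2"
        using norm_u_ex_resonance[of \<delta> d t] unfolding n1_def n2_def by (simp add: norm_minus_commute)
      also have "2 * (1 - cos 1)\<^sup>2 * (c * ?\<rho>) = m * ?\<rho> + m * ?\<rho>" by (simp add: m_def)
      \<comment> \<open>Which of the two increments is large may depend on \<delta>; adding the
        integrands at t + \<delta> and t - \<delta> covers both cases.\<close>
      finally have "m * ?\<rho> \<le> n1\<^sup>2 \<or> m * ?\<rho> \<le> n2\<^sup>2" by linarith
      then have "sqrt (m * ?\<rho>) \<le> n1 \<or> sqrt (m * ?\<rho>) \<le> n2"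
        unfolding n1_def n2_def by (metis norm_ge_zero real_sqrt_abs abs_of_nonneg real_sqrt_le_mono)
      moreover have "ennreal A * ?W \<delta> \<le> ennreal (n powr q / \<delta> powr ?e)" if "sqrt (m * ?\<rho>) \<le> n" for n
      proof -
        have "sqrt (m * ?\<rho>) powr q \<le> n powr q"
        proof (rule powr_mono2)
          show "0 \<le> sqrt (m * ?\<rho>)"
            using mult_nonneg_nonneg[OF less_imp_le[OF m] \<rho>] by (simp only: real_sqrt_ge_0_iff)
        qed (use that q in auto)
        then have "A * ?\<rho> powr (q / 2) \<le> n powr q"
          unfolding A_def using m \<rho> by (subst (asm) powr_sqrt_mult) auto
        then have "A * (?\<rho> powr (q / 2) / \<delta> powr ?e) \<le> n powr q / \<delta> powr ?e"
          by (simp add: divide_right_mono)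
        then show ?thesis
          using True A by (simp add: log_weight_def ennreal_mult[symmetric] ennreal_leI)
      qed
      ultimately consider "ennreal A * ?W \<delta> \<le> ennreal (n1 powr q / \<delta> powr ?e)"
        | "ennreal A * ?W \<delta> \<le> ennreal (n2 powr q / \<delta> powr ?e)" by blast
      moreover have "t + \<delta> \<in> {0..T}" "t - \<delta> \<in> {0..T}" using t True \<delta> by auto
      then have "?H (t + \<delta>) = ennreal (n1 powr q / \<delta> powr ?e)" "?H (t - \<delta>) = ennreal (n2 powr q / \<delta> powr ?e)"
        using True by (simp_all add: n1_def n2_def)
      ultimately show ?thesis by (metis add_increasing add_increasing2 zero_le)
    qed (simp add: log_weight_def)
    have "\<infinity> = ennreal A * (\<integral>\<^sup>+x. ?W x \<partial>lborel)"
      unfolding inf using A by (simp add: ennreal_mult_top)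
    also have "\<dots> = (\<integral>\<^sup>+x. ennreal A * ?W x \<partial>lborel)" by (simp add: nn_integral_cmult)
    also have "\<dots> \<le> (\<integral>\<^sup>+x. ?H (t + x) + ?H (t - x) \<partial>lborel)" by (rule nn_integral_mono) (rule pt)
    also have "\<dots> = (\<integral>\<^sup>+x. ?H (t + x) \<partial>lborel) + (\<integral>\<^sup>+x. ?H (t - x) \<partial>lborel)"
      by (rule nn_integral_add) measurable
    also have "\<dots> = (\<integral>\<^sup>+x. ?H x \<partial>lborel) + (\<integral>\<^sup>+x. ?H x \<partial>lborel)"
      by (simp only: nn_integral_shift(2,3)[OF H])
    also have "(\<integral>\<^sup>+x. ?H x \<partial>lborel) = (\<integral>\<^sup>+s. ?G t s \<partial>lebesgue_on {0..T})"
      by (rule nn_integral_lebesgue_on_eq[OF G, symmetric])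
    finally show ?thesis by (simp add: top_unique)
  qed
  have "\<infinity> = (\<integral>\<^sup>+t. \<infinity> * indicator {T/4..3*T/4} t \<partial>lborel)"
    using T by (subst nn_integral_cmult_indicator) (auto simp: ennreal_top_mult)
  also have "\<dots> = (\<integral>\<^sup>+t. (\<infinity> * indicator {T/4..3*T/4} t) * indicator {0..T} t \<partial>lborel)"
    using T by (intro nn_integral_cong) (auto simp: indicator_def)
  also have "\<dots> = (\<integral>\<^sup>+t. \<infinity> * indicator {T/4..3*T/4} t \<partial>lebesgue_on {0..T})"
    by (rule nn_integral_lebesgue_on_eq[symmetric]) measurable
  also have "\<dots> \<le> (\<integral>\<^sup>+t. (\<integral>\<^sup>+s. ?G t s \<partial>lebesgue_on {0..T}) \<partial>lebesgue_on {0..T})"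
    by (rule nn_integral_mono) (use inner in \<open>auto simp: indicator_def\<close>)
  also have "\<dots> < \<infinity>" using fr by (simp add: frac_sobolev_def)
  finally show False by simp
qed

text \<open>At order 1/2 the powers of x combine to 1/x, leaving (-ln x)^(-q/2)/x. Its
  antiderivative is a multiple of (-ln x)^(1 - q/2), which vanishes at 0 because q > 2.\<close>

lemma log_weight_half_finite:
  assumes q: "2 < q" and \<delta>: "0 < \<delta>1" "\<delta>1 \<le> 1/4"
  shows "(\<integral>\<^sup>+x. log_weight (1/2) q \<delta>1 x \<partial>lborel) < \<infinity>"
proof -
  let ?F = "\<lambda>x::real. (- ln x) powr (1 - q/2) / (q/2 - 1)"
  let ?f = "\<lambda>x::real. (- ln x) powr (- q/2) / x"
  have "(?f has_integral (?F \<delta>1 - ?F 0)) {0..\<delta>1}"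
  proof (rule fundamental_theorem_of_calculus_interior)
    show "(?F has_vector_derivative ?f x) (at x)" if x: "x \<in> {0<..<\<delta>1}" for x
    proof -
      have l: "0 < - ln x" using x \<delta> by simp
      have "((\<lambda>x. - ln x) has_field_derivative - (1 / x)) (at x)"
        using x by (auto intro!: derivative_eq_intros)
      from DERIV_fun_powr[OF this l, of "1 - q/2"]
      have "((\<lambda>x. (- ln x) powr (1 - q/2)) has_field_derivative (1 - q/2) * (- ln x) powr (- q/2) * - (1 / x)) (at x)"
        by simp
      from DERIV_cdivide[OF this, of "q/2 - 1"]
      have "(?F has_field_derivative ((1 - q/2) * (- ln x) powr (- q/2) * - (1 / x)) / (q/2 - 1)) (at x)" .
      moreover have "((1 - q/2) * (- ln x) powr (- q/2) * - (1 / x)) / (q/2 - 1) = ?f x"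
        using q x by (simp add: field_simps)
      ultimately show ?thesis by (simp add: has_real_derivative_iff_has_vector_derivative)
    qed
    show "continuous_on {0..\<delta>1} ?F"
      unfolding continuous_on_def
    proof
      fix x assume x: "x \<in> {0..\<delta>1}"
      show "(?F \<longlongrightarrow> ?F x) (at x within {0..\<delta>1})"
      proof (cases "x = 0")
        case True
        \<comment> \<open>The conventional value \<open>?F 0\<close> is 0 and agrees with this
          limit, so the fundamental theorem of calculus applies up to the endpoint.\<close>
        have "filterlim (\<lambda>x::real. - ln x) at_top (at_right 0)"
          using ln_at_0 by (simp add: filterlim_uminus_at_bot)
        then have "((\<lambda>x::real. (- ln x) powr (1 - q/2)) \<longlongrightarrow> 0) (at_right 0)"
          using q by (intro tendsto_neg_powr) auto
        then have "(?F \<longlongrightarrow> 0 / (q/2 - 1)) (at_right 0)" using q by (intro tendsto_divide tendsto_const) auto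
        moreover have "at 0 within {0..\<delta>1} = at_right (0::real)"
          using \<delta> by (simp add: at_within_Icc_at_right)
        ultimately show ?thesis using True by simp
      next
        case False
        then have "0 < x" "ln x < 0" using x \<delta> by auto
        then have "isCont ?F x" using q by (intro continuous_intros) auto
        from continuous_at_imp_continuous_within[OF this] show ?thesis by (simp add: continuous_within)
      qed
    qed
  qed (use \<delta> in auto)
  then have fin: "(\<integral>\<^sup>+x. ennreal (?f x) * indicator {0..\<delta>1} x \<partial>lborel) = ennreal (?F \<delta>1 - ?F 0)"
    by (intro nn_integral_has_integral_lebesgue') auto
  have "log_weight (1/2) q \<delta>1 x \<le> ennreal (?f x) * indicator {0..\<delta>1} x" for x
  proof (cases "x \<in> {0<..\<delta>1}")
    case True
    then have x: "0 < x" "0 < - ln x" using \<delta> by auto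
    have "(x / (- ln x)) powr (q / 2) / x powr (1 + 1/2 * q) = x powr (q/2) / (- ln x) powr (q/2) / (x * x powr (q/2))"
      using x by (simp only: powr_divide powr_add) simp
    also have "\<dots> = ?f x" using x by (simp add: powr_minus divide_simps)
    finally show ?thesis using True by (simp add: log_weight_def)
  qed (simp add: log_weight_def)
  then have "(\<integral>\<^sup>+x. log_weight (1/2) q \<delta>1 x \<partial>lborel) \<le> ennreal (?F \<delta>1 - ?F 0)"
    unfolding fin[symmetric] by (rule nn_integral_mono)
  then show ?thesis by (simp add: le_less_trans)
qed

lemma frac_sobolev_half:
  fixes g :: "real \<Rightarrow> 'b::real_normed_vector"
  assumes "2 < q" "0 \<le> K"
    and g: "\<And>t s. t \<in> {0..T} \<Longrightarrow> s \<in> {0..T} \<Longrightarrow> norm (g t - g s) \<le> K * osc t s"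
  shows "frac_sobolev (1/2) q T g"
proof -
  obtain \<delta>0 C :: real where *: "0 < \<delta>0" "\<delta>0 \<le> 1/4" "0 < C"
    "\<forall>\<delta>\<in>{0<..\<delta>0}. modulus \<delta> \<le> C * (\<delta> / (- ln \<delta>))"
    using modulus_bounds by blast
  show ?thesis
    by (rule frac_sobolev_of_modulus[OF _ _ assms(2) *(3) g *(1,2)])
      (use assms * log_weight_half_finite in auto)
qed

text \<open>Regularity of u forces the logarithmic weight to be integrable, and this in turn gives
  the same regularity to any path controlled by the modulus. No increment of \<open>g\<close> is
  compared with one of u.\<close>

lemma frac_sobolev_transfer:
  fixes g :: "real \<Rightarrow> 'b::real_normed_vector"
  assumes T: "0 < T" and q: "0 < q" and \<alpha>: "0 < \<alpha>" and fr: "frac_sobolev \<alpha> q T (u_ex d)" and K: "0 \<le> K"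
    and g: "\<And>t s. t \<in> {0..T} \<Longrightarrow> s \<in> {0..T} \<Longrightarrow> norm (g t - g s) \<le> K * osc t s"
  shows "frac_sobolev \<alpha> q T g"
proof -
  obtain \<delta>0 C c :: real where *: "0 < \<delta>0" "\<delta>0 \<le> 1/4" "0 < C" "0 < c"
    "\<forall>\<delta>\<in>{0<..\<delta>0}. modulus \<delta> \<le> C * (\<delta> / (- ln \<delta>)) \<and> c * (\<delta> / (- ln \<delta>)) \<le> resonant_mass \<delta>"
    using modulus_bounds by blast
  \<comment> \<open>The bound T/4 leaves room for steps in both directions from the middle half of
    the interval.\<close>
  define \<delta>1 where "\<delta>1 = min \<delta>0 (T / 4)"
  have d: "0 < \<delta>1" "\<delta>1 \<le> 1/4" "\<delta>1 \<le> T / 4" using * T by (auto simp: \<delta>1_def)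
  have up: "modulus \<delta> \<le> C * (\<delta> / (- ln \<delta>))" and lo: "c * (\<delta> / (- ln \<delta>)) \<le> resonant_mass \<delta>"
    if "\<delta> \<in> {0<..\<delta>1}" for \<delta>
    using *(5) that by (auto simp: \<delta>1_def)
  have "(\<integral>\<^sup>+x. log_weight \<alpha> q \<delta>1 x \<partial>lborel) < \<infinity>"
    by (rule log_weight_finite_of_frac_sobolev[OF T q d(1,3,2) *(4) lo fr])
  from frac_sobolev_of_modulus[OF q \<alpha> K *(3) g d(1,2) up this] show ?thesis .
qed

section \<open>The form\<close>

lemma integral_sqrt_amp_pos:
  assumes p: "profile p" "\<And>x. 0 < x \<Longrightarrow> x < 1 \<Longrightarrow> 0 < p x"
  shows "0 < (\<integral>x. sqrt (amp x) * p x \<partial>flat)"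
proof -
  have pos: "AE x in flat. 0 < sqrt (amp x) * p x"
    using AE_flat by eventually_elim (use p(2) amp_pos in auto)
  have i: "integrable flat (\<lambda>x. sqrt (amp x) * p x)" by (rule integrable_sqrt_amp_mult[OF p(1)])
  have nn: "AE x in flat. 0 \<le> sqrt (amp x) * p x" using pos by eventually_elim simp
  have "(\<integral>x. sqrt (amp x) * p x \<partial>flat) \<noteq> 0"
  proof
    assume "(\<integral>x. sqrt (amp x) * p x \<partial>flat) = 0"
    then have "AE x in flat. sqrt (amp x) * p x = 0"
      using integral_nonneg_eq_0_iff_AE[OF i nn] by simp
    with pos have "AE x in flat. False" by eventually_elim simp
    from AE_E[OF this] obtain N where N: "{x\<in>space flat. \<not> False} \<subseteq> N" "emeasure flat N = 0" "N \<in> sets flat"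
      by blast
    have "emeasure flat {0..1/2} \<le> emeasure flat N" by (rule emeasure_mono) (use N in auto)
    then have "emeasure flat {0..1/2} = 0" using N(2) by simp
    then have "Sigma_Algebra.measure flat {0..1/2} = 0" by (simp add: Sigma_Algebra.measure_def)
    then show False by simp
  qed
  moreover have "0 \<le> (\<integral>x. sqrt (amp x) * p x \<partial>flat)" by (rule integral_nonneg_AE[OF nn])
  ultimately show ?thesis by linarith
qed

text \<open>\<open>mass\<close> and \<open>dual_mass\<close> are the squared norms of the envelope
  \<open>amp\<close> in V and in H.\<close>

definition mass :: real where "mass = (\<integral>x. sqrt (amp x) * 1 \<partial>flat)"
definition dual_mass :: real where "dual_mass = (\<integral>x. sqrt (amp x) * (1 / wgt x) \<partial>flat)"

lemma mass_pos: "0 < mass" "0 < dual_mass"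
  unfolding mass_def dual_mass_def
  by (intro integral_sqrt_amp_pos profile_div_wgt profile_const; simp add: wgt_pos)+

text \<open>The rank-one part repairs the equation at the single vector \<open>u t\<close>: it maps \<open>u t\<close> to \<open>driver d t\<close>.\<close>

definition coercivity :: real where "coercivity = dual_mass / (16 * mass)"

text \<open>The equation forces the operator to map u to \<open>dual_path\<close> minus
  \<open>velocity\<close>. Subtracting the share of the multiple of the inner product leaves what
  the rank-one part has to produce.\<close>

definition driver :: "real \<Rightarrow> real \<Rightarrow> V_space" where
  "driver d t = dual_path d t - velocity t - coercivity *\<^sub>R u_ex d t"

definition pairing :: "real \<Rightarrow> real \<Rightarrow> real" where
  "pairing d t = Re (cinner (u_ex d t) (driver d t))"

definition ex_form :: "real \<Rightarrow> V_space form" where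
  "ex_form d t = rank_one_form coercivity (driver d t) (pairing d t)"

lemma coercivity_pos: "0 < coercivity"
  using mass_pos by (simp add: coercivity_def)

lemma cinner_u_ex:
  "cinner (u_ex d t) (dual_path d t) =
     of_real (\<integral>x. sqrt (amp x) * ((sin (t * phi x) + d) * ((sin (t * phi x) + d) / wgt x)) \<partial>flat)"
  "cinner (u_ex d t) (velocity t) =
     of_real (\<integral>x. sqrt (amp x) * ((sin (t * phi x) + d) * cos (t * phi x)) \<partial>flat)"
  "cinner (u_ex d t) (u_ex d t) =
     of_real (\<integral>x. sqrt (amp x) * ((sin (t * phi x) + d) * (sin (t * phi x) + d)) \<partial>flat)"
  unfolding u_ex_eq dual_path_def velocity_def by (rule cinner_amp_mult; simp)+

lemma cinner_u_ex_driver: "cinner (u_ex d t) (driver d t) = of_real (pairing d t)"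
  unfolding pairing_def driver_def cinner_diff_right cinner_scaleR_right cinner_u_ex
  by (simp flip: of_real_mult of_real_diff)

text \<open>Put e = d - 1. The pairing with \<open>dual_path\<close> is at least e^2
  \<open>dual_mass\<close>, while the terms from \<open>velocity\<close> and
  \<open>coercivity\<close> each take away at most a quarter of that. The remaining half is at least
  2 \<open>dual_mass\<close> because e >= 2.\<close>

lemma pairing_ge:
  assumes d: "3 \<le> d" "8 * mass / dual_mass \<le> d - 1"
  shows "2 * dual_mass \<le> pairing d t"
proof -
  let ?s = "\<lambda>x. sin (t * phi x)"
  have s: "d - 1 \<le> ?s x + d" "?s x + d \<le> d + 1" "0 \<le> ?s x + d" for x
    using abs_sin_le_one[of "t * phi x"] d by linarith+
  have "(\<integral>x. sqrt (amp x) * ((d - 1)\<^sup>2 * (1 / wgt x)) \<partial>flat) \<le>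
      (\<integral>x. sqrt (amp x) * ((?s x + d) * ((?s x + d) / wgt x)) \<partial>flat)"
  proof (rule integral_sqrt_amp_mono)
    fix x :: real assume x: "0 < x" "x < 1"
    have "(d - 1)\<^sup>2 \<le> (?s x + d)\<^sup>2" using s(1) d by (intro power_mono) auto
    then have "(d - 1)\<^sup>2 / wgt x \<le> (?s x + d)\<^sup>2 / wgt x" by (simp add: divide_right_mono)
    then show "(d - 1)\<^sup>2 * (1 / wgt x) \<le> (?s x + d) * ((?s x + d) / wgt x)"
      by (simp add: power2_eq_square)
  qed (intro profile_mult profile_sin_add profile_sin_add_div_wgt
      profile_div_wgt profile_const)+
  also have "(\<integral>x. sqrt (amp x) * ((d - 1)\<^sup>2 * (1 / wgt x)) \<partial>flat) = (d - 1)\<^sup>2 * dual_mass"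
    unfolding dual_mass_def integral_mult_right_zero[symmetric]
    by (rule Bochner_Integration.integral_cong[OF refl]) simp
  finally have 1: "(d - 1)\<^sup>2 * dual_mass \<le> Re (cinner (u_ex d t) (dual_path d t))"
    unfolding cinner_u_ex by simp
  have "(\<integral>x. sqrt (amp x) * ((?s x + d) * cos (t * phi x)) \<partial>flat) \<le> (\<integral>x. sqrt (amp x) * (d + 1) \<partial>flat)"
  proof (rule integral_sqrt_amp_mono)
    fix x :: real
    have "(?s x + d) * cos (t * phi x) \<le> (?s x + d) * 1" using s(3) by (intro mult_left_mono) auto
    then show "(?s x + d) * cos (t * phi x) \<le> d + 1" using s(2)[of x] by (metis mult.right_neutral order.trans)
  qed (intro profile_mult profile_sin_add profile_trig profile_const)+
  also have "\<dots> = (d + 1) * mass"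
    unfolding mass_def integral_mult_right_zero[symmetric]
    by (rule Bochner_Integration.integral_cong[OF refl]) simp
  finally have 2: "Re (cinner (u_ex d t) (velocity t)) \<le> (d + 1) * mass"
    unfolding cinner_u_ex by simp
  have "(\<integral>x. sqrt (amp x) * ((?s x + d) * (?s x + d)) \<partial>flat) \<le> (\<integral>x. sqrt (amp x) * ((d + 1) * (d + 1)) \<partial>flat)"
  proof (rule integral_sqrt_amp_mono)
    show "(?s x + d) * (?s x + d) \<le> (d + 1) * (d + 1)" for x
      using s(2,3)[of x] d by (intro mult_mono) auto
  qed (intro profile_mult profile_sin_add profile_const)+
  also have "\<dots> = (d + 1) * (d + 1) * mass"
    unfolding mass_def integral_mult_right_zero[symmetric]
    by (rule Bochner_Integration.integral_cong[OF refl]) simp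
  finally have 3: "Re (cinner (u_ex d t) (u_ex d t)) \<le> (d + 1) * (d + 1) * mass"
    unfolding cinner_u_ex by simp
  note m = mass_pos
  \<comment> \<open>From d >= 3 follows d + 1 <= 2 e. The factor 1/16 in \<open>coercivity\<close>
    then absorbs (2 e)^2 up to a quarter, and the second hypothesis on d does the same for the
    velocity term.\<close>
  define e where "e = d - 1"
  have e: "2 \<le> e" "8 * mass \<le> e * dual_mass" using d m by (simp_all add: e_def field_simps)
  have "coercivity * ((d + 1) * (d + 1) * mass) = dual_mass * ((d + 1) * (d + 1)) / 16"
    using m by (simp add: coercivity_def)
  also have "\<dots> \<le> dual_mass * ((2 * e) * (2 * e)) / 16"
    using m e(1) by (intro divide_right_mono mult_left_mono mult_mono) (auto simp: e_def)
  finally have 4: "coercivity * ((d + 1) * (d + 1) * mass) \<le> e * e * dual_mass / 4" by (simp add: mult.commute)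
  have "(d + 1) * mass \<le> (2 * e) * mass" using m e(1) by (intro mult_right_mono) (auto simp: e_def)
  also have "\<dots> = e * (8 * mass) / 4" by simp
  also have "\<dots> \<le> e * (e * dual_mass) / 4" using e by (intro divide_right_mono mult_left_mono) auto
  finally have 5: "(d + 1) * mass \<le> e * e * dual_mass / 4" by simp
  have 6: "coercivity * Re (cinner (u_ex d t) (u_ex d t)) \<le> coercivity * ((d + 1) * (d + 1) * mass)"
    using 3 coercivity_pos by (intro mult_left_mono) auto
  have "4 * dual_mass \<le> e * e * dual_mass" using e m mult_mono[of 2 e 2 e] by (intro mult_right_mono) auto
  moreover have "pairing d t = Re (cinner (u_ex d t) (dual_path d t)) - Re (cinner (u_ex d t) (velocity t))
      - coercivity * Re (cinner (u_ex d t) (u_ex d t))"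
    by (simp add: pairing_def driver_def cinner_diff_right cinner_scaleR_right)
  moreover have "(d - 1)\<^sup>2 * dual_mass = e * e * dual_mass" by (simp add: e_def power2_eq_square)
  ultimately show ?thesis using 1 2 4 5 6 by linarith
qed

lemma norm_velocity_le: "norm (velocity t) \<le> 1"
  unfolding velocity_def by (rule norm_amp_mult_le_const) simp_all

lemma norm_dual_path_le: "norm (dual_path d t) \<le> 1 + \<bar>d\<bar>"
  unfolding dual_path_def
proof (rule norm_amp_mult_le_const[OF profile_sin_add_div_wgt])
  fix x :: real assume x: "0 < x" "x < 1"
  have "\<bar>(sin (t * phi x) + d) / wgt x\<bar> \<le> (1 + \<bar>d\<bar>) / 1"
    unfolding abs_divide using wgt_ge_1[OF x] abs_sin_le_one[of "t * phi x"]
    by (intro frac_le) (auto intro: order.trans[OF abs_triangle_ineq])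
  then show "\<bar>(sin (t * phi x) + d) / wgt x\<bar> \<le> 1 + \<bar>d\<bar>" by simp
qed

definition driver_bound :: "real \<Rightarrow> real" where
  "driver_bound d = (1 + \<bar>d\<bar>) + 1 + coercivity * (1 + \<bar>d\<bar>)"

lemma driver_bound_pos: "0 < driver_bound d"
  unfolding driver_bound_def using coercivity_pos
  by (intro add_pos_nonneg mult_nonneg_nonneg) auto

lemma norm_driver_le: "norm (driver d t) \<le> driver_bound d"
proof -
  have "norm (driver d t) \<le> norm (dual_path d t) + norm (velocity t) + coercivity * norm (u_ex d t)"
    unfolding driver_def using coercivity_pos
    by (intro order.trans[OF norm_triangle_ineq4] add_mono norm_triangle_ineq4) auto
  also have "\<dots> \<le> driver_bound d"
    unfolding driver_bound_def using coercivity_pos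
    by (intro add_mono mult_left_mono norm_dual_path_le norm_velocity_le norm_u_ex_le) auto
  finally show ?thesis .
qed

lemma norm_driver_diff_le: "norm (driver d t - driver d s) \<le> (2 + coercivity) * osc t s"
proof -
  have "driver d t - driver d s = (dual_path d t - dual_path d s) - (velocity t - velocity s)
      - coercivity *\<^sub>R (u_ex d t - u_ex d s)"
    by (simp add: driver_def algebra_simps)
  also have "norm \<dots> \<le> norm (dual_path d t - dual_path d s) + norm (velocity t - velocity s)
      + coercivity * norm (u_ex d t - u_ex d s)"
    using coercivity_pos
    by (intro order.trans[OF norm_triangle_ineq4] add_mono norm_triangle_ineq4) auto
  also have "\<dots> \<le> osc t s + osc t s + coercivity * osc t s"
    using coercivity_pos by (intro add_mono mult_left_mono norm_path_diff_le) auto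
  finally show ?thesis by (simp add: algebra_simps)
qed

lemma pairing_diff_le:
  "\<bar>pairing d t - pairing d s\<bar> \<le>
     (driver_bound d + (1 + \<bar>d\<bar>) * (2 + coercivity)) * osc t s"
proof -
  have "pairing d t - pairing d s =
      Re (cinner (u_ex d t - u_ex d s) (driver d t) + cinner (u_ex d s) (driver d t - driver d s))"
    by (simp add: pairing_def cinner_diff_left cinner_diff_right)
  also have "\<bar>\<dots>\<bar> \<le> cmod (cinner (u_ex d t - u_ex d s) (driver d t)) + cmod (cinner (u_ex d s) (driver d t - driver d s))"
    by (rule order.trans[OF abs_Re_le_cmod norm_triangle_ineq])
  also have "\<dots> \<le> osc t s * driver_bound d + (1 + \<bar>d\<bar>) * ((2 + coercivity) * osc t s)"
    using modulus_nonneg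
    by (intro add_mono order.trans[OF cmod_cinner_le] mult_mono norm_path_diff_le norm_driver_le
        norm_u_ex_le norm_driver_diff_le) auto
  finally show ?thesis by (simp add: algebra_simps)
qed

context
  fixes d :: real
  assumes d: "3 \<le> d" "8 * mass / dual_mass \<le> d - 1"
begin

lemma pairing_lower: "2 * dual_mass \<le> pairing d t" "0 < 2 * dual_mass" "0 < pairing d t"
  using pairing_ge[OF d, of t] mass_pos(2) by auto

definition form_bound :: real where
  "form_bound = coercivity + (driver_bound d)\<^sup>2 / (2 * dual_mass)"

lemma form_bound_pos: "0 < form_bound"
  unfolding form_bound_def using coercivity_pos mass_pos(2) by (intro add_pos_nonneg) auto

lemma cmod_ex_form_le: "cmod (ex_form d t v z) \<le> form_bound * norm v * norm z"
  unfolding ex_form_def form_bound_def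
  by (rule cmod_rank_one_form_le[OF pairing_lower(2,1) norm_driver_le less_imp_le[OF coercivity_pos]])

lemma Re_ex_form_ge: "coercivity * (norm v)\<^sup>2 \<le> Re (ex_form d t v v)"
  unfolding ex_form_def by (rule Re_rank_one_form_ge[OF pairing_lower(3)])

lemma sesquilinear_ex_form: "sesquilinear (ex_form d t)"
  unfolding ex_form_def by (rule sesquilinear_rank_one_form)

lemma bounded_coercive_ex_form: "bounded_coercive_form T (ex_form d)"
  unfolding bounded_coercive_form_def
  using sesquilinear_ex_form Re_ex_form_ge cmod_ex_form_le coercivity_pos form_bound_pos by blast

lemma symmetric_ex_form: "symmetric_form T (ex_form d)"
  unfolding symmetric_form_def ex_form_def using rank_one_form_commute by blast

lemma form_op_ex_form_apply: "blinfun_apply (blinfun_apply (form_op (ex_form d) t) v) z = ex_form d t v z"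
  by (rule blinfun_apply_form_op[where a="ex_form d" and t=t, OF sesquilinear_ex_form less_imp_le[OF form_bound_pos] cmod_ex_form_le])

text \<open>At u the denominator \<open>pairing d t\<close> cancels against the inner product of u
  and \<open>driver d t\<close>, so the rank-one part contributes exactly the driver.\<close>

lemma form_op_ex_form_u_ex: "form_op (ex_form d) t (u_ex d t) = riesz (dual_path d t - velocity t)"
proof (rule blinfun_eqI)
  fix z
  have "ex_form d t (u_ex d t) z = of_real coercivity * cinner (u_ex d t) z + cinner (driver d t) z"
    unfolding ex_form_def rank_one_form_def cinner_u_ex_driver using pairing_lower(3)[of t] by simp
  also have "\<dots> = cinner (dual_path d t - velocity t) z"
    by (simp add: driver_def cinner_diff_left cinner_scaleR_left)
  finally show "blinfun_apply (form_op (ex_form d) t (u_ex d t)) z = blinfun_apply (riesz (dual_path d t - velocity t)) z"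
    by (simp add: form_op_ex_form_apply)
qed

lemma form_op_ex_form_modulus:
  "\<exists>K\<ge>0. \<forall>t s. norm (form_op (ex_form d) t - form_op (ex_form d) s) \<le> K * osc t s"
proof -
  let ?b = "2 * dual_mass" and ?M = "driver_bound d"
  let ?K = "2 * ?M / ?b * (2 + coercivity) + ?M\<^sup>2 / ?b\<^sup>2 * (?M + (1 + \<bar>d\<bar>) * (2 + coercivity))"
  have M: "0 \<le> ?M" using driver_bound_pos less_imp_le by blast
  have "norm (form_op (ex_form d) t - form_op (ex_form d) s) \<le> ?K * osc t s" for t s
  proof -
    have "norm (form_op (ex_form d) t - form_op (ex_form d) s) \<le>
        2 * ?M / ?b * norm (driver d t - driver d s) + ?M\<^sup>2 / ?b\<^sup>2 * \<bar>pairing d t - pairing d s\<bar>"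
      unfolding ex_form_def[abs_def]
      by (rule norm_diff_rank_one_form_op_le)
        (use pairing_lower norm_driver_le coercivity_pos in \<open>auto intro: less_imp_le\<close>)
    also have "\<dots> \<le> 2 * ?M / ?b * ((2 + coercivity) * osc t s) +
        ?M\<^sup>2 / ?b\<^sup>2 * ((?M + (1 + \<bar>d\<bar>) * (2 + coercivity)) * osc t s)"
      using M mass_pos(2) by (intro add_mono mult_left_mono norm_driver_diff_le pairing_diff_le) auto
    also have "A * (c * m) + B * (E * m) = (A * c + B * E) * m" for A B c E m :: real
      by (simp add: algebra_simps)
    finally show ?thesis .
  qed
  moreover have "0 \<le> ?K" using M mass_pos(2) coercivity_pos
    by (intro add_nonneg_nonneg mult_nonneg_nonneg divide_nonneg_nonneg) auto
  ultimately show ?thesis by blast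
qed

end


section \<open>Continuous functions and integrated solutions\<close>

lemma ennreal_powr_finite: "x < top \<Longrightarrow> ennreal_powr x r < top"
  by (simp add: ennreal_powr_def)

lemma in_Lp_continuous_on:
  fixes g :: "real \<Rightarrow> 'b::real_normed_vector"
  assumes g: "continuous_on {0..T} g" shows "in_Lp p T g"
  unfolding in_Lp_def
proof
  show "bochner_measurable T g" by (rule bochner_measurable_continuous_on[OF g])
  have "bounded (g ` {0..T})" by (intro compact_imp_bounded compact_continuous_image g) simp
  then obtain B where "\<forall>t\<in>{0..T}. norm (g t) \<le> B" by (auto simp: bounded_iff)
  then have B: "\<And>t. t \<in> {0..T} \<Longrightarrow> norm (g t) \<le> B" by blast
  show "Lp_norm p T g < \<infinity>"
  proof (cases "p = \<infinity>")
    case True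
    have "(\<lambda>t. norm (g t)) \<in> borel_measurable (lebesgue_on {0..T})"
      by (intro continuous_imp_measurable_on_sets_lebesgue continuous_on_norm g) simp
    then have "esssup (lebesgue_on {0..T}) (\<lambda>t. ennreal (norm (g t))) \<le> ennreal B"
      using B by (intro esssup_I) (auto intro!: ennreal_leI)
    then show ?thesis using True by (simp add: Lp_norm_def le_less_trans)
  next
    case False
    let ?p = "enn2real p"
    have "(\<integral>\<^sup>+t. ennreal (norm (g t) powr ?p) \<partial>lebesgue_on {0..T}) \<le>
        (\<integral>\<^sup>+t. ennreal (B powr ?p) \<partial>lebesgue_on {0..T})"
      using B by (intro nn_integral_mono ennreal_leI powr_mono2) auto
    also have "\<dots> < \<infinity>"
      by (simp add: emeasure_restrict_space emeasure_lborel_Icc_eq ennreal_mult_less_top)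
    finally show ?thesis using False by (simp add: Lp_norm_def ennreal_powr_finite)
  qed
qed

lemma continuous_on_riesz: "continuous_on S g \<Longrightarrow> continuous_on S (\<lambda>t. riesz (g t))"
  by (rule bounded_linear.continuous_on[OF bounded_linear_riesz])

lemma has_vector_derivative_emb_dual_u_ex:
  "((\<lambda>s. emb_dual V_to_H (V_to_H (u_ex d s))) has_vector_derivative riesz (velocity t)) (at t within S)"
  unfolding emb_dual_u_ex
  by (rule bounded_linear.has_vector_derivative[OF bounded_linear_riesz has_vector_derivative_dual_path])

lemma integrated_solution_u_ex:
  assumes d: "3 \<le> d" "8 * mass / dual_mass \<le> d - 1"
  shows "integrated_solution T V_to_H (ex_form d) (\<lambda>t. emb_dual V_to_H (V_to_H (u_ex d t))) (u_ex d)"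
  unfolding integrated_solution_def
proof (intro conjI exI)
  show "in_Lp 2 T (u_ex d)" by (intro in_Lp_continuous_on continuous_on_paths)
  show "sobolev_deriv 2 T (\<lambda>t. emb_dual V_to_H (V_to_H (u_ex d t))) (\<lambda>t. riesz (velocity t))"
    unfolding sobolev_deriv_def
  proof (intro conjI ballI)
    show "in_Lp 2 T (\<lambda>t. emb_dual V_to_H (V_to_H (u_ex d t)))"
      unfolding emb_dual_u_ex by (intro in_Lp_continuous_on continuous_on_riesz continuous_on_paths)
    show "in_Lp 2 T (\<lambda>t. riesz (velocity t))"
      by (intro in_Lp_continuous_on continuous_on_riesz continuous_on_paths)
    show "((\<lambda>t. riesz (velocity t)) has_integral
        emb_dual V_to_H (V_to_H (u_ex d t)) - emb_dual V_to_H (V_to_H (u_ex d 0))) {0..t}" if "t \<in> {0..T}" for t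
      using that
      by (intro fundamental_theorem_of_calculus[where f="\<lambda>t. emb_dual V_to_H (V_to_H (u_ex d t))"]
          has_vector_derivative_emb_dual_u_ex) auto
  qed
  show "AE t in lebesgue_on {0..T}. riesz (velocity t) + form_op (ex_form d) t (u_ex d t) =
      emb_dual V_to_H (V_to_H (u_ex d t))"
  proof (rule AE_I2)
    fix t
    have "riesz (velocity t) + riesz (dual_path d t - velocity t) = riesz (dual_path d t)"
      using linear_add[OF bounded_linear.linear[OF bounded_linear_riesz], of "velocity t" "dual_path d t - velocity t"]
      by simp
    then show "riesz (velocity t) + form_op (ex_form d) t (u_ex d t) = emb_dual V_to_H (V_to_H (u_ex d t))"
      by (simp add: form_op_ex_form_u_ex[OF d] emb_dual_u_ex)
  qed
qed

section \<open>Measurability and integrability along Bochner measurable functions\<close>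

text \<open>The sequence converges only almost everywhere; the pointwise limit operator is
  measurable, and completeness of Lebesgue measure passes this on to \<open>g\<close>.\<close>

lemma borel_measurable_AE_limit:
  fixes g :: "real \<Rightarrow> real"
  assumes u: "\<And>n. u n \<in> borel_measurable (lebesgue_on {a..b})"
    and lim: "AE t in lebesgue_on {a..b}. (\<lambda>n::nat. u n t) \<longlonglongrightarrow> g t"
  shows "g \<in> borel_measurable (lebesgue_on {a..b})"
proof (rule borel_measurable_if_D)
  let ?h = "\<lambda>t. lim (\<lambda>n. u n t)"
  have "?h \<in> borel_measurable (lebesgue_on {a..b})" using u by measurable
  then have "(\<lambda>t. if t \<in> {a..b} then ?h t else 0) \<in> borel_measurable lebesgue"
    by (rule borel_measurable_if_I) simp
  moreover have "AE t in lebesgue. t \<in> {a..b} \<longrightarrow> (\<lambda>n. u n t) \<longlonglongrightarrow> g t"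
    using lim by (subst (asm) AE_restrict_space_iff) auto
  then have "AE t in lebesgue. (if t \<in> {a..b} then ?h t else 0) = (if t \<in> {a..b} then g t else 0)"
    by eventually_elim (auto simp: limI)
  ultimately show "(\<lambda>t. if t \<in> {a..b} then g t else 0) \<in> borel_measurable lebesgue"
    by (rule borel_measurable_AE)
qed

lemma borel_measurable_norm_bochner:
  assumes "bochner_measurable T g"
  shows "(\<lambda>t. norm (g t)) \<in> borel_measurable (lebesgue_on {0..T})"
proof -
  obtain s where s: "\<And>n::nat. simple_function (lebesgue_on {0..T}) (s n)"
      "AE t in lebesgue_on {0..T}. (\<lambda>n. s n t) \<longlonglongrightarrow> g t"
    using assms unfolding bochner_measurable_def by blast
  show ?thesis
  proof (rule borel_measurable_AE_limit)
    show "(\<lambda>t. norm (s n t)) \<in> borel_measurable (lebesgue_on {0..T})" for n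
      by (rule borel_measurable_simple_function, rule simple_function_compose1[OF s(1), of norm])
    show "AE t in lebesgue_on {0..T}. (\<lambda>n. norm (s n t)) \<longlonglongrightarrow> norm (g t)"
      using s(2) by eventually_elim (rule tendsto_norm)
  qed
qed

text \<open>On each level set of an approximating simple function the first argument is constant, so
  the pairing is a finite sum of indicators times continuous functions.\<close>

lemma borel_measurable_inner_bochner:
  fixes g :: "real \<Rightarrow> 'b::real_inner"
  assumes g: "bochner_measurable T g" and c: "continuous_on {0..T} c"
  shows "(\<lambda>t. inner (g t) (c t)) \<in> borel_measurable (lebesgue_on {0..T})"
proof -
  let ?M = "lebesgue_on {0..T}"
  obtain s where s: "\<And>n::nat. simple_function ?M (s n)" "AE t in ?M. (\<lambda>n. s n t) \<longlonglongrightarrow> g t"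
    using g unfolding bochner_measurable_def by blast
  show ?thesis
  proof (rule borel_measurable_AE_limit)
    fix n
    have fin: "finite (s n ` {0..T})" using s(1)[of n] by (simp add: simple_function_def)
    have "(\<lambda>t. \<Sum>y\<in>s n ` {0..T}. indicator (s n -` {y} \<inter> space ?M) t * inner y (c t)) \<in> borel_measurable ?M"
    proof (intro borel_measurable_sum borel_measurable_times borel_measurable_indicator)
      show "s n -` {y} \<inter> space ?M \<in> sets ?M" for y
        using simple_functionD(2)[OF s(1)] .
      show "(\<lambda>t. inner y (c t)) \<in> borel_measurable ?M" for y
        by (intro continuous_imp_measurable_on_sets_lebesgue continuous_intros c) simp
    qed
    moreover have "inner (s n t) (c t) = (\<Sum>y\<in>s n ` {0..T}. indicator (s n -` {y} \<inter> space ?M) t * inner y (c t))"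
      if "t \<in> space ?M" for t
    proof -
      have "(\<Sum>y\<in>s n ` {0..T}. indicator (s n -` {y} \<inter> space ?M) t * inner y (c t)) =
          (\<Sum>y\<in>s n ` {0..T}. if y = s n t then inner y (c t) else 0)"
        using that by (intro sum.cong) (auto simp: indicator_def)
      also have "\<dots> = inner (s n t) (c t)" using fin that by (simp add: sum.delta')
      finally show ?thesis ..
    qed
    ultimately show "(\<lambda>t. inner (s n t) (c t)) \<in> borel_measurable ?M"
      by (subst measurable_cong) auto
  next
    show "AE t in ?M. (\<lambda>n. inner (s n t) (c t)) \<longlonglongrightarrow> inner (g t) (c t)"
      using s(2) by eventually_elim (intro tendsto_intros)
  qed
qed

text \<open>On a bounded interval every exponent p >= 1 gives integrability; this alone is what the
  uniqueness argument uses, so it runs uniformly in p.\<close>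

lemma integrable_norm_in_Lp:
  assumes g: "in_Lp p T g" and p: "1 \<le> p"
  shows "integrable (lebesgue_on {0..T}) (\<lambda>t. norm (g t))"
proof -
  let ?M = "lebesgue_on {0..T}"
  have fm: "finite_measure ?M" by (rule finite_measure_lebesgue_on) simp
  have meas: "(\<lambda>t. norm (g t)) \<in> borel_measurable ?M"
    using g by (intro borel_measurable_norm_bochner) (simp add: in_Lp_def)
  have fin: "Lp_norm p T g < \<infinity>" using g by (simp add: in_Lp_def)
  show ?thesis
  proof (cases "p = \<infinity>")
    case True
    let ?E = "esssup ?M (\<lambda>t. ennreal (norm (g t)))"
    have E: "?E < top" using fin True by (simp add: Lp_norm_def)
    have "AE t in ?M. ennreal (norm (g t)) \<le> ?E" by (rule esssup_AE)
    then have "AE t in ?M. norm (norm (g t)) \<le> enn2real ?E"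
    proof eventually_elim
      case (elim t)
      then have "ennreal (norm (g t)) \<le> ennreal (enn2real ?E)" using E by simp
      then show ?case by (simp add: ennreal_le_iff)
    qed
    then show ?thesis by (rule finite_measure.integrable_const_bound[OF fm _ meas])
  next
    case False
    let ?p = "enn2real p"
    have p1: "1 \<le> ?p"
      using p False by (metis enn2real_mono enn2real_1 infinity_ennreal_def less_top)
    have pow: "(\<lambda>t. norm (g t) powr ?p) \<in> borel_measurable ?M" using meas by measurable
    have "(\<integral>\<^sup>+t. ennreal (norm (g t) powr ?p) \<partial>?M) < \<infinity>"
    proof (rule ccontr)
      assume "\<not> (\<integral>\<^sup>+t. ennreal (norm (g t) powr ?p) \<partial>?M) < \<infinity>"
      then have "(\<integral>\<^sup>+t. ennreal (norm (g t) powr ?p) \<partial>?M) = \<infinity>" by (metis less_top infinity_ennreal_def)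
      then show False using fin False by (simp add: Lp_norm_def ennreal_powr_def)
    qed
    then have "integrable ?M (\<lambda>t. norm (g t) powr ?p)"
      using pow by (intro integrableI_bounded) auto
    then have i: "integrable ?M (\<lambda>t. 1 + norm (g t) powr ?p)"
      by (intro Bochner_Integration.integrable_add finite_measure.integrable_const fm)
    show ?thesis
    proof (rule Bochner_Integration.integrable_bound[OF i meas])
      have "norm (g t) \<le> 1 + norm (g t) powr ?p" for t
      proof (cases "norm (g t) \<le> 1")
        case False
        then have "norm (g t) powr 1 \<le> norm (g t) powr ?p" using p1 by (intro powr_mono) auto
        then show ?thesis by simp
      qed (simp add: add_increasing2)
      then show "AE t in ?M. norm (norm (g t)) \<le> norm (1 + norm (g t) powr ?p)"
        by (intro AE_I2) (simp add: abs_of_nonneg)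
    qed
  qed
qed

text \<open>If short increments of f are bounded by an arbitrarily small multiple of those of one
  fixed G, telescoping over a fine partition bounds the total increment by that multiple of G b - G
  0. It replaces a product rule for curves that need not be differentiable.\<close>

lemma eq_of_small_increments:
  fixes f G :: "real \<Rightarrow> real"
  assumes inc: "\<And>e. 0 < e \<Longrightarrow> \<exists>\<delta>>0. \<forall>s t. 0 \<le> s \<and> s \<le> t \<and> t \<le> b \<and> t - s < \<delta> \<longrightarrow> \<bar>f t - f s\<bar> \<le> e * (G t - G s)"
    and b: "0 \<le> b"
  shows "f b = f 0"
proof (rule ccontr)
  assume "f b \<noteq> f 0"
  \<comment> \<open>Chosen so that the telescoped bound is at most half of |f b - f 0|; the summand
    1 keeps the denominator positive.\<close>
  define e where "e = \<bar>f b - f 0\<bar> / (2 * (1 + \<bar>G b - G 0\<bar>))"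
  have e: "0 < e" using \<open>f b \<noteq> f 0\<close> by (simp add: e_def add_pos_nonneg)
  obtain \<delta> where \<delta>: "0 < \<delta>"
      "\<And>s t. 0 \<le> s \<Longrightarrow> s \<le> t \<Longrightarrow> t \<le> b \<Longrightarrow> t - s < \<delta> \<Longrightarrow> \<bar>f t - f s\<bar> \<le> e * (G t - G s)"
    using inc[OF e] by blast
  obtain N :: nat where N: "b / \<delta> < real N" using reals_Archimedean2 by blast
  have N0: "0 < real N" using N b \<delta>(1) by (meson divide_nonneg_pos le_less_trans)
  define t where "t i = b * real i / real N" for i
  have step: "\<bar>f (t (Suc i)) - f (t i)\<bar> \<le> e * (G (t (Suc i)) - G (t i))" if "i < N" for i
  proof (rule \<delta>(2))
    show "0 \<le> t i" using b by (simp add: t_def)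
    show "t i \<le> t (Suc i)" unfolding t_def using b by (intro divide_right_mono mult_left_mono) auto
    have "b * real (Suc i) \<le> b * real N" using that b by (intro mult_left_mono) auto
    then show "t (Suc i) \<le> b" using N0 by (simp add: t_def field_simps)
    have "t (Suc i) - t i = b / real N" by (simp add: t_def distrib_left add_divide_distrib)
    also have "\<dots> < \<delta>" using N N0 \<delta>(1) by (simp add: field_simps)
    finally show "t (Suc i) - t i < \<delta>" .
  qed
  have t0: "t 0 = 0" "t N = b" using N0 by (simp_all add: t_def)
  have "\<bar>f b - f 0\<bar> = \<bar>\<Sum>i<N. f (t (Suc i)) - f (t i)\<bar>"
    unfolding sum_lessThan_telescope[of "\<lambda>i. f (t i)"] t0 ..
  also have "\<dots> \<le> (\<Sum>i<N. \<bar>f (t (Suc i)) - f (t i)\<bar>)" by (rule sum_abs)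
  also have "\<dots> \<le> (\<Sum>i<N. e * (G (t (Suc i)) - G (t i)))" by (intro sum_mono step) simp
  also have "\<dots> = e * (G b - G 0)" unfolding sum_distrib_left[symmetric] sum_lessThan_telescope[of "\<lambda>i. G (t i)"] t0 ..
  also have "\<dots> \<le> e * (1 + \<bar>G b - G 0\<bar>)" using e by (intro mult_left_mono) auto
  also have "\<dots> = \<bar>f b - f 0\<bar> / 2"
  proof -
    have "0 < 1 + \<bar>G b - G 0\<bar>" by (simp add: add_pos_nonneg)
    moreover have "x / (2 * y) * y = x / 2" if "0 < y" for x y :: real using that by simp
    ultimately show ?thesis unfolding e_def by blast
  qed
  finally show False using \<open>f b \<noteq> f 0\<close> by simp
qed


section \<open>Failure of maximal regularity\<close>

text \<open>The forcing for which t u(t) satisfies the equation in V'. Starting from 0 avoids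
  deciding whether u(0) belongs to the interpolation space, and the zero vector is admissible for
  every p.\<close>

definition forcing :: "real \<Rightarrow> real \<Rightarrow> H_space" where
  "forcing d t = V_to_H ((1 + t) *\<^sub>R u_ex d t)"

text \<open>Represents the derivative of t u(t) in V'.\<close>

definition ramp_rate :: "real \<Rightarrow> real \<Rightarrow> V_space" where
  "ramp_rate d t = dual_path d t + t *\<^sub>R velocity t"

lemma V_to_H_scaleR: "V_to_H (r *\<^sub>R v) = r *\<^sub>R V_to_H v"
  by (simp add: scaleR_scaleC V_to_H_scaleC)

lemma V_to_H_diff: "V_to_H (v - w) = V_to_H v - V_to_H w"
  using V_to_H_add[of "v - w" w] by (simp add: algebra_simps)

lemma cinner_V_to_H_u_ex: "cinner (V_to_H (u_ex d t)) (V_to_H z) = cinner (dual_path d t) z"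
  using arg_cong[OF emb_dual_u_ex[of d t], of "\<lambda>f. blinfun_apply f z"] by simp

lemma continuous_on_V_to_H: "continuous_on S g \<Longrightarrow> continuous_on S (\<lambda>t. V_to_H (g t))"
  by (rule bounded_linear.continuous_on[OF bounded_linear_V_to_H])

lemma in_Lp_forcing: "in_Lp p T (forcing d)"
  unfolding forcing_def[abs_def]
  by (intro in_Lp_continuous_on continuous_on_V_to_H continuous_intros continuous_on_paths)

lemma ramp_has_integral:
  assumes "s \<le> t"
  shows "((\<lambda>r. inner (ramp_rate d r) \<eta>) has_integral
     inner (V_to_H (t *\<^sub>R u_ex d t)) (V_to_H \<eta>) - inner (V_to_H (s *\<^sub>R u_ex d s)) (V_to_H \<eta>)) {s..t}"
proof -
  have eq: "inner (V_to_H (r *\<^sub>R u_ex d r)) (V_to_H \<eta>) = inner (r *\<^sub>R dual_path d r) \<eta>" for r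
    unfolding inner_eq_Re_cinner V_to_H_scaleR cinner_scaleR_left cinner_V_to_H_u_ex ..
  have "((\<lambda>r. inner (r *\<^sub>R dual_path d r) \<eta>) has_vector_derivative inner (ramp_rate d r) \<eta>) (at r within {s..t})" for r
  proof (rule bounded_linear.has_vector_derivative[OF bounded_linear_inner_left])
    have "((\<lambda>r. r *\<^sub>R dual_path d r) has_vector_derivative r *\<^sub>R velocity r + 1 *\<^sub>R dual_path d r) (at r within {s..t})"
      by (rule has_vector_derivative_scaleR[OF DERIV_ident has_vector_derivative_dual_path])
    then show "((\<lambda>r. r *\<^sub>R dual_path d r) has_vector_derivative ramp_rate d r) (at r within {s..t})"
      by (simp add: ramp_rate_def add.commute)
  qed
  then show ?thesis unfolding eq by (intro fundamental_theorem_of_calculus assms) auto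
qed

lemma continuous_on_ramp_rate: "continuous_on S (ramp_rate d)"
  unfolding ramp_rate_def[abs_def] by (intro continuous_intros continuous_on_paths)

lemma V_to_H_0 [simp]: "V_to_H 0 = 0"
  using V_to_H_scaleR[of 0 0] by simp

lemma part_rel_unique:
  assumes "part_rel V_to_H a t x y" "part_rel V_to_H a t x y'" shows "y = y'"
proof -
  obtain v where v: "x = V_to_H v" "form_op a t v = emb_dual V_to_H y"
    using assms(1) unfolding part_rel_def by blast
  obtain v' where v': "x = V_to_H v'" "form_op a t v' = emb_dual V_to_H y'"
    using assms(2) unfolding part_rel_def by blast
  have "v = v'" using injD[OF inj_V_to_H] v(1) v'(1) by simp
  then show ?thesis using v(2) v'(2) by (simp add: inj_emb_dual)
qed

lemma part_rel_part_op:
  assumes "x \<in> part_dom V_to_H a t" shows "part_rel V_to_H a t x (part_op V_to_H a t x)"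
proof -
  obtain y where y: "part_rel V_to_H a t x y" using assms unfolding part_dom_def by blast
  show ?thesis unfolding part_op_def by (rule theI[where P="part_rel V_to_H a t x", OF y]) (rule part_rel_unique[OF _ y])
qed

section \<open>Comparison of an arbitrary solution with t u(t)\<close>

context
  fixes T d :: real and p :: ennreal and w w' :: "real \<Rightarrow> H_space"
  assumes T: "0 < T" and d: "3 \<le> d" "8 * mass / dual_mass \<le> d - 1" and p: "1 \<le> p"
    and sol: "Lp_solution p T V_to_H (ex_form d) (forcing d) 0 w w'"
begin

definition error :: "real \<Rightarrow> H_space" where "error r = w r - V_to_H (r *\<^sub>R u_ex d r)"

text \<open>The time derivative of the error, tested against V. One part of it is a vector of H and
  the other a functional in V', so they are combined only after pairing with a test vector.\<close>

definition residual :: "real \<Rightarrow> V_space \<Rightarrow> real" where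
  "residual r \<eta> = inner (w' r) (V_to_H \<eta>) - inner (ramp_rate d r) \<eta>"

lemma residual_linear:
  "residual r (\<eta> + \<theta>) = residual r \<eta> + residual r \<theta>"
  "residual r (\<eta> - \<theta>) = residual r \<eta> - residual r \<theta>"
  "residual r (c *\<^sub>R \<eta>) = c * residual r \<eta>"
  by (simp_all add: residual_def V_to_H_add V_to_H_diff V_to_H_scaleR algebra_simps)

text \<open>Subtracting the equations of w and of t u(t) leaves the homogeneous equation for the
  error, in V' and at almost every time. The V-norm of the representative \<zeta> need not be
  integrable in time a priori.\<close>

lemma AE_error:
  "AE r in lebesgue_on {0..T}. \<exists>\<zeta>. error r = V_to_H \<zeta> \<and> (\<forall>\<eta>. residual r \<eta> = - Re (ex_form d r \<zeta> \<eta>))"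
proof -
  have "AE r in lebesgue_on {0..T}. w r \<in> part_dom V_to_H (ex_form d) r"
    and "AE r in lebesgue_on {0..T}. w' r + part_op V_to_H (ex_form d) r (w r) = forcing d r"
    using sol by (auto simp: Lp_solution_def)
  then show ?thesis
  proof eventually_elim
    case (elim r)
    let ?y = "part_op V_to_H (ex_form d) r (w r)"
    obtain v where v: "w r = V_to_H v" "form_op (ex_form d) r v = emb_dual V_to_H ?y"
      using part_rel_part_op[OF elim(1)] by (auto simp: part_rel_def)
    have y: "?y = forcing d r - w' r" using elim(2) by (simp add: algebra_simps)
    let ?\<zeta> = "v - r *\<^sub>R u_ex d r"
    have "residual r \<eta> = - Re (ex_form d r ?\<zeta> \<eta>)" for \<eta>
    proof -
      have "blinfun_apply (form_op (ex_form d) r ?\<zeta>) \<eta> =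
          blinfun_apply (emb_dual V_to_H ?y) \<eta> - complex_of_real r * blinfun_apply (riesz (dual_path d r - velocity r)) \<eta>"
        unfolding v(2)[symmetric] form_op_ex_form_u_ex[OF d, symmetric]
        by (simp add: blinfun.bilinear_simps scaleR_conv_of_real)
      then have "ex_form d r ?\<zeta> \<eta> = cinner ?y (V_to_H \<eta>) - complex_of_real r * cinner (dual_path d r - velocity r) \<eta>"
        by (simp add: form_op_ex_form_apply[OF d])
      also have "cinner ?y (V_to_H \<eta>) = (1 + complex_of_real r) * cinner (dual_path d r) \<eta> - cinner (w' r) (V_to_H \<eta>)"
        unfolding y cinner_diff_left forcing_def V_to_H_scaleR cinner_scaleR_left cinner_V_to_H_u_ex
        by simp
      finally have E: "ex_form d r ?\<zeta> \<eta> = (1 + complex_of_real r) * cinner (dual_path d r) \<eta> -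
          cinner (w' r) (V_to_H \<eta>) - complex_of_real r * cinner (dual_path d r - velocity r) \<eta>" .
      show ?thesis
        unfolding E residual_def ramp_rate_def inner_eq_Re_cinner cinner_add_left cinner_diff_left cinner_scaleR_left
        by (simp add: algebra_simps)
    qed
    then show ?case using v(1) by (intro exI[of _ ?\<zeta>]) (simp add: error_def V_to_H_diff)
  qed
qed

lemma w_has_integral: "t \<in> {0..T} \<Longrightarrow> (w' has_integral (w t - w 0)) {0..t}"
  and in_Lp_w': "in_Lp p T w'" and w_0: "w 0 = 0"
  using sol by (auto simp: Lp_solution_def sobolev_deriv_def)

lemma inner_w_has_integral:
  assumes "0 \<le> s" "s \<le> t" "t \<le> T"
  shows "((\<lambda>r. inner (w' r) \<xi>) has_integral inner (w t - w s) \<xi>) {s..t}"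
proof -
  let ?f = "\<lambda>r. inner (w' r) \<xi>"
  have *: "(?f has_integral inner (w r - w 0) \<xi>) {0..r}" if "r \<in> {0..T}" for r
    using has_integral_linear[OF w_has_integral[OF that] bounded_linear_inner_left[of \<xi>]] by (simp add: o_def)
  have t: "?f integrable_on {0..t}" using *[of t] assms by auto
  then have st: "?f integrable_on {s..t}" by (rule integrable_on_subinterval) (use assms in auto)
  have "integral {0..s} ?f + integral {s..t} ?f = integral {0..t} ?f"
    using assms t by (intro Henstock_Kurzweil_Integration.integral_combine) auto
  then have "integral {s..t} ?f = inner (w t - w s) \<xi>"
    using *[of s] *[of t] assms by (simp add: integral_unique inner_diff_left)
  then show ?thesis using integrable_integral[OF st] by simp
qed

lemma residual_has_integral:
  assumes "0 \<le> s" "s \<le> t" "t \<le> T"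
  shows "((\<lambda>r. residual r \<eta>) has_integral inner (error t - error s) (V_to_H \<eta>)) {s..t}"
  using has_integral_diff[OF inner_w_has_integral[OF assms, of "V_to_H \<eta>"] ramp_has_integral[OF assms(2), of d \<eta>]]
  by (simp add: residual_def[abs_def] error_def inner_diff_left algebra_simps)

lemma integrable_norm_w': "integrable (lebesgue_on {0..T}) (\<lambda>r. norm (w' r))"
  by (rule integrable_norm_in_Lp[OF in_Lp_w' p])

lemma norm_w'_integrable_on:
  assumes "0 \<le> s" "t \<le> T" shows "(\<lambda>r. norm (w' r)) integrable_on {s..t}"
proof (rule integrable_on_subinterval)
  show "(\<lambda>r. norm (w' r)) integrable_on {0..T}"
    by (rule integrable_on_lebesgue_on[OF integrable_norm_w']) simp
qed (use assms in auto)

lemma norm_w_diff_le: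
  assumes "0 \<le> s" "s \<le> t" "t \<le> T"
  shows "norm (w t - w s) \<le> integral {s..t} (\<lambda>r. norm (w' r))"
proof -
  \<comment> \<open>The increment is tested with itself and one factor is cancelled, so that only
    scalar integrals occur.\<close>
  let ?x = "w t - w s"
  note i = inner_w_has_integral[OF assms, of ?x]
  have "inner ?x ?x \<le> integral {s..t} (\<lambda>r. norm (w' r) * norm ?x)"
    unfolding integral_unique[OF i, symmetric]
    using i norm_w'_integrable_on[of s t] assms
    by (intro integral_le norm_cauchy_schwarz) (auto intro: integrable_on_mult_left)
  then have "norm ?x * norm ?x \<le> integral {s..t} (\<lambda>r. norm (w' r)) * norm ?x"
    by (simp add: power2_norm_eq_inner[symmetric] power2_eq_square)
  then show ?thesis
    by (cases "norm ?x = 0") (auto intro!: integral_nonneg norm_w'_integrable_on assms)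
qed

lemma continuous_on_error: "continuous_on {0..T} error"
proof -
  let ?I = "\<lambda>t. integral {0..t} (\<lambda>r. norm (w' r))"
  have I: "continuous_on {0..T} ?I"
    by (rule indefinite_integral_continuous_1[OF norm_w'_integrable_on]) auto
  have le: "dist (w t) (w s) \<le> dist (?I t) (?I s)" if "s \<in> {0..T}" "t \<in> {0..T}" for s t
  proof -
    have *: "dist (w t) (w s) \<le> dist (?I t) (?I s)" if "0 \<le> s" "s \<le> t" "t \<le> T" for s t
    proof -
      have "?I s + integral {s..t} (\<lambda>r. norm (w' r)) = ?I t"
        using that by (intro Henstock_Kurzweil_Integration.integral_combine norm_w'_integrable_on) auto
      then show ?thesis using norm_w_diff_le[OF that] by (simp add: dist_norm)
    qed
    show ?thesis using *[of s t] *[of t s] that by (cases "s \<le> t") (auto simp: dist_commute)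
  qed
  have "continuous_on {0..T} w"
    unfolding continuous_on_iff
  proof (intro ballI allI impI)
    fix x e :: real assume "x \<in> {0..T}" "0 < e"
    then obtain \<delta> where \<delta>: "0 < \<delta>" "\<And>y. y \<in> {0..T} \<Longrightarrow> dist y x < \<delta> \<Longrightarrow> dist (?I y) (?I x) < e"
      using I unfolding continuous_on_iff by blast
    have "dist (w y) (w x) < e" if "y \<in> {0..T}" "dist y x < \<delta>" for y
      by (rule le_less_trans[OF le[OF \<open>x \<in> {0..T}\<close> that(1)] \<delta>(2)[OF that]])
    then show "\<exists>\<delta>>0. \<forall>y\<in>{0..T}. dist y x < \<delta> \<longrightarrow> dist (w y) (w x) < e"
      using \<delta>(1) by blast
  qed
  then show ?thesis unfolding error_def[abs_def]
    by (intro continuous_on_diff continuous_on_V_to_H continuous_intros continuous_on_paths)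
qed

lemma bounds_exist:
  "\<exists>Q Z. 0 \<le> Q \<and> 0 \<le> Z \<and> (\<forall>r\<in>{0..T}. norm (ramp_rate d r) \<le> Q) \<and> (\<forall>r\<in>{0..T}. norm (error r) \<le> Z)"
proof -
  have "bounded (ramp_rate d ` {0..T})" "bounded (error ` {0..T})"
    by (intro compact_imp_bounded compact_continuous_image continuous_on_ramp_rate continuous_on_error; simp)+
  then obtain Q Z where QZ: "\<forall>r\<in>{0..T}. norm (ramp_rate d r) \<le> Q" "\<forall>r\<in>{0..T}. norm (error r) \<le> Z"
    unfolding bounded_iff by auto
  have "0 \<in> {0..T}" using T by simp
  then have "0 \<le> Q" "0 \<le> Z" using QZ by (meson norm_ge_zero order.trans)+
  with QZ show ?thesis by blast
qed

section \<open>Energy estimate for the truncated error\<close>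

context
  fixes Q Z :: real
  assumes Q: "0 \<le> Q" "\<forall>r\<in>{0..T}. norm (ramp_rate d r) \<le> Q"
    and Z: "0 \<le> Z" "\<forall>r\<in>{0..T}. norm (error r) \<le> Z"
begin

text \<open>The derivative w' is paired through the H-norm of the test vector and the ramp through
  its V-norm. Keeping them apart matters for the majorant: the error is bounded in H, but not known
  to be bounded in V.\<close>

lemma abs_residual_le:
  assumes "r \<in> {0..T}"
  shows "\<bar>residual r \<eta>\<bar> \<le> norm (w' r) * norm (V_to_H \<eta>) + Q * norm \<eta>"
proof -
  have "\<bar>inner (ramp_rate d r) \<eta>\<bar> \<le> Q * norm \<eta>"
    using Q assms by (intro order.trans[OF Cauchy_Schwarz_ineq2] mult_right_mono) auto
  then show ?thesis unfolding residual_def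
    using Cauchy_Schwarz_ineq2[of "w' r" "V_to_H \<eta>"] by linarith
qed

lemma abs_residual_le': "r \<in> {0..T} \<Longrightarrow> \<bar>residual r \<eta>\<bar> \<le> (norm (w' r) + Q) * norm \<eta>"
  using abs_residual_le[of r \<eta>] mult_left_mono[OF norm_V_to_H_le[of \<eta>], of "norm (w' r)"]
  by (simp add: distrib_right)

text \<open>Half the formal time derivative of the energy of the truncated error in H.\<close>

definition flux :: "nat \<Rightarrow> real \<Rightarrow> real" where
  "flux n r = residual r (truncate n (error r))"

lemma continuous_on_truncate_error: "continuous_on {0..T} (\<lambda>r. truncate n (error r))"
  by (rule bounded_linear.continuous_on[OF bounded_linear_truncate continuous_on_error])

lemma borel_measurable_flux: "flux n \<in> borel_measurable (lebesgue_on {0..T})"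
  unfolding flux_def[abs_def] residual_def
proof (rule borel_measurable_diff)
  show "(\<lambda>r. inner (w' r) (V_to_H (truncate n (error r)))) \<in> borel_measurable (lebesgue_on {0..T})"
    using in_Lp_w' by (intro borel_measurable_inner_bochner continuous_on_V_to_H continuous_on_truncate_error)
      (simp add: in_Lp_def)
  show "(\<lambda>r. inner (ramp_rate d r) (truncate n (error r))) \<in> borel_measurable (lebesgue_on {0..T})"
    by (intro continuous_imp_measurable_on_sets_lebesgue continuous_on_inner continuous_on_ramp_rate
        continuous_on_truncate_error) simp
qed

lemma integrable_flux: "integrable (lebesgue_on {0..T}) (flux n)"
proof (rule Bochner_Integration.integrable_bound[OF _ borel_measurable_flux])
  let ?c = "Z * sqrt (real n)"
  show "integrable (lebesgue_on {0..T}) (\<lambda>r. (norm (w' r) + Q) * ?c)"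
    by (intro Bochner_Integration.integrable_mult_left Bochner_Integration.integrable_add integrable_norm_w'
        finite_measure.integrable_const finite_measure_lebesgue_on) simp
  show "AE r in lebesgue_on {0..T}. norm (flux n r) \<le> norm ((norm (w' r) + Q) * ?c)"
  proof (rule AE_I2)
    fix r assume "r \<in> space (lebesgue_on {0..T})"
    then have r: "r \<in> {0..T}" by simp
    have "\<bar>flux n r\<bar> \<le> (norm (w' r) + Q) * norm (truncate n (error r))"
      unfolding flux_def by (rule abs_residual_le'[OF r])
    also have "\<dots> \<le> (norm (w' r) + Q) * ?c"
      using Z Q r by (intro mult_left_mono order.trans[OF norm_truncate_le] mult_right_mono) auto
    finally show "norm (flux n r) \<le> norm ((norm (w' r) + Q) * ?c)" by simp
  qed
qed

lemma flux_integrable_on: "0 \<le> s \<Longrightarrow> t \<le> T \<Longrightarrow> flux n integrable_on {s..t}"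
  by (rule integrable_on_subinterval[OF integrable_on_lebesgue_on[OF integrable_flux]]) auto

text \<open>A discrete product rule. By symmetry of the truncation, the energy increment from s to t
  is error t - error s paired with the truncation of error t + error s, hence an integral of
  residuals. Replacing the sum by twice the error at the integration variable costs little by
  uniform continuity, and the small increments add up to nothing.\<close>

lemma energy_identity:
  assumes b: "b \<in> {0..T}"
  shows "inner (error b) (V_to_H (truncate n (error b))) = 2 * integral {0..b} (flux n)"
proof -
  let ?E = "\<lambda>t. inner (error t) (V_to_H (truncate n (error t)))"
  let ?f = "\<lambda>t. ?E t - 2 * integral {0..t} (flux n)"
  let ?g = "\<lambda>r. norm (w' r) + Q"
  let ?G = "\<lambda>t. integral {0..t} ?g"
  have g: "?g integrable_on {s..t}" if "0 \<le> s" "t \<le> T" for s t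
    using norm_w'_integrable_on[OF that] by (intro integrable_add) auto
  have sym: "inner x (V_to_H (truncate n y)) = inner y (V_to_H (truncate n x))" for x y
    unfolding inner_eq_Re_cinner
    by (metis cinner_truncate cinner_commute cnj.simps(1))
  note lin = bounded_linear.linear[OF bounded_linear_truncate[of n]]
  have "?f b = ?f 0"
  proof (rule eq_of_small_increments[where f="?f" and G="?G"])
    fix e :: real assume e: "0 < e"
    \<comment> \<open>Two differences of the error, each below e', pass through a truncation of norm
      at most \<open>sqrt (real n)\<close>; the extra 1 keeps the quotient meaningful for n =
      0.\<close>
    define e' where "e' = e / (2 * (sqrt (real n) + 1))"
    have s1: "0 < sqrt (real n) + 1" by (simp add: add_nonneg_pos)
    have e': "0 < e'" using e s1 by (simp add: e'_def)
    have "2 * (x / (2 * y)) * y = x" if "0 < y" for x y :: real using that by simp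
    from this[OF s1] have "2 * e' * (sqrt (real n) + 1) = e" unfolding e'_def .
    then have e'e: "2 * e' * sqrt (real n) \<le> e" using e' by (simp add: algebra_simps)
    have "uniformly_continuous_on {0..T} error"
      by (rule compact_uniformly_continuous[OF continuous_on_error]) simp
    then obtain \<delta> where \<delta>: "0 < \<delta>"
        "\<And>x y. x \<in> {0..T} \<Longrightarrow> y \<in> {0..T} \<Longrightarrow> dist x y < \<delta> \<Longrightarrow> dist (error x) (error y) < e'"
      using e' unfolding uniformly_continuous_on_def by metis
    have "\<bar>?f t - ?f s\<bar> \<le> e * (?G t - ?G s)" if st: "0 \<le> s" "s \<le> t" "t \<le> b" "t - s < \<delta>" for s t
    proof -
      have tT: "t \<le> T" using st b by simp
      let ?\<eta> = "truncate n (error t + error s)"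
      have 1: "((\<lambda>r. residual r ?\<eta>) has_integral inner (error t - error s) (V_to_H ?\<eta>)) {s..t}"
        by (rule residual_has_integral[OF st(1,2) tT])
      \<comment> \<open>The mixed terms cancel because the truncated pairing is symmetric.\<close>
      have E: "inner (error t - error s) (V_to_H ?\<eta>) = ?E t - ?E s"
        using sym[of "error s" "error t"]
        by (simp add: linear_add[OF lin] V_to_H_add inner_diff_left inner_add_right)
      have fl: "flux n integrable_on {s..t}" by (rule flux_integrable_on[OF st(1) tT])
      have F: "integral {0..s} (flux n) + integral {s..t} (flux n) = integral {0..t} (flux n)"
        using st tT by (intro Henstock_Kurzweil_Integration.integral_combine flux_integrable_on) auto
      have "((\<lambda>r. residual r ?\<eta> - 2 * flux n r) has_integral (?E t - ?E s) - 2 * integral {s..t} (flux n)) {s..t}"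
        using 1 fl unfolding E by (intro has_integral_diff has_integral_mult_right) auto
      moreover have "(?E t - ?E s) - 2 * integral {s..t} (flux n) = ?f t - ?f s" using F by linarith
      ultimately have 2: "((\<lambda>r. residual r ?\<eta> - 2 * flux n r) has_integral ?f t - ?f s) {s..t}"
        by (simp only:)
      have 3: "norm (residual r ?\<eta> - 2 * flux n r) \<le> e * ?g r" if r: "r \<in> {s..t}" for r
      proof -
        have rT: "r \<in> {0..T}" "s \<in> {0..T}" "t \<in> {0..T}" using r st tT by auto
        let ?x = "(error t - error r) + (error s - error r)"
        have "residual r ?\<eta> - 2 * flux n r = residual r (?\<eta> - 2 *\<^sub>R truncate n (error r))"
          by (simp add: residual_linear flux_def)
        also have "?\<eta> - 2 *\<^sub>R truncate n (error r) = truncate n ?x"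
          unfolding linear_add[OF lin] linear_diff[OF lin] scaleR_2 by (simp add: algebra_simps)
        also have "\<bar>residual r (truncate n ?x)\<bar> \<le> ?g r * norm (truncate n ?x)"
          by (rule abs_residual_le'[OF rT(1)])
        also have "\<dots> \<le> ?g r * e"
        proof (rule mult_left_mono)
          have "dist (error t) (error r) < e'" "dist (error s) (error r) < e'"
            using r st rT by (auto intro!: \<delta>(2) simp: dist_real_def)
          then have "norm ?x \<le> 2 * e'"
            by (intro order.trans[OF norm_triangle_ineq]) (simp add: dist_norm)
          then have "norm (truncate n ?x) \<le> 2 * e' * sqrt (real n)"
            by (intro order.trans[OF norm_truncate_le] mult_right_mono) auto
          then show "norm (truncate n ?x) \<le> e" using e'e by linarith
        qed (use Q in auto)
        finally show ?thesis by (simp add: mult.commute)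
      qed
      have "norm (integral {s..t} (\<lambda>r. residual r ?\<eta> - 2 * flux n r)) \<le> integral {s..t} (\<lambda>r. e * ?g r)"
        using 2 3 g[OF st(1) tT]
        by (intro integral_norm_bound_integral integrable_on_mult_right) auto
      also have "integral {s..t} (\<lambda>r. e * ?g r) = e * integral {s..t} ?g" by simp
      also have "integral {s..t} ?g = ?G t - ?G s"
        using Henstock_Kurzweil_Integration.integral_combine[OF st(1,2) g[OF order.refl tT]] by linarith
      finally show ?thesis unfolding integral_unique[OF 2] by simp
    qed
    then show "\<exists>\<delta>>0. \<forall>s t. 0 \<le> s \<and> s \<le> t \<and> t \<le> b \<and> t - s < \<delta> \<longrightarrow> \<bar>?f t - ?f s\<bar> \<le> e * (?G t - ?G s)"
      using \<delta>(1) by blast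
  qed (use b in simp)
  moreover have "?f 0 = 0" by (simp add: error_def w_0 V_to_H_scaleR)
  ultimately show ?thesis by simp
qed

text \<open>Along the truncations the flux converges to the residual at \<zeta>, which is -Re
  a(\<zeta>,\<zeta>) <= 0, so its positive part vanishes in the limit. The majorant is free of
  \<zeta>: coercivity bounds k ||\<zeta>||^2 by the data and Q ||\<zeta>||, and the latter is
  absorbed.\<close>

lemma AE_flux:
  "AE r in lebesgue_on {0..T}. (\<lambda>n. max (flux n r) 0) \<longlonglongrightarrow> 0 \<and>
     (\<forall>n. \<bar>flux n r\<bar> \<le> 2 * (Z * norm (w' r)) + Q\<^sup>2 / coercivity)"
proof -
  have "AE r in lebesgue_on {0..T}. r \<in> {0..T}" using AE_space[of "lebesgue_on {0..T}"] by simp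
  with AE_error show ?thesis
  proof eventually_elim
    case (elim r)
    then obtain \<zeta> where \<zeta>: "error r = V_to_H \<zeta>" "\<And>\<eta>. residual r \<eta> = - Re (ex_form d r \<zeta> \<eta>)" by blast
    have Zr: "norm (error r) \<le> Z" using Z elim by blast
    let ?k = coercivity and ?N = "norm (w' r)"
    note k = coercivity_pos
    have "?k * (norm \<zeta>)\<^sup>2 \<le> \<bar>residual r \<zeta>\<bar>"
      using Re_ex_form_ge[OF d, of \<zeta> r] \<zeta>(2)[of \<zeta>] by linarith
    also have "\<dots> \<le> ?N * norm (V_to_H \<zeta>) + Q * norm \<zeta>" by (rule abs_residual_le[OF elim(2)])
    also have "?N * norm (V_to_H \<zeta>) \<le> ?N * Z" using Zr by (intro mult_left_mono) (auto simp: \<zeta>(1))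
    finally have c1: "?k * (norm \<zeta>)\<^sup>2 \<le> ?N * Z + Q * norm \<zeta>" by simp
    \<comment> \<open>Young's inequality as a completed square: 2 Q ||\<zeta>|| <= Q^2/k + k
      ||\<zeta>||^2, into which the coercive bound is inserted.\<close>
    have "0 \<le> (Q - ?k * norm \<zeta>)\<^sup>2 / ?k" using k by simp
    also have "\<dots> = Q\<^sup>2 / ?k - 2 * (Q * norm \<zeta>) + ?k * (norm \<zeta>)\<^sup>2"
      using k by (simp add: power2_eq_square field_simps)
    finally have Qz: "Q * norm \<zeta> \<le> Z * ?N + Q\<^sup>2 / ?k" using c1 by (simp add: mult.commute)
    have bound: "\<bar>flux n r\<bar> \<le> 2 * (Z * ?N) + Q\<^sup>2 / ?k" for n
    proof -
      have "\<bar>flux n r\<bar> \<le> ?N * norm (V_to_H (truncate n (error r))) + Q * norm (truncate n (error r))"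
        unfolding flux_def by (rule abs_residual_le[OF elim(2)])
      also have "\<dots> \<le> ?N * Z + Q * norm \<zeta>"
        using Zr Q norm_truncate_V_to_H_le[of n \<zeta>]
        by (intro add_mono mult_left_mono order.trans[OF norm_V_to_H_truncate_le]) (auto simp: \<zeta>(1))
      finally show ?thesis using Qz by (simp add: mult.commute)
    qed
    have "(\<lambda>n. flux n r) \<longlonglongrightarrow> residual r \<zeta>"
      unfolding flux_def \<zeta>(1) residual_def
      by (intro tendsto_intros bounded_linear.tendsto[OF bounded_linear_V_to_H] truncate_V_to_H_tendsto)
    then have "(\<lambda>n. max (flux n r) 0) \<longlonglongrightarrow> max (residual r \<zeta>) 0" by (intro tendsto_max tendsto_const)
    moreover have "0 \<le> ?k * (norm \<zeta>)\<^sup>2" using k by simp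
    then have "residual r \<zeta> \<le> 0" using Re_ex_form_ge[OF d, of \<zeta> r] \<zeta>(2)[of \<zeta>] by linarith
    ultimately show ?case using bound by (simp add: max_def)
  qed
qed

text \<open>Only an upper bound of the energy is required, so the flux is replaced by its positive
  part; this also allows the integral to be enlarged to [0,T]. Dominated convergence then makes the
  energy at b at most 0.\<close>

lemma error_eq_0_aux:
  assumes b: "b \<in> {0..T}" shows "error b = 0"
proof -
  let ?M = "lebesgue_on {0..T}"
  let ?m = "\<lambda>n r. max (flux n r) 0"
  have meas: "?m n \<in> borel_measurable ?M" for n using borel_measurable_flux by measurable
  have D: "integrable ?M (\<lambda>r. 2 * (Z * norm (w' r)) + Q\<^sup>2 / coercivity)"
    by (intro Bochner_Integration.integrable_add integrable_mult_right integrable_norm_w'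
        finite_measure.integrable_const finite_measure_lebesgue_on) simp
  have "(\<lambda>n. integral\<^sup>L ?M (?m n)) \<longlonglongrightarrow> integral\<^sup>L ?M (\<lambda>_. 0)"
  proof (rule integral_dominated_convergence[OF _ meas D])
    show "AE r in ?M. (\<lambda>n. ?m n r) \<longlonglongrightarrow> 0" using AE_flux by eventually_elim simp
    show "AE r in ?M. norm (?m n r) \<le> 2 * (Z * norm (w' r)) + Q\<^sup>2 / coercivity" for n
      using AE_flux
    proof eventually_elim
      case (elim r)
      then have "\<bar>flux n r\<bar> \<le> 2 * (Z * norm (w' r)) + Q\<^sup>2 / coercivity" by blast
      moreover have "norm (?m n r) \<le> \<bar>flux n r\<bar>" by (simp add: max_def)
      ultimately show ?case by linarith
    qed
  qed simp
  then have lim0: "(\<lambda>n. 2 * integral\<^sup>L ?M (?m n)) \<longlonglongrightarrow> 0" using tendsto_mult_right_zero by fastforce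
  have "(\<lambda>n. inner (error b) (V_to_H (truncate n (error b)))) \<longlonglongrightarrow> inner (error b) (error b)"
    by (intro tendsto_intros V_to_H_truncate_tendsto)
  moreover have "inner (error b) (V_to_H (truncate n (error b))) \<le> 2 * integral\<^sup>L ?M (?m n)" for n
  proof -
    have m: "integrable ?M (?m n)" using integrable_flux by (intro Bochner_Integration.integrable_max) auto
    have mH: "?m n integrable_on {0..T}" by (rule integrable_on_lebesgue_on[OF m]) simp
    then have mb: "?m n integrable_on {0..b}" by (rule integrable_on_subinterval) (use b in auto)
    have "integral {0..b} (flux n) \<le> integral {0..b} (?m n)"
      using b mb by (intro integral_le flux_integrable_on) auto
    also have "\<dots> \<le> integral {0..T} (?m n)" using b mb mH by (intro integral_subset_le) auto
    also have "\<dots> = integral\<^sup>L ?M (?m n)" by (rule lebesgue_integral_eq_integral[OF m, symmetric]) simp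
    finally show ?thesis unfolding energy_identity[OF b] by simp
  qed
  ultimately have "inner (error b) (error b) \<le> 0" by (intro LIMSEQ_le[OF _ lim0]) auto
  then show ?thesis by (metis inner_eq_zero_iff inner_ge_zero order.antisym)
qed

end

lemma error_eq_0: "b \<in> {0..T} \<Longrightarrow> w b = V_to_H (b *\<^sub>R u_ex d b)"
  using bounds_exist error_eq_0_aux unfolding error_def by (metis eq_iff_diff_eq_0)

text \<open>Since w(t) = t u(t), membership in D(A(t)) at some t > 0 puts t A(t) u(t) in H. As u(t)
  lies in H as well, the derivative of u would belong to H. At t = 0 no contradiction could arise,
  so the time is picked in (0,T].\<close>

lemma no_solution: False
proof -
  let ?P = "\<lambda>t. w t \<in> part_dom V_to_H (ex_form d) t"
  have "AE t in lebesgue_on {0..T}. ?P t" using sol by (simp add: Lp_solution_def)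
  then obtain N where N: "{t\<in>space (lebesgue_on {0..T}). \<not> ?P t} \<subseteq> N" "emeasure (lebesgue_on {0..T}) N = 0"
      "N \<in> sets (lebesgue_on {0..T})" by (rule AE_E)
  have "\<exists>t\<in>{0<..T}. ?P t"
  proof (rule ccontr)
    assume "\<not> ?thesis"
    then have "{0<..T} \<subseteq> N" using N(1) by auto
    then have "emeasure (lebesgue_on {0..T}) {0<..T} \<le> emeasure (lebesgue_on {0..T}) N"
      using N(3) by (rule emeasure_mono)
    moreover have "emeasure (lebesgue_on {0..T}) {0<..T} = ennreal T"
      using T by (subst emeasure_restrict_space) auto
    ultimately show False using N(2) T by simp
  qed
  then obtain t where t: "0 < t" "t \<le> T" "?P t" by auto
  then obtain y v where v: "w t = V_to_H v" "form_op (ex_form d) t v = emb_dual V_to_H y"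
    by (auto simp: part_dom_def part_rel_def)
  have "v = t *\<^sub>R u_ex d t" using error_eq_0[of t] t v(1) inj_V_to_H by (auto dest: injD)
  then have y: "t *\<^sub>R riesz (dual_path d t - velocity t) = emb_dual V_to_H y"
    using v(2) form_op_ex_form_u_ex[OF d, of t] by (simp add: blinfun.scaleR_right)
  have "riesz (velocity t) = emb_dual V_to_H (V_to_H (u_ex d t) - (1 / t) *\<^sub>R y)"
  proof (rule blinfun_eqI)
    fix z
    have "complex_of_real t * cinner (dual_path d t - velocity t) z = cinner y (V_to_H z)"
      using arg_cong[OF y, of "\<lambda>f. blinfun_apply f z"] by (simp add: blinfun.scaleR_left scaleR_conv_of_real)
    then show "blinfun_apply (riesz (velocity t)) z =
        blinfun_apply (emb_dual V_to_H (V_to_H (u_ex d t) - (1 / t) *\<^sub>R y)) z"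
      using t(1) by (simp add: cinner_diff_left cinner_scaleR_left cinner_V_to_H_u_ex field_simps)
  qed
  then have "riesz (velocity t) \<in> range (emb_dual V_to_H)" by blast
  then show False using cos_not_in_range_emb_dual[of t] t(1) unfolding velocity_def by simp
qed

end

text \<open>The infimum in the K-functional is attained at 0, which lies in the domain of every part
  of the operator; this holds for finite and infinite p alike.\<close>

lemma initial_norm_0:
  assumes d: "3 \<le> d" "8 * mass / dual_mass \<le> d - 1"
  shows "initial_norm p V_to_H (ex_form d) 0 < \<infinity>"
proof -
  let ?a = "ex_form d"
  let ?D = "part_dom V_to_H ?a 0" and ?n = "\<lambda>x. norm x + norm (part_op V_to_H ?a 0 x)"
  have "emb_dual V_to_H 0 = 0" by (rule blinfun_eqI) (simp add: cinner_self[of 0, simplified] inner_eq_Re_cinner bounded_bilinear.zero_left[OF bounded_bilinear_cinner])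
  then have rel: "part_rel V_to_H ?a 0 0 0"
    unfolding part_rel_def by (intro exI[of _ 0]) (simp add: blinfun.zero_right)
  then have D0: "0 \<in> ?D" by (auto simp: part_dom_def)
  have po: "part_op V_to_H ?a 0 0 = 0" by (rule part_rel_unique[OF part_rel_part_op[OF D0] rel])
  have K: "K_functional ?D ?n s 0 = 0" if "0 < s" for s
  proof (rule antisym)
    have "(INF y\<in>?D. ?n y + s * norm (0 - y)) \<le> ?n 0 + s * norm (0 - 0 :: H_space)"
      using that by (intro cINF_lower D0 bdd_belowI2[where m=0]) auto
    then show "K_functional ?D ?n s 0 \<le> 0" by (simp add: K_functional_def po)
    show "0 \<le> K_functional ?D ?n s 0"
      unfolding K_functional_def using that D0 by (intro cINF_greatest) auto
  qed
  have "interp_norm ?D ?n \<theta> p 0 = 0" if "p \<noteq> \<infinity>" for \<theta>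
  proof -
    have "(\<integral>\<^sup>+s\<in>{0<..}. ennreal ((s powr (-\<theta>) * K_functional ?D ?n s 0) powr enn2real p / s) \<partial>lborel) =
        (\<integral>\<^sup>+s. 0 \<partial>(lborel :: real measure))"
      by (rule nn_integral_cong) (auto simp: K indicator_def)
    then show ?thesis using that by (simp add: interp_norm_def ennreal_powr_def)
  qed
  moreover have "interp_norm ?D ?n \<theta> \<infinity> 0 = 0" for \<theta>
  proof -
    have "(SUP s\<in>{0<..}. ennreal (s powr (-\<theta>) * K_functional ?D ?n s 0)) = (SUP s\<in>{0::real<..}. 0)"
      by (intro SUP_cong refl) (simp add: K)
    then show ?thesis by (simp add: interp_norm_def)
  qed
  ultimately show ?thesis unfolding initial_norm_def by (cases "p = \<infinity>") auto
qed

lemma not_maximal_Lp_regularity_ex_form: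
  assumes T: "0 < T" and d: "3 \<le> d" "8 * mass / dual_mass \<le> d - 1" and p: "1 \<le> p"
  shows "\<not> maximal_Lp_regularity p T V_to_H (ex_form d)"
proof
  assume "maximal_Lp_regularity p T V_to_H (ex_form d)"
  then obtain w w' where "Lp_solution p T V_to_H (ex_form d) (forcing d) 0 w w'"
    unfolding maximal_Lp_regularity_def using in_Lp_forcing initial_norm_0[OF d] by blast
  then show False by (rule no_solution[OF T d p])
qed

theorem mainTheorem5:
  fixes T :: real
  assumes T: "0 < T"
  shows "dense_embedding V_to_H \<and>
    (\<exists>d0>0. \<forall>d\<ge>d0.
       (\<forall>t\<in>{0..T}. sq_integrable (tag_measure TYPE(wgt_tag)) (u_fun d t)) \<and>
       (\<forall>t\<in>{0..T}. \<exists>y. ((\<lambda>s. emb_dual V_to_H (V_to_H (u_ex d s))) has_vector_derivative y)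
            (at t within {0..T}) \<and> y \<notin> range (emb_dual V_to_H)) \<and>
       in_Lp \<infinity> T (u_ex d) \<and>
       (\<exists>a :: V_space form.
          bounded_coercive_form T a \<and> symmetric_form T a \<and>
          integrated_solution T V_to_H a (\<lambda>t. emb_dual V_to_H (V_to_H (u_ex d t))) (u_ex d) \<and>
          (\<forall>\<alpha> q. 0 < \<alpha> \<and> \<alpha> < 1 \<and> 1 < q \<and> frac_sobolev \<alpha> q T (u_ex d) \<longrightarrow>
             frac_sobolev \<alpha> q T (form_op a)) \<and>
          (\<forall>q>2. frac_sobolev (1/2) q T (form_op a)) \<and>
          (\<forall>p\<ge>1. \<not> maximal_Lp_regularity p T V_to_H a)) \<and>
       (\<forall>q>2. frac_sobolev (1/2) q T (u_ex d)))"
proof (rule conjI[OF dense_embedding_V_to_H], intro exI conjI allI impI)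
  \<comment> \<open>The two lower bounds on d under which the denominator \<open>pairing d t\<close>
    of the form stays away from 0.\<close>
  let ?d0 = "max 3 (8 * mass / dual_mass + 1)"
  show "0 < ?d0" by (simp add: less_max_iff_disj)
  fix d :: real assume d0: "?d0 \<le> d"
  then have d: "3 \<le> d" "8 * mass / dual_mass \<le> d - 1" by auto
  obtain K where K: "0 \<le> K"
      "\<forall>t s. norm (form_op (ex_form d) t - form_op (ex_form d) s) \<le> K * osc t s"
    using form_op_ex_form_modulus[OF d] by blast
  show "\<forall>t\<in>{0..T}. sq_integrable (tag_measure TYPE(wgt_tag)) (u_fun d t)"
    using sq_integrable_amp_mult[OF profile_sin_add] unfolding wgt_tag[symmetric] u_fun_def[abs_def] by blast
  show "\<forall>t\<in>{0..T}. \<exists>y. ((\<lambda>s. emb_dual V_to_H (V_to_H (u_ex d s))) has_vector_derivative y)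
      (at t within {0..T}) \<and> y \<notin> range (emb_dual V_to_H)"
    using has_vector_derivative_emb_dual_u_ex cos_not_in_range_emb_dual unfolding velocity_def by fastforce
  show "in_Lp \<infinity> T (u_ex d)" by (intro in_Lp_continuous_on continuous_on_paths)
  show "bounded_coercive_form T (ex_form d)" by (rule bounded_coercive_ex_form[OF d])
  show "symmetric_form T (ex_form d)" by (rule symmetric_ex_form[OF d])
  show "integrated_solution T V_to_H (ex_form d) (\<lambda>t. emb_dual V_to_H (V_to_H (u_ex d t))) (u_ex d)"
    by (rule integrated_solution_u_ex[OF d])
  show "frac_sobolev \<alpha> q T (form_op (ex_form d))"
    if "0 < \<alpha> \<and> \<alpha> < 1 \<and> 1 < q \<and> frac_sobolev \<alpha> q T (u_ex d)" for \<alpha> q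
    by (rule frac_sobolev_transfer[OF T _ _ _ K(1), where d=d]) (use that K(2) in auto)
  show "frac_sobolev (1/2) q T (form_op (ex_form d))" if "2 < q" for q
    by (rule frac_sobolev_half[OF that K(1)]) (use K(2) in auto)
  show "\<not> maximal_Lp_regularity p T V_to_H (ex_form d)" if "1 \<le> p" for p
    by (rule not_maximal_Lp_regularity_ex_form[OF T d that])
  show "frac_sobolev (1/2) q T (u_ex d)" if "2 < q" for q
    by (rule frac_sobolev_half[OF that, of 1]) (simp_all add: norm_path_diff_le)
qed

end
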